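(* Let $W$ be $W_{A_{n-1}}$, $W_{D_n}$ or $W_{B_n}$. The even center $\mathcal Z(\ddot{\mathfrak H}^{\mathfrak c}_W)$ of the rational double affine Hecke-Clifford algebra $\ddot{\mathfrak H}^{\mathfrak c}_W$ contains $\mathbb C[y_1,\dots,y_n]^W$ and $\mathbb C[x_1^2,\dots,x_n^2]^W$ as subalgebras. In particular, $\ddot{\mathfrak H}^{\mathfrak c}_W$ is module-finite over its even center.
   Context: Ground field $\mathbb C$. The even center $\mathcal Z(A)$ of a superalgebra $A$ consists of the even central elements of $A$. Weyl groups. $W_{A_{n-1}}=S_n$ acts on $\mathbb C^n$ by permuting the standard basis $e_1,\dots,e_n$; $W_{B_n}$ ($n\ge 2$) is the group of all signed permutations of the $e_i$; $W_{D_n}$ ($n\ge 4$) is the subgroup with an even number of sign changes. For $i\ne j$: $s_{ij}$ swaps $e_i,e_j$; $\overline{s}_{ij}$ sends $e_i\mapsto -e_j$, $e_j\mapsto -e_i$; $\tau_i$ sends $e_i\mapsto -e_i$ (other basis vectors fixed). $\mathcal C_n$ is the Clifford algebra generated by $c_1,\dots,c_n$ with $c_i^2=1$, $c_ic_j=-c_jc_i$ ($i\ne j$), on which $W$ acts by automorphisms, acting on the $c_i$ as on the $e_i$. Let $\mathfrak h^*=\bigoplus\mathbb Cx_i$, $\mathfrak h=\bigoplus\mathbb Cy_i$ with $W$ acting on the $x_i$ and on the $y_i$ as on the $e_i$; superscript $W$ denotes invariants for the induced actions on $\mathbb C[x_1,\dots,x_n]$, $\mathbb C[y_1,\dots,y_n]$.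 Let $u\in\mathbb C$ (and $v\in\mathbb C$ in type $B_n$). $\ddot{\mathfrak H}^{\mathfrak c}_W$ is generated by $x_i,y_i,c_i$ ($1\le i\le n$) and $W$, subject to the relations of $W$, of $\mathcal C_n$, and: $x_ix_j=x_jx_i$, $y_iy_j=y_jy_i$, $y_ic_j=c_jy_i$ (all $i,j$); $x_ic_i=-c_ix_i$, $x_ic_j=c_jx_i$ ($i\ne j$); $wxw^{-1}=w(x)$, $wyw^{-1}=w(y)$, $wcw^{-1}=w(c)$ ($w\in W$, $x\in\mathfrak h^*$, $y\in\mathfrak h$, $c\in\mathcal C_n$); and (with $[a,b]=ab-ba$) type $A_{n-1}$: $[y_j,x_i]=u(1+c_jc_i)s_{ji}$ ($i\neq j$), $[y_i,x_i]=-u\sum_{k\ne i}(1+c_kc_i)s_{ki}$; type $D_n$: $[y_j,x_i]=u((1+c_jc_i)s_{ij}-(1-c_jc_i)\overline{s}_{ij})$ ($i\ne j$), $[y_i,x_i]=-u\sum_{k\ne i}((1+c_kc_i)s_{ki}+(1-c_kc_i)\overline{s}_{ki})$; type $B_n$: $[y_j,x_i]=u((1+c_jc_i)s_{ij}-(1-c_jc_i)\overline{s}_{ij})$ ($i\ne j$), $[y_i,x_i]=-u\sum_{k\ne i}((1+c_kc_i)s_{ki}+(1-c_kc_i)\overline{s}_{ki})-\sqrt2\,v\tau_i$. It is a superalgebra with $x_i,y_i$ and elements of $W$ even and each $c_i$ odd. *)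

theory Defs
  imports
    "HOL-Analysis.Analysis"
    "HOL-Algebra.QuotRing"
    "HOL-Library.Poly_Mapping"
begin

section \<open>Free algebras\<close>

text \<open>Words, as a type of their own so that concatenation can be the monoid operation.
  Finitely supported functions on words then form the free associative algebra over \<open>\<complex>\<close>
  (convolution product of \<open>Poly_Mapping\<close>).\<close>

datatype 'g word = Word (letters: "'g list")

instantiation word :: (type) monoid_add
begin
definition zero_word :: "'a word" where "0 = Word []"
definition plus_word :: "'a word \<Rightarrow> 'a word \<Rightarrow> 'a word"
  where "a + b = Word (letters a @ letters b)"
instance
  by standard (auto simp: zero_word_def plus_word_def)
end

type_synonym 'g free = "'g word \<Rightarrow>\<^sub>0 complex"

text \<open>The ring structure of the ambient type, restricted to the carrier \<open>S\<close>.\<close>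

definition type_ring :: "'a::ring_1 set \<Rightarrow> 'a ring" where
  "type_ring S = \<lparr>carrier = S, mult = (*), one = 1, zero = 0, add = (+)\<rparr>"

definition free_algebra :: "'g set \<Rightarrow> 'g free ring" where
  "free_algebra G = type_ring {f. \<forall>w\<in>Poly_Mapping.keys f. set (letters w) \<subseteq> G}"

definition gen :: "'g \<Rightarrow> 'g free" where
  "gen g = Poly_Mapping.single (Word [g]) 1"

definition scal :: "complex \<Rightarrow> 'g free" where
  "scal a = Poly_Mapping.single 0 a"

section \<open>Weyl groups, as groups of signed permutation matrices\<close>

text \<open>The matrix of \<open>e\<^sub>i \<mapsto> \<epsilon> i \<cdot> e\<^bsub>\<pi> i\<^esub>\<close> (column \<open>i\<close> is the image of \<open>e\<^sub>i\<close>).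
  The index set \<open>{1,\<dots>,n}\<close> is the finite type \<open>'n\<close>.\<close>

definition signed_perm :: "('n \<Rightarrow> 'n) \<Rightarrow> ('n \<Rightarrow> complex) \<Rightarrow> complex^'n^'n" where
  "signed_perm \<pi> \<epsilon> = (\<chi> j i. if j = \<pi> i then \<epsilon> i else 0)"

datatype weyl_type = Type_A | Type_B | Type_D

text \<open>Here \<open>n\<close> is the number of coordinates; \<open>Type_A\<close> stands for \<open>A\<^bsub>n-1\<^esub>\<close>.\<close>

fun admissible :: "weyl_type \<Rightarrow> nat \<Rightarrow> bool" where
  "admissible Type_A n \<longleftrightarrow> n \<ge> 1"
| "admissible Type_B n \<longleftrightarrow> n \<ge> 2"
| "admissible Type_D n \<longleftrightarrow> n \<ge> 4"

fun weyl_group :: "weyl_type \<Rightarrow> (complex^'n^'n) set" where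
  "weyl_group Type_A = {signed_perm \<pi> (\<lambda>_. 1) | \<pi>. bij \<pi>}"
| "weyl_group Type_B = {signed_perm \<pi> \<epsilon> | \<pi> \<epsilon>. bij \<pi> \<and> range \<epsilon> \<subseteq> {1, -1}}"
| "weyl_group Type_D = {signed_perm \<pi> \<epsilon> | \<pi> \<epsilon>.
     bij \<pi> \<and> range \<epsilon> \<subseteq> {1, -1} \<and> even (card {i. \<epsilon> i = -1})}"

definition s_refl :: "'n \<Rightarrow> 'n \<Rightarrow> complex^'n^'n" where
  "s_refl i j = signed_perm (Transposition.transpose i j) (\<lambda>_. 1)"

definition sbar_refl :: "'n \<Rightarrow> 'n \<Rightarrow> complex^'n^'n" where
  "sbar_refl i j = signed_perm (Transposition.transpose i j) (\<lambda>k. if k \<in> {i, j} then -1 else 1)"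

definition tau_refl :: "'n \<Rightarrow> complex^'n^'n" where
  "tau_refl i = signed_perm id (\<lambda>k. if k = i then -1 else 1)"

section \<open>The rational double affine Hecke-Clifford algebra\<close>

datatype ('n, 'w) rdahc_gen = Xgen 'n | Ygen 'n | Cgen 'n | Wgen 'w

type_synonym 'n rdahc_free = "('n, complex^'n^'n) rdahc_gen free"
type_synonym 'n rdahc = "'n rdahc_free set"

definition rdahc_gens :: "weyl_type \<Rightarrow> ('n, complex^'n^'n) rdahc_gen set" where
  "rdahc_gens T = range Xgen \<union> range Ygen \<union> range Cgen \<union> Wgen ` weyl_group T"

abbreviation rdahc_free_algebra :: "weyl_type \<Rightarrow> 'n::finite rdahc_free ring" where
  "rdahc_free_algebra T \<equiv> free_algebra (rdahc_gens T)"

definition comm :: "'a::ring \<Rightarrow> 'a \<Rightarrow> 'a" where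
  "comm a b = a * b - b * a"

text \<open>With \<open>K\<close> one of \<open>Xgen\<close>, \<open>Ygen\<close>, \<open>Cgen\<close>, the element \<open>\<Sum>\<^sub>i a\<^sub>i K\<^sub>i\<close>; thus \<open>lin K (w *v a)\<close> is the
  result of applying \<open>w\<close> to \<open>lin K a\<close>.\<close>

definition lin :: "('n \<Rightarrow> ('n, complex^'n^'n) rdahc_gen) \<Rightarrow> complex^'n \<Rightarrow> 'n::finite rdahc_free" where
  "lin K a = (\<Sum>i\<in>UNIV. scal (a $ i) * gen (K i))"

text \<open>The prescribed values of \<open>[y\<^sub>j, x\<^sub>i]\<close>, for \<open>i \<noteq> j\<close> and for \<open>i = j\<close>.
  The parameter \<open>v\<close> only occurs in type B.\<close>

fun comm_offdiag :: "weyl_type \<Rightarrow> complex \<Rightarrow> 'n::finite \<Rightarrow> 'n \<Rightarrow> 'n rdahc_free" where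
  "comm_offdiag Type_A u j i =
     scal u * ((1 + gen (Cgen j) * gen (Cgen i)) * gen (Wgen (s_refl j i)))"
| "comm_offdiag _ u j i =
     scal u * ((1 + gen (Cgen j) * gen (Cgen i)) * gen (Wgen (s_refl i j))
             - (1 - gen (Cgen j) * gen (Cgen i)) * gen (Wgen (sbar_refl i j)))"

fun comm_diag :: "weyl_type \<Rightarrow> complex \<Rightarrow> complex \<Rightarrow> 'n::finite \<Rightarrow> 'n rdahc_free" where
  "comm_diag Type_A u v i =
     - (scal u * (\<Sum>k\<in>UNIV - {i}. (1 + gen (Cgen k) * gen (Cgen i)) * gen (Wgen (s_refl k i))))"
| "comm_diag Type_D u v i =
     - (scal u * (\<Sum>k\<in>UNIV - {i}. (1 + gen (Cgen k) * gen (Cgen i)) * gen (Wgen (s_refl k i))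
                              + (1 - gen (Cgen k) * gen (Cgen i)) * gen (Wgen (sbar_refl k i))))"
| "comm_diag Type_B u v i =
     - (scal u * (\<Sum>k\<in>UNIV - {i}. (1 + gen (Cgen k) * gen (Cgen i)) * gen (Wgen (s_refl k i))
                              + (1 - gen (Cgen k) * gen (Cgen i)) * gen (Wgen (sbar_refl k i))))
     - scal (complex_of_real (sqrt 2) * v) * gen (Wgen (tau_refl i))"

text \<open>Each relation \<open>l = r\<close> is recorded as the element \<open>l - r\<close>. The relations of the group
  \<open>weyl_group T\<close> are its multiplication table.\<close>

definition rdahc_rels :: "weyl_type \<Rightarrow> complex \<Rightarrow> complex \<Rightarrow> 'n::finite rdahc_free set" where
  "rdahc_rels T u v =
     {gen (Wgen w) * gen (Wgen w') - gen (Wgen (w ** w')) | w w'. w \<in> weyl_group T \<and> w' \<in> weyl_group T}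
   \<union> {gen (Wgen (mat 1)) - 1}
   \<union> {gen (Cgen i) * gen (Cgen i) - 1 | i. True}
   \<union> {gen (Cgen i) * gen (Cgen j) + gen (Cgen j) * gen (Cgen i) | i j. i \<noteq> j}
   \<union> {comm (gen (Xgen i)) (gen (Xgen j)) | i j. True}
   \<union> {comm (gen (Ygen i)) (gen (Ygen j)) | i j. True}
   \<union> {comm (gen (Ygen i)) (gen (Cgen j)) | i j. True}
   \<union> {gen (Xgen i) * gen (Cgen i) + gen (Cgen i) * gen (Xgen i) | i. True}
   \<union> {comm (gen (Xgen i)) (gen (Cgen j)) | i j. i \<noteq> j}
   \<union> {gen (Wgen w) * lin K a * gen (Wgen (matrix_inv w)) - lin K (w *v a) | w K a.
        w \<in> weyl_group T \<and> K \<in> {Xgen, Ygen, Cgen}}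
   \<union> {comm (gen (Ygen j)) (gen (Xgen i)) - comm_offdiag T u j i | i j. i \<noteq> j}
   \<union> {comm (gen (Ygen i)) (gen (Xgen i)) - comm_diag T u v i | i. True}"

definition rdahc_ideal :: "weyl_type \<Rightarrow> complex \<Rightarrow> complex \<Rightarrow> 'n::finite rdahc_free set" where
  "rdahc_ideal T u v = genideal (rdahc_free_algebra T) (rdahc_rels T u v)"

definition rdahc_algebra :: "weyl_type \<Rightarrow> complex \<Rightarrow> complex \<Rightarrow> 'n::finite rdahc ring" where
  "rdahc_algebra T u v = rdahc_free_algebra T Quot rdahc_ideal T u v"

definition rdahc_class :: "weyl_type \<Rightarrow> complex \<Rightarrow> complex \<Rightarrow> 'n::finite rdahc_free \<Rightarrow> 'n rdahc" where
  "rdahc_class T u v f = rdahc_ideal T u v +>\<^bsub>rdahc_free_algebra T\<^esub> f"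

text \<open>The even part for the grading in which exactly the generators \<open>Cgen i\<close> are odd.\<close>

fun is_odd_gen :: "('n, 'w) rdahc_gen \<Rightarrow> bool" where
  "is_odd_gen (Cgen _) = True"
| "is_odd_gen _ = False"

definition rdahc_even_part :: "weyl_type \<Rightarrow> complex \<Rightarrow> complex \<Rightarrow> 'n::finite rdahc set" where
  "rdahc_even_part T u v = rdahc_class T u v `
     {f \<in> carrier (rdahc_free_algebra T).
        \<forall>w\<in>Poly_Mapping.keys f. even (length (filter is_odd_gen (letters w)))}"

definition rdahc_even_center :: "weyl_type \<Rightarrow> complex \<Rightarrow> complex \<Rightarrow> 'n::finite rdahc set" where
  "rdahc_even_center T u v = {z \<in> rdahc_even_part T u v. \<forall>a\<in>carrier (rdahc_algebra T u v).
     z \<otimes>\<^bsub>rdahc_algebra T u v\<^esub> a = a \<otimes>\<^bsub>rdahc_algebra T u v\<^esub> z}"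

definition module_finite_over :: "('a, 'b) ring_scheme \<Rightarrow> 'a set \<Rightarrow> bool" where
  "module_finite_over R Z \<longleftrightarrow> (\<exists>S. finite S \<and> S \<subseteq> carrier R \<and>
     (\<forall>a\<in>carrier R. \<exists>z\<in>S \<rightarrow> Z. a = (\<Oplus>\<^bsub>R\<^esub>s\<in>S. z s \<otimes>\<^bsub>R\<^esub> s)))"

section \<open>Invariant polynomials\<close>

type_synonym 'n mpoly = "('n \<Rightarrow>\<^sub>0 nat) \<Rightarrow>\<^sub>0 complex"

definition mconst :: "complex \<Rightarrow> 'n mpoly" where
  "mconst a = Poly_Mapping.single 0 a"

definition mvar :: "'n \<Rightarrow> 'n mpoly" where
  "mvar i = Poly_Mapping.single (Poly_Mapping.single i 1) 1"

definition msubst :: "('n::finite \<Rightarrow> 'n mpoly) \<Rightarrow> 'n mpoly \<Rightarrow> 'n mpoly" where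
  "msubst g p = (\<Sum>m\<in>Poly_Mapping.keys p. mconst (Poly_Mapping.lookup p m) *
     (\<Prod>i\<in>UNIV. g i ^ Poly_Mapping.lookup m i))"

definition mact :: "complex^'n^'n \<Rightarrow> 'n::finite mpoly \<Rightarrow> 'n mpoly" where
  "mact w = msubst (\<lambda>i. \<Sum>j\<in>UNIV. mconst (w $ j $ i) * mvar j)"

definition invariants :: "weyl_type \<Rightarrow> 'n::finite mpoly set" where
  "invariants T = {p. \<forall>w\<in>weyl_group T. mact w p = p}"

definition square_invariants :: "weyl_type \<Rightarrow> 'n::finite mpoly set" where
  "square_invariants T = invariants T \<inter> range (msubst (\<lambda>i. mvar i ^ 2))"

text \<open>\<open>\<phi>\<close> is the \<open>\<complex>\<close>-algebra homomorphism from the polynomial ring to the Hecke-Clifford algebra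
  that sends the \<open>i\<close>-th variable to the class of \<open>K i\<close>; it is uniquely determined by this.\<close>

definition is_eval_hom :: "weyl_type \<Rightarrow> complex \<Rightarrow> complex \<Rightarrow>
    ('n \<Rightarrow> ('n, complex^'n^'n) rdahc_gen) \<Rightarrow> ('n::finite mpoly \<Rightarrow> 'n rdahc) \<Rightarrow> bool" where
  "is_eval_hom T u v K \<phi> \<longleftrightarrow>
     \<phi> \<in> ring_hom (type_ring UNIV) (rdahc_algebra T u v) \<and>
     (\<forall>a. \<phi> (mconst a) = rdahc_class T u v (scal a)) \<and>
     (\<forall>i. \<phi> (mvar i) = rdahc_class T u v (gen (K i)))"

text \<open>The subalgebra \<open>P\<close> of the polynomial ring is a subalgebra of the even center, the \<open>i\<close>-th
  variable being identified with the class of \<open>K i\<close>. Injectivity is part of this: \<open>P\<close> consists of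
  abstract polynomials.\<close>

definition embeds_in_even_center :: "weyl_type \<Rightarrow> complex \<Rightarrow> complex \<Rightarrow>
    ('n \<Rightarrow> ('n, complex^'n^'n) rdahc_gen) \<Rightarrow> 'n::finite mpoly set \<Rightarrow> bool" where
  "embeds_in_even_center T u v K P \<longleftrightarrow>
     (\<exists>\<phi>. is_eval_hom T u v K \<phi> \<and> inj_on \<phi> P \<and> \<phi> ` P \<subseteq> rdahc_even_center T u v)"

section \<open>Well-definedness\<close>

text \<open>All relations lie in the free algebra on the chosen generators, so that the generated ideal
  is an ideal and the quotient is a ring.\<close>

lemma free_algebra_carrier_iff:
  "f \<in> carrier (free_algebra G) \<longleftrightarrow> (\<forall>w\<in>Poly_Mapping.keys f. set (letters w) \<subseteq> G)"
  by (simp add: free_algebra_def type_ring_def)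

lemma free_algebra_simps [simp]:
  "f \<otimes>\<^bsub>free_algebra G\<^esub> g = f * g" "f \<oplus>\<^bsub>free_algebra G\<^esub> g = f + g"
  "\<one>\<^bsub>free_algebra G\<^esub> = 1" "\<zero>\<^bsub>free_algebra G\<^esub> = 0"
  by (simp_all add: free_algebra_def type_ring_def)

lemma free_algebra_closed:
  shows "0 \<in> carrier (free_algebra G)" "1 \<in> carrier (free_algebra G)"
    and "scal a \<in> carrier (free_algebra G)"
    and "g \<in> G \<Longrightarrow> gen g \<in> carrier (free_algebra G)"
    and "f \<in> carrier (free_algebra G) \<Longrightarrow> h \<in> carrier (free_algebra G) \<Longrightarrow> f + h \<in> carrier (free_algebra G)"
    and "f \<in> carrier (free_algebra G) \<Longrightarrow> h \<in> carrier (free_algebra G) \<Longrightarrow> f * h \<in> carrier (free_algebra G)"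
    and "f \<in> carrier (free_algebra G) \<Longrightarrow> - f \<in> carrier (free_algebra G)"
    and "f \<in> carrier (free_algebra G) \<Longrightarrow> h \<in> carrier (free_algebra G) \<Longrightarrow> f - h \<in> carrier (free_algebra G)"
proof -
  show add: "f \<in> carrier (free_algebra G) \<Longrightarrow> h \<in> carrier (free_algebra G) \<Longrightarrow> f + h \<in> carrier (free_algebra G)" for f h
    using Poly_Mapping.keys_add[of f h] unfolding free_algebra_carrier_iff by blast
  show neg: "f \<in> carrier (free_algebra G) \<Longrightarrow> - f \<in> carrier (free_algebra G)" for f
    unfolding free_algebra_carrier_iff by simp
  show "f \<in> carrier (free_algebra G) \<Longrightarrow> h \<in> carrier (free_algebra G) \<Longrightarrow> f - h \<in> carrier (free_algebra G)"
    using add[of f "-h"] neg[of h] by simp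
  show "f \<in> carrier (free_algebra G) \<Longrightarrow> h \<in> carrier (free_algebra G) \<Longrightarrow> f * h \<in> carrier (free_algebra G)"
    using keys_mult[of f h] unfolding free_algebra_carrier_iff by (fastforce simp: plus_word_def)
qed (auto simp: free_algebra_carrier_iff scal_def gen_def zero_word_def simp flip: single_one split: if_splits)

lemma ring_free_algebra: "ring (free_algebra G)"
proof (rule ringI)
  show "abelian_group (free_algebra G)"
  proof (rule abelian_groupI)
    fix f assume "f \<in> carrier (free_algebra G)"
    then show "\<exists>h\<in>carrier (free_algebra G). h \<oplus>\<^bsub>free_algebra G\<^esub> f = \<zero>\<^bsub>free_algebra G\<^esub>"
      by (intro bexI[of _ "-f"]) (auto simp: free_algebra_closed)
  qed (auto simp: free_algebra_closed algebra_simps)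
  show "monoid (free_algebra G)"
    by (rule monoidI) (auto simp: free_algebra_closed algebra_simps)
qed (auto simp: algebra_simps)

lemma free_algebra_sum_closed:
  "(\<And>i. i \<in> I \<Longrightarrow> f i \<in> carrier (free_algebra G)) \<Longrightarrow> sum f I \<in> carrier (free_algebra G)"
  by (induction I rule: infinite_finite_induct) (auto simp: free_algebra_closed)

lemma signed_perm_mult:
  "signed_perm \<pi> \<epsilon> ** signed_perm \<rho> \<delta> = signed_perm (\<pi> \<circ> \<rho>) (\<lambda>i. \<delta> i * \<epsilon> (\<rho> i))"
  by (auto simp: signed_perm_def matrix_matrix_mult_def vec_eq_iff if_distrib[of "\<lambda>x. x * _"]
      if_distrib[of "\<lambda>x. _ * x"] cong: if_cong)

lemma mat_1_eq_signed_perm: "mat 1 = signed_perm id (\<lambda>_. 1)"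
  by (simp add: mat_def signed_perm_def)

lemma even_card_signs:
  fixes \<epsilon> :: "'n::finite \<Rightarrow> complex"
  assumes "range \<epsilon> \<subseteq> {1, -1}"
  shows "even (card {i. \<epsilon> i = -1}) \<longleftrightarrow> (\<Prod>i\<in>UNIV. \<epsilon> i) = 1"
proof -
  have "(\<Prod>i\<in>UNIV. \<epsilon> i) = (\<Prod>i\<in>UNIV. if i \<in> {i. \<epsilon> i = -1} then -1 else 1)"
    by (rule prod.cong) (use assms in auto)
  also have "\<dots> = (-1) ^ card {i. \<epsilon> i = -1}"
    by (subst prod.If_cases) (auto simp: prod_constant)
  finally show ?thesis
    by (cases "even (card {i. \<epsilon> i = -1})") auto
qed

lemma weyl_group_D_iff:
  "weyl_group Type_D = {signed_perm \<pi> \<epsilon> | \<pi> \<epsilon>.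
     bij \<pi> \<and> range \<epsilon> \<subseteq> {1, -1} \<and> (\<Prod>i\<in>UNIV. \<epsilon> i) = 1}"
  using even_card_signs by (simp only: weyl_group.simps) blast

lemma signed_perm_in_weyl_group:
  assumes "bij \<pi>" "range \<epsilon> \<subseteq> {1, -1}"
  shows "signed_perm \<pi> \<epsilon> \<in> weyl_group Type_B"
    and "(\<Prod>i\<in>UNIV. \<epsilon> i) = 1 \<Longrightarrow> signed_perm \<pi> \<epsilon> \<in> weyl_group Type_D"
  unfolding weyl_group_D_iff using assms by auto

lemma weyl_group_one: "mat 1 \<in> weyl_group T"
  by (cases T) (auto simp: mat_1_eq_signed_perm intro!: exI[of _ id] exI[of _ "\<lambda>_. 1"])

lemma weyl_group_mult:
  assumes "w \<in> weyl_group T" "w' \<in> weyl_group T"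
  shows "w ** w' \<in> weyl_group T"
proof -
  have sgn: "range (\<lambda>i. \<delta> i * \<epsilon> (\<rho> i)) \<subseteq> {1, -1}"
    if "range \<epsilon> \<subseteq> {1, -1}" "range \<delta> \<subseteq> {1, -1}" for \<epsilon> \<delta> :: "'n \<Rightarrow> complex" and \<rho>
  proof (rule image_subsetI)
    fix i
    have "\<delta> i \<in> {1, -1}" "\<epsilon> (\<rho> i) \<in> {1, -1}" using that by blast+
    then show "\<delta> i * \<epsilon> (\<rho> i) \<in> {1, -1}" by auto
  qed
  have prd: "(\<Prod>i\<in>UNIV. \<delta> i * \<epsilon> (\<rho> i)) = 1"
    if "bij \<rho>" "(\<Prod>i\<in>UNIV. \<epsilon> i) = 1" "(\<Prod>i\<in>UNIV. \<delta> i) = 1" for \<epsilon> \<delta> :: "'n \<Rightarrow> complex" and \<rho>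
    using that prod.reindex_bij_betw[of \<rho> UNIV UNIV \<epsilon>] by (simp add: prod.distrib)
  show ?thesis
  proof (cases T)
    case Type_A
    then show ?thesis using assms by (auto simp: signed_perm_mult intro!: bij_comp)
  next
    case Type_B
    with assms obtain \<pi> \<epsilon> \<rho> \<delta> where "w = signed_perm \<pi> \<epsilon>" "w' = signed_perm \<rho> \<delta>" "bij \<pi>" "bij \<rho>"
      "range \<epsilon> \<subseteq> {1, -1}" "range \<delta> \<subseteq> {1, -1}" by auto
    with sgn[of \<epsilon> \<delta> \<rho>] Type_B show ?thesis
      by (simp only: signed_perm_mult bij_comp signed_perm_in_weyl_group)
  next
    case Type_D
    with assms obtain \<pi> \<epsilon> \<rho> \<delta> where "w = signed_perm \<pi> \<epsilon>" "w' = signed_perm \<rho> \<delta>" "bij \<pi>" "bij \<rho>"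
      "range \<epsilon> \<subseteq> {1, -1}" "range \<delta> \<subseteq> {1, -1}" "prod \<epsilon> UNIV = 1" "prod \<delta> UNIV = 1" 
      unfolding Type_D weyl_group_D_iff by auto
    with sgn[of \<epsilon> \<delta> \<rho>] prd[of \<rho> \<epsilon> \<delta>] Type_D show ?thesis
      by (simp only: signed_perm_mult bij_comp signed_perm_in_weyl_group)
  qed
qed

lemma signed_perm_inverse:
  assumes "bij \<pi>" "range \<epsilon> \<subseteq> {1, -1}"
  shows "matrix_inv (signed_perm \<pi> \<epsilon>) = signed_perm (inv_into UNIV \<pi>) (\<lambda>i. \<epsilon> (inv_into UNIV \<pi> i))"
proof -
  have e: "\<epsilon> i * \<epsilon> i = 1" for i
  proof -
    have "\<epsilon> i \<in> {1, -1}" using assms(2) by blast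
    then show ?thesis by auto
  qed
  have l: "signed_perm \<pi> \<epsilon> ** signed_perm (inv_into UNIV \<pi>) (\<lambda>i. \<epsilon> (inv_into UNIV \<pi> i)) = mat 1"
    using e surj_iff[THEN iffD1, OF bij_is_surj[OF assms(1)]]
    by (simp only: signed_perm_mult mat_1_eq_signed_perm id_def)
  then have r: "signed_perm (inv_into UNIV \<pi>) (\<lambda>i. \<epsilon> (inv_into UNIV \<pi> i)) ** signed_perm \<pi> \<epsilon> = mat 1"
    by (simp add: matrix_left_right_inverse)
  have "signed_perm \<pi> \<epsilon> ** matrix_inv (signed_perm \<pi> \<epsilon>) = mat 1"
    unfolding matrix_inv_def by (rule someI2_ex) (use l r in auto)
  then show ?thesis
    by (metis r matrix_mul_assoc matrix_mul_lid matrix_mul_rid)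
qed

lemma weyl_group_inverse:
  assumes "w \<in> weyl_group T"
  shows "matrix_inv w \<in> weyl_group T"
proof -
  have rng: "range (\<lambda>i. \<epsilon> (\<rho> i)) \<subseteq> {1, -1}" if "range \<epsilon> \<subseteq> {1, -1}" for \<epsilon> :: "'n \<Rightarrow> complex" and \<rho>
    using that by auto
  show ?thesis
  proof (cases T)
    case Type_A
    then show ?thesis using assms by (auto simp: signed_perm_inverse bij_imp_bij_inv)
  next
    case Type_B
    with assms obtain \<pi> \<epsilon> where "w = signed_perm \<pi> \<epsilon>" "bij \<pi>" "range \<epsilon> \<subseteq> {1, -1}" by auto
    with rng[of \<epsilon> "inv_into UNIV \<pi>"] Type_B show ?thesis
      by (simp only: signed_perm_inverse bij_imp_bij_inv signed_perm_in_weyl_group)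
  next
    case Type_D
    with assms obtain \<pi> \<epsilon> where *: "w = signed_perm \<pi> \<epsilon>" "bij \<pi>" "range \<epsilon> \<subseteq> {1, -1}" "prod \<epsilon> UNIV = 1"
      unfolding Type_D weyl_group_D_iff by auto
    have "(\<Prod>i\<in>UNIV. \<epsilon> (inv_into UNIV \<pi> i)) = 1"
      using * prod.reindex_bij_betw[of "inv_into UNIV \<pi>" UNIV UNIV \<epsilon>] by (simp add: bij_imp_bij_inv)
    with * rng[of \<epsilon> "inv_into UNIV \<pi>"] Type_D show ?thesis
      by (simp only: signed_perm_inverse bij_imp_bij_inv signed_perm_in_weyl_group)
  qed
qed

lemma reflections_in_weyl_group:
  fixes i j :: "'n::finite"
  shows "s_refl i j \<in> weyl_group T"
    and "i \<noteq> j \<Longrightarrow> T \<noteq> Type_A \<Longrightarrow> sbar_refl i j \<in> weyl_group T"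
    and "tau_refl i \<in> weyl_group Type_B"
proof -
  let ?t = "Transposition.transpose i j" and ?e = "\<lambda>k. if k \<in> {i, j} then -1 else (1::complex)"
  have t: "bij ?t" by (rule involuntory_imp_bij) simp
  show "s_refl i j \<in> weyl_group T"
    unfolding s_refl_def
  proof (cases T)
    case Type_A
    with t show "signed_perm ?t (\<lambda>_. 1) \<in> weyl_group T" by auto
  next
    case Type_B
    have "range (\<lambda>_::'n. 1::complex) \<subseteq> {1, -1}" by auto
    with t Type_B show "signed_perm ?t (\<lambda>_. 1) \<in> weyl_group T"
      by (simp only: signed_perm_in_weyl_group)
  next
    case Type_D
    have "range (\<lambda>_::'n. 1::complex) \<subseteq> {1, -1}" "(\<Prod>_\<in>(UNIV::'n set). 1::complex) = 1" by auto
    with t Type_D show "signed_perm ?t (\<lambda>_. 1) \<in> weyl_group T"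
      by (simp only: signed_perm_in_weyl_group)
  qed
  have e: "range ?e \<subseteq> {1, -1}" by auto
  show "sbar_refl i j \<in> weyl_group T" if "i \<noteq> j" "T \<noteq> Type_A"
  proof -
    have "{k. ?e k = -1} = {i, j}" by auto
    then have "even (card {k. ?e k = -1})" using that(1) by (simp only:) simp
    then have "(\<Prod>k\<in>UNIV. ?e k) = 1" using even_card_signs[OF e] by (simp only:)
    with t e that(2) show ?thesis
      unfolding sbar_refl_def by (cases T) (simp_all only: signed_perm_in_weyl_group not_True_eq_False simp_thms)
  qed
  have "range (\<lambda>k. if k = i then -1 else (1::complex)) \<subseteq> {1, -1}" by auto
  then show "tau_refl i \<in> weyl_group Type_B"
    unfolding tau_refl_def by (rule signed_perm_in_weyl_group(1)[OF bij_id])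
qed

lemma rdahc_gens_closed:
  "gen (Xgen i) \<in> carrier (rdahc_free_algebra T)" "gen (Ygen i) \<in> carrier (rdahc_free_algebra T)"
  "gen (Cgen i) \<in> carrier (rdahc_free_algebra T)"
  "w \<in> weyl_group T \<Longrightarrow> gen (Wgen w) \<in> carrier (rdahc_free_algebra T)"
  by (auto intro!: free_algebra_closed(4) simp: rdahc_gens_def)

lemma rdahc_rels_closed: "rdahc_rels T u v \<subseteq> carrier (rdahc_free_algebra T)"
proof -
  have lin: "K \<in> {Xgen, Ygen, Cgen} \<Longrightarrow> lin K a \<in> carrier (rdahc_free_algebra T)" for K a
    unfolding lin_def by (rule free_algebra_sum_closed) (auto intro!: free_algebra_closed(6,3) rdahc_gens_closed)
  have off: "comm_offdiag T u j i \<in> carrier (rdahc_free_algebra T)" if "i \<noteq> j" for i j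
    using that by (cases T) (auto intro!: free_algebra_closed(2,3,5-8) rdahc_gens_closed
      reflections_in_weyl_group simp del: weyl_group.simps)
  have diag: "comm_diag T u v i \<in> carrier (rdahc_free_algebra T)" for i
    by (cases T) (auto intro!: free_algebra_closed(2,3,5-8) free_algebra_sum_closed rdahc_gens_closed
      reflections_in_weyl_group simp del: weyl_group.simps)
  show ?thesis
  proof
    fix f assume "f \<in> rdahc_rels T u v"
    then show "f \<in> carrier (rdahc_free_algebra T)"
      unfolding rdahc_rels_def comm_def
      by (elim UnE CollectE exE conjE singletonE; hypsubst)
        (rule free_algebra_closed(2,5-8) rdahc_gens_closed lin off diag weyl_group_one
          weyl_group_mult weyl_group_inverse | assumption)+
  qed
qed

lemma ring_rdahc_algebra: "ring (rdahc_algebra T u v)"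
  unfolding rdahc_algebra_def rdahc_ideal_def
  by (intro ideal.quotient_is_ring ring.genideal_ideal ring_free_algebra rdahc_rels_closed)

end

theory Submission
  imports Defs
begin

text \<open>Write \<open>z\<^sub>1, \<dots>, z\<^sub>n\<close> for one of the two families \<open>y\<^sub>i\<close>, \<open>x\<^sub>i\<close> and \<open>d\<^sub>1, \<dots>, d\<^sub>n\<close> for the other.
  By the twisted Leibniz rule, \<open>[d\<^sub>i, f(z)]\<close> is a sum of divided differences
  \<open>(f - s f) / \<alpha>\<^sub>s\<close> of \<open>f\<close> times elements of the group algebra of \<open>W\<close> over the Clifford algebra.
  These vanish when \<open>f\<close> is invariant under \<open>W\<close> and, for \<open>z = x\<close>, under all sign changes, which are
  the effect of moving \<open>c\<^sub>i\<close> past \<open>f\<close>; hence the invariants are central. Conversely the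
  formula defines operators \<open>d\<^sub>i\<close> on polynomials in \<open>z\<close> with values in a module of the Clifford algebra
  extended by \<open>W\<close>. They kill constants, so that an operator commuting with all \<open>z\<^sub>l\<close> and killing
  constants vanishes, and \<open>[d\<^sub>i, d\<^sub>j] = 0\<close> reduces to the Jacobi identity. In this representation
  \<open>f(z)\<close> sends the constant \<open>1\<close> to \<open>f\<close>, which gives injectivity. Finally, reordering shows that the algebra
  is spanned by the products \<open>f(x) g(y) c w\<close>, and every \<open>z\<^sub>i\<close> is a root of \<open>\<Prod>\<^sub>j (t\<^sup>2 - z\<^sub>j\<^sup>2)\<close>, whose
  coefficients are central.\<close>

section \<open>Congruence modulo a two-sided ideal\<close>

text \<open>An algebra given by generators and relations might collapse, and computing with
  relations cannot show that distinct polynomials stay distinct. For explicit Dunkl operators the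
  laborious identity is [d_i, d_j] = 0. The criterion that an operator killing constants vanishes
  once it passes all variables replaces this computation, and it tolerates passing a variable up to
  a scalar and a change of index, so that it also yields the relations of d_i with the c_l and with
  W. The families differ only through the Clifford part: every c_j commutes with all y_i, whereas
  c_k c_i negates x_k and x_i. Thus [y_i, f(x)] involves divided differences for both signs of a
  reflection even in type A, which is why squares appear for x and not for y. The flag
  \<open>\<eta>\<close> carries both cases through one argument. Computations take place in the
  whole free algebra modulo a two-sided ideal, so that ordinary ring rewriting applies before
  anything is passed to the quotient.\<close>

locale ring_congruence =
  fixes J :: "'a::ring_1 set"
  assumes zero_mem: "0 \<in> J"
    and add_mem: "a \<in> J \<Longrightarrow> b \<in> J \<Longrightarrow> a + b \<in> J"
    and mult_left_mem: "a \<in> J \<Longrightarrow> x * a \<in> J"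
    and mult_right_mem: "a \<in> J \<Longrightarrow> a * x \<in> J"
begin

definition eqv :: "'a \<Rightarrow> 'a \<Rightarrow> bool" (infix \<open>\<doteq>\<close> 50) where
  "a \<doteq> b \<longleftrightarrow> a - b \<in> J"

lemma uminus_mem: "a \<in> J \<Longrightarrow> - a \<in> J"
  using mult_left_mem[of a "-1"] by simp

lemma eqv_refl [simp, intro]: "a \<doteq> a"
  by (simp add: eqv_def zero_mem)

lemma eqv_sym: "a \<doteq> b \<Longrightarrow> b \<doteq> a"
  unfolding eqv_def using uminus_mem[of "a - b"] by simp

lemma eqv_trans [trans]: "a \<doteq> b \<Longrightarrow> b \<doteq> c \<Longrightarrow> a \<doteq> c"
  unfolding eqv_def using add_mem[of "a - b" "b - c"] by simp

lemma eqv_add: "a \<doteq> b \<Longrightarrow> c \<doteq> d \<Longrightarrow> a + c \<doteq> b + d"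
  unfolding eqv_def using add_mem[of "a - b" "c - d"] by (simp add: algebra_simps)

lemma eqv_minus: "a \<doteq> b \<Longrightarrow> - a \<doteq> - b"
  unfolding eqv_def using uminus_mem[of "a - b"] by (simp add: algebra_simps)

lemma eqv_diff: "a \<doteq> b \<Longrightarrow> c \<doteq> d \<Longrightarrow> a - c \<doteq> b - d"
  using eqv_add[OF _ eqv_minus, of a b c d] by simp

lemma eqv_mult: "a \<doteq> b \<Longrightarrow> c \<doteq> d \<Longrightarrow> a * c \<doteq> b * d"
  unfolding eqv_def using add_mem[OF mult_right_mem[of "a - b" c] mult_left_mem[of "c - d" b]]
  by (simp add: algebra_simps)

lemma eqv_sum: "(\<And>i. i \<in> A \<Longrightarrow> f i \<doteq> g i) \<Longrightarrow> sum f A \<doteq> sum g A"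
  by (induction A rule: infinite_finite_induct) (auto intro: eqv_add)

lemma eqv_eq_trans [trans]: "a \<doteq> b \<Longrightarrow> b = c \<Longrightarrow> a \<doteq> c"
  and eq_eqv_trans [trans]: "a = b \<Longrightarrow> b \<doteq> c \<Longrightarrow> a \<doteq> c"
  by simp_all

lemma eqv_power_commute: "x * a \<doteq> a * x \<Longrightarrow> x * a ^ k \<doteq> a ^ k * x"
proof (induction k)
  case (Suc k)
  have "x * a ^ Suc k = (x * a) * a ^ k" by (simp add: mult.assoc)
  also have "\<dots> \<doteq> (a * x) * a ^ k" using Suc.prems by (rule eqv_mult) auto
  also have "\<dots> = a * (x * a ^ k)" by (simp add: mult.assoc)
  also have "\<dots> \<doteq> a * (a ^ k * x)" by (rule eqv_mult) (auto intro: Suc)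
  finally show ?case by (simp add: mult.assoc)
qed simp

lemma eqv_prod_list_commute:
  "(\<And>b. b \<in> set bs \<Longrightarrow> a * b \<doteq> b * a) \<Longrightarrow> a * prod_list bs \<doteq> prod_list bs * a"
proof (induction bs)
  case (Cons b bs)
  have "a * prod_list (b # bs) = (a * b) * prod_list bs" by (simp add: mult.assoc)
  also have "\<dots> \<doteq> (b * a) * prod_list bs" using Cons.prems by (rule eqv_mult) auto
  also have "\<dots> = b * (a * prod_list bs)" by (simp add: mult.assoc)
  also have "\<dots> \<doteq> b * (prod_list bs * a)" using Cons.IH Cons.prems by (intro eqv_mult[OF eqv_refl]) auto
  finally show ?case by (simp add: mult.assoc)
qed simp

end

text \<open>Congruence modulo the zero ideal is equality, so a statement up to congruence contains
  its exact version; \<open>lin_ext_mult\<close> is obtained in this way.\<close>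

lemma ring_congruence_zero: "ring_congruence {0}"
  by unfold_locales auto

section \<open>Linear extension of multiplicative maps on monomials\<close>

lemma poly_mapping_sum_singles:
  "f = (\<Sum>m\<in>Poly_Mapping.keys f. Poly_Mapping.single m (Poly_Mapping.lookup f m))"
proof (rule poly_mapping_eqI)
  fix k
  have "(\<Sum>m\<in>Poly_Mapping.keys f. Poly_Mapping.lookup (Poly_Mapping.single m (Poly_Mapping.lookup f m)) k)
    = (\<Sum>m\<in>Poly_Mapping.keys f. if m = k then Poly_Mapping.lookup f k else 0)"
    by (rule sum.cong) (auto simp: lookup_single when_def)
  then show "Poly_Mapping.lookup f k =
    Poly_Mapping.lookup (\<Sum>m\<in>Poly_Mapping.keys f. Poly_Mapping.single m (Poly_Mapping.lookup f m)) k"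
    by (simp add: lookup_sum in_keys_iff)
qed

text \<open>A complex algebra is given by a ring homomorphism from the scalars into the center.
  Polynomials, the free algebra and the operators of the representation are instances and share
  \<open>lin_ext\<close>.\<close>

locale central_scalars =
  fixes sc :: "complex \<Rightarrow> 'a::ring_1"
  assumes sc_add: "sc (a + b) = sc a + sc b"
    and sc_mult: "sc (a * b) = sc a * sc b"
    and sc_1 [simp]: "sc 1 = 1"
    and sc_commute: "x * sc a = sc a * x"
begin

lemma sc_0 [simp]: "sc 0 = 0"
proof -
  have "sc 0 = sc 0 + sc 0" by (metis add_0 sc_add)
  then show ?thesis by (metis add_cancel_right_left)
qed

lemma sc_minus: "sc (- a) = - sc a"
  by (rule minus_unique[symmetric]) (simp flip: sc_add)

lemma sc_sum: "sc (sum f A) = (\<Sum>i\<in>A. sc (f i))"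
  by (induction A rule: infinite_finite_induct) (auto simp: sc_add)

lemma sc_left_commute: "x * (sc a * y) = sc a * (x * y)"
  by (simp only: mult.assoc[symmetric] sc_commute[of x])

definition lin_ext :: "('m \<Rightarrow> 'a) \<Rightarrow> ('m \<Rightarrow>\<^sub>0 complex) \<Rightarrow> 'a" where
  "lin_ext h f = (\<Sum>m\<in>Poly_Mapping.keys f. sc (Poly_Mapping.lookup f m) * h m)"

lemma lin_ext_superset:
  assumes "finite A" "Poly_Mapping.keys f \<subseteq> A"
  shows "lin_ext h f = (\<Sum>m\<in>A. sc (Poly_Mapping.lookup f m) * h m)"
  unfolding lin_ext_def
  by (rule sum.mono_neutral_left) (use assms in \<open>auto simp: in_keys_iff\<close>)

lemma lin_ext_0 [simp]: "lin_ext h 0 = 0"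
  by (simp add: lin_ext_def)

lemma lin_ext_single [simp]: "lin_ext h (Poly_Mapping.single m a) = sc a * h m"
  by (simp add: lin_ext_def)

lemma lin_ext_add: "lin_ext h (f + g) = lin_ext h f + lin_ext h g"
proof -
  let ?A = "Poly_Mapping.keys f \<union> Poly_Mapping.keys g"
  have "lin_ext h (f + g) = (\<Sum>m\<in>?A. sc (Poly_Mapping.lookup (f + g) m) * h m)"
    by (rule lin_ext_superset) (auto simp: Poly_Mapping.keys_add)
  also have "\<dots> = (\<Sum>m\<in>?A. sc (Poly_Mapping.lookup f m) * h m) + (\<Sum>m\<in>?A. sc (Poly_Mapping.lookup g m) * h m)"
    by (simp add: lookup_add sc_add algebra_simps sum.distrib)
  also have "\<dots> = lin_ext h f + lin_ext h g"
    by (simp add: lin_ext_superset[of ?A])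
  finally show ?thesis .
qed

lemma lin_ext_sum: "lin_ext h (sum f A) = (\<Sum>i\<in>A. lin_ext h (f i))"
  by (induction A rule: infinite_finite_induct) (auto simp: lin_ext_add)

lemma lin_ext_minus: "lin_ext h (- f) = - lin_ext h f"
  by (rule minus_unique[symmetric]) (simp flip: lin_ext_add)

lemma lin_ext_diff: "lin_ext h (f - g) = lin_ext h f - lin_ext h g"
  by (metis diff_conv_add_uminus lin_ext_add lin_ext_minus)

text \<open>By bilinearity monomials suffice. Only a congruence is assumed for them, because an
  ordered product of noncommuting variables is multiplicative only after a reordering that uses the
  relations.\<close>

lemma lin_ext_mult_eqv:
  fixes f g :: "'m::monoid_add \<Rightarrow>\<^sub>0 complex"
  assumes J: "ring_congruence J"
    and h: "\<And>m m'. ring_congruence.eqv J (h (m + m')) (h m * h m')"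
  shows "ring_congruence.eqv J (lin_ext h (f * g)) (lin_ext h f * lin_ext h g)"
proof -
  interpret ring_congruence J by (rule J)
  let ?s = "\<lambda>f m. Poly_Mapping.single m (Poly_Mapping.lookup f m)"
  let ?F = "Poly_Mapping.keys f" and ?G = "Poly_Mapping.keys g"
  have "f * g = (\<Sum>m\<in>?F. ?s f m) * (\<Sum>m\<in>?G. ?s g m)"
    by (simp only: poly_mapping_sum_singles[symmetric])
  also have "\<dots> = (\<Sum>m\<in>?F. \<Sum>m'\<in>?G. Poly_Mapping.single (m + m') (Poly_Mapping.lookup f m * Poly_Mapping.lookup g m'))"
    by (simp add: sum_product mult_single)
  finally have "lin_ext h (f * g) = (\<Sum>m\<in>?F. \<Sum>m'\<in>?G.
      sc (Poly_Mapping.lookup f m) * sc (Poly_Mapping.lookup g m') * h (m + m'))"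
    by (simp add: lin_ext_sum sc_mult)
  also have "\<dots> \<doteq> (\<Sum>m\<in>?F. \<Sum>m'\<in>?G.
      sc (Poly_Mapping.lookup f m) * sc (Poly_Mapping.lookup g m') * (h m * h m'))"
    by (intro eqv_sum eqv_mult eqv_refl h)
  also have "\<dots> = (\<Sum>m\<in>?F. \<Sum>m'\<in>?G.
      sc (Poly_Mapping.lookup f m) * h m * (sc (Poly_Mapping.lookup g m') * h m'))"
    by (simp only: mult.assoc sc_left_commute[of "h _"])
  also have "\<dots> = lin_ext h f * lin_ext h g"
    by (simp add: lin_ext_def sum_product)
  finally show ?thesis .
qed

lemma lin_ext_mult:
  fixes f g :: "'m::monoid_add \<Rightarrow>\<^sub>0 complex"
  assumes "\<And>m m'. h (m + m') = h m * h m'"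
  shows "lin_ext h (f * g) = lin_ext h f * lin_ext h g"
  using lin_ext_mult_eqv[OF ring_congruence_zero, of h f g] assms
  by (simp add: ring_congruence.eqv_def[OF ring_congruence_zero])

lemma lin_ext_1: "h 0 = 1 \<Longrightarrow> lin_ext h 1 = 1"
  by (simp add: single_one[symmetric] del: single_one)

end

section \<open>Substitution in polynomials\<close>

lemma mconst_0 [simp]: "mconst 0 = 0" and mconst_1 [simp]: "mconst 1 = 1"
  and mconst_add: "mconst (a + b) = mconst a + mconst b"
  and mconst_mult: "mconst (a * b) = mconst a * mconst b"
  and mconst_minus: "mconst (- a) = - mconst a"
  by (simp_all add: mconst_def single_add mult_single single_uminus)

interpretation mpoly: central_scalars mconst
  by unfold_locales (simp_all add: mconst_add mconst_mult mult.commute)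

text \<open>Induction on the degree of a monomial, from which one variable is split off.
  Leibniz-type statements then only have to be checked for one additional variable on the
  left.\<close>

lemma mpoly_induct [case_names const add var]:
  fixes f :: "'n::finite mpoly"
  assumes const: "\<And>a. P (mconst a)" and add: "\<And>f g. P f \<Longrightarrow> P g \<Longrightarrow> P (f + g)"
    and var: "\<And>i f. P f \<Longrightarrow> P (mvar i * f)"
  shows "P f"
proof -
  have single: "P (Poly_Mapping.single m a)" for m a
  proof (induction "\<Sum>i\<in>UNIV. Poly_Mapping.lookup m i" arbitrary: m)
    case 0
    then have "m = 0" by (intro poly_mapping_eqI) simp
    then show ?case using const[of a] by (simp add: mconst_def)
  next
    case (Suc k)
    have "(\<Sum>i\<in>UNIV. Poly_Mapping.lookup m i) \<noteq> 0" using Suc.hyps(2) by linarith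
    then obtain i where i: "Poly_Mapping.lookup m i \<noteq> 0" by (meson sum.neutral)
    define m' where "m' = m - Poly_Mapping.single i 1"
    have m: "m = Poly_Mapping.single i 1 + m'"
      using i unfolding m'_def
      by (intro poly_mapping_eqI) (auto simp: lookup_add lookup_minus lookup_single when_def)
    have "Suc k = Suc (\<Sum>i\<in>UNIV. Poly_Mapping.lookup m' i)"
      using Suc.hyps(2) by (subst (asm) m) (simp add: lookup_add sum.distrib lookup_single when_def)
    then have "P (Poly_Mapping.single m' a)" by (intro Suc.hyps(1)) simp
    then have "P (mvar i * Poly_Mapping.single m' a)" by (rule var)
    then show ?case by (simp add: mvar_def mult_single m)
  qed
  have "P (\<Sum>m\<in>A. Poly_Mapping.single m (Poly_Mapping.lookup f m))" for A
    using single[of 0 0]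
    by (induction A rule: infinite_finite_induct) (auto intro: add single)
  then show ?thesis by (subst poly_mapping_sum_singles) simp
qed

lemma msubst_eq_lin_ext:
  "msubst g = mpoly.lin_ext (\<lambda>m. \<Prod>i\<in>UNIV. g i ^ Poly_Mapping.lookup m i)"
  by (simp add: fun_eq_iff msubst_def mpoly.lin_ext_def)

lemma msubst_add: "msubst g (p + q) = msubst g p + msubst g q"
  and msubst_minus: "msubst g (- p) = - msubst g p"
  and msubst_diff: "msubst g (p - q) = msubst g p - msubst g q"
  and msubst_0 [simp]: "msubst g 0 = 0"
  and msubst_sum: "msubst g (sum f A) = (\<Sum>i\<in>A. msubst g (f i))"
  by (simp_all add: msubst_eq_lin_ext mpoly.lin_ext_add mpoly.lin_ext_minus mpoly.lin_ext_diff mpoly.lin_ext_sum)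

lemma msubst_const [simp]: "msubst g (mconst a) = mconst a"
  by (simp add: msubst_eq_lin_ext) (simp add: mconst_def)

lemma msubst_1 [simp]: "msubst g 1 = 1"
  using msubst_const[of g 1] by simp

lemma msubst_var [simp]: "msubst g (mvar i) = g i"
proof -
  have "(\<Prod>j\<in>UNIV. g j ^ Poly_Mapping.lookup (Poly_Mapping.single i (1::nat)) j) = (\<Prod>j\<in>UNIV. if j = i then g i else 1)"
    by (rule prod.cong) (auto simp: lookup_single when_def)
  then show ?thesis by (simp add: msubst_eq_lin_ext mvar_def)
qed

lemma msubst_mult: "msubst g (p * q) = msubst g p * msubst g q"
  unfolding msubst_eq_lin_ext
  by (rule mpoly.lin_ext_mult) (simp add: lookup_add power_add prod.distrib)

lemma msubst_power: "msubst g (p ^ k) = msubst g p ^ k"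
  by (induction k) (auto simp: msubst_mult)

lemma msubst_prod: "msubst g (prod f A) = (\<Prod>i\<in>A. msubst g (f i))"
  by (induction A rule: infinite_finite_induct) (auto simp: msubst_mult)

lemma msubst_msubst: "msubst g (msubst h p) = msubst (\<lambda>i. msubst g (h i)) p"
  by (induction p rule: mpoly_induct) (simp_all add: msubst_add msubst_mult)

lemma msubst_mvar [simp]: "msubst mvar p = p"
  by (induction p rule: mpoly_induct) (simp_all add: msubst_add msubst_mult)

lemmas mact_simps = msubst_add msubst_minus msubst_diff msubst_sum msubst_mult msubst_power msubst_prod

lemma mact_add: "mact w (p + q) = mact w p + mact w q"
  and mact_minus: "mact w (- p) = - mact w p"
  and mact_0 [simp]: "mact w 0 = 0"
  and mact_sum: "mact w (sum f A) = (\<Sum>i\<in>A. mact w (f i))"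
  and mact_const [simp]: "mact w (mconst a) = mconst a"
  and mact_1 [simp]: "mact w 1 = 1"
  and mact_mult: "mact w (p * q) = mact w p * mact w q"
  and mact_power: "mact w (p ^ k) = mact w p ^ k"
  and mact_prod: "mact w (prod f A) = (\<Prod>i\<in>A. mact w (f i))"
  unfolding mact_def by (simp_all add: mact_simps)

lemma mact_var: "mact w (mvar i) = (\<Sum>j\<in>UNIV. mconst (w $ j $ i) * mvar j)"
  by (simp add: mact_def)

lemma mact_mact: "mact w (mact w' p) = mact (w ** w') p"
proof (induction p rule: mpoly_induct)
  case (var i f)
  have "mact w (mact w' (mvar i)) = (\<Sum>j\<in>UNIV. \<Sum>k\<in>UNIV. mconst (w' $ j $ i) * (mconst (w $ k $ j) * mvar k))"
    unfolding mact_var[of w'] by (simp only: mact_sum mact_mult mact_const mact_var sum_distrib_left)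
  also have "\<dots> = (\<Sum>k\<in>UNIV. \<Sum>j\<in>UNIV. mconst (w' $ j $ i) * (mconst (w $ k $ j) * mvar k))"
    by (rule sum.swap)
  also have "\<dots> = mact (w ** w') (mvar i)"
    by (simp only: mact_var matrix_matrix_mult_def mpoly.sc_sum mconst_mult sum_distrib_left sum_distrib_right mult_ac vec_lambda_beta)
  finally show ?case using var by (simp add: mact_mult)
qed (simp_all add: mact_add)

lemma mact_signed_perm_var: "mact (signed_perm \<pi> \<epsilon>) (mvar i) = mconst (\<epsilon> i) * mvar (\<pi> i)"
proof -
  have "mact (signed_perm \<pi> \<epsilon>) (mvar i) = (\<Sum>j\<in>UNIV. if j = \<pi> i then mconst (\<epsilon> i) * mvar j else 0)"
    unfolding mact_var by (rule sum.cong) (auto simp: signed_perm_def)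
  then show ?thesis by simp
qed

lemma mact_mat_1 [simp]: "mact (mat 1) p = p"
  unfolding mat_1_eq_signed_perm
  by (induction p rule: mpoly_induct) (simp_all add: mact_add mact_mult mact_signed_perm_var)

section \<open>Reflections and divided differences\<close>

text \<open>\<open>reflection \<delta> k i\<close> is \<open>s\<^bsub>ki\<^esub>\<close> for \<open>\<delta> = 1\<close> and its barred version for \<open>\<delta> = -1\<close>;
  the degenerate case \<open>reflection (-1) i i\<close> is \<open>\<tau>\<^sub>i\<close>, so that all reflections are treated alike.\<close>

definition reflection :: "complex \<Rightarrow> 'n::finite \<Rightarrow> 'n \<Rightarrow> complex^'n^'n" where
  "reflection \<delta> k i = signed_perm (Transposition.transpose k i) (\<lambda>l. if l \<in> {k, i} then \<delta> else 1)"

lemma refl_1: "reflection 1 k i = s_refl k i" "reflection 1 k i = s_refl i k"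
  by (simp_all add: reflection_def s_refl_def transpose_commute)

lemma refl_minus_1: "reflection (-1) k i = sbar_refl k i" "reflection (-1) k i = sbar_refl i k"
  by (simp_all add: reflection_def sbar_refl_def transpose_commute insert_commute)

lemma s_refl_commute: "s_refl k i = s_refl i k"
  and sbar_refl_commute: "sbar_refl k i = sbar_refl i k"
  using refl_1 refl_minus_1 by metis+

lemma refl_diag: "reflection (-1) i i = tau_refl i"
  by (simp add: reflection_def tau_refl_def)

lemma bij_transpose: "bij (Transposition.transpose k i)"
  by (rule involuntory_imp_bij) simp

lemma refl_in_B: "\<delta> \<in> {1, -1} \<Longrightarrow> reflection \<delta> k i \<in> weyl_group Type_B"
  unfolding reflection_def by (intro signed_perm_in_weyl_group bij_transpose) auto

lemma mact_refl_var:
  "mact (reflection \<delta> k i) (mvar l) = (if l \<in> {k, i} then mconst \<delta> else 1) * mvar (Transposition.transpose k i l)"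
  by (simp add: reflection_def mact_signed_perm_var)

text \<open>A linear form that \<open>reflection \<delta> k i\<close> negates when \<delta> is a
  sign; for k = i and \<delta> = -1 it is twice the variable.\<close>

definition root_poly :: "complex \<Rightarrow> 'n \<Rightarrow> 'n \<Rightarrow> 'n mpoly" where
  "root_poly \<delta> k i = mvar k - mconst \<delta> * mvar i"

text \<open>The order of the tests matters: for l = k = i and \<delta> = -1 the variable changes by
  \<open>2 * mvar i\<close>, which is the root itself, so the coefficient has to be 1.\<close>

definition root_coeff :: "complex \<Rightarrow> 'n \<Rightarrow> 'n \<Rightarrow> 'n \<Rightarrow> complex" where
  "root_coeff \<delta> k i l = (if l = k then 1 else if l = i then - \<delta> else 0)"

lemma var_minus_mact_refl:
  assumes "\<delta> \<in> {1, -1}"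
  shows "mvar l - mact (reflection \<delta> k i) (mvar l) = mconst (root_coeff \<delta> k i l) * root_poly \<delta> k i"
proof -
  have "mconst \<delta> * (mconst \<delta> * mvar i) = mconst (\<delta> * \<delta>) * mvar i"
    by (simp only: mconst_mult mult.assoc)
  also have "\<delta> * \<delta> = 1" using assms by auto
  finally have "mconst \<delta> * (mconst \<delta> * mvar i) = mvar i" by simp
  then show ?thesis
    by (cases "l = k"; cases "l = i")
      (auto simp: mact_refl_var root_poly_def root_coeff_def mconst_minus right_diff_distrib)
qed

text \<open>Multiplication by a variable shifts exponents injectively, so each coefficient of p
  reappears as a coefficient of the product.\<close>

lemma mvar_mult_eq_0: "p * mvar k = 0 \<Longrightarrow> p = 0"
proof (rule poly_mapping_eqI)
  fix m
  let ?e = "Poly_Mapping.single k (1::nat)"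
  assume "p * mvar k = 0"
  then have "0 = Poly_Mapping.lookup ((\<Sum>m\<in>Poly_Mapping.keys p. Poly_Mapping.single m (Poly_Mapping.lookup p m)) * mvar k) (m + ?e)"
    by (simp flip: poly_mapping_sum_singles)
  also have "\<dots> = (\<Sum>m'\<in>Poly_Mapping.keys p. Poly_Mapping.lookup (Poly_Mapping.single (m' + ?e) (Poly_Mapping.lookup p m')) (m + ?e))"
    by (simp add: sum_distrib_right lookup_sum mvar_def mult_single)
  also have "\<dots> = (\<Sum>m'\<in>Poly_Mapping.keys p. if m' = m then Poly_Mapping.lookup p m else 0)"
    by (rule sum.cong) (auto simp: lookup_single when_def)
  finally show "Poly_Mapping.lookup p m = Poly_Mapping.lookup 0 m"
    by (simp add: in_keys_iff split: if_splits)
qed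

text \<open>The root is not a zero divisor: for k = i it is twice a variable, and otherwise an
  invertible linear substitution carries it to a variable.\<close>

lemma mult_root_eq_0:
  fixes p :: "'n::finite mpoly"
  assumes "\<delta> \<in> {1, -1}" "k = i \<Longrightarrow> \<delta> = -1" "p * root_poly \<delta> k i = 0"
  shows "p = 0"
proof (cases "k = i")
  case True
  moreover have "mconst 2 = (1 + 1 :: 'n mpoly)"
    using mconst_add[of 1 1] by simp
  ultimately have "p * root_poly \<delta> k i = (mconst 2 * p) * mvar i"
    using assms(2) by (simp add: root_poly_def mconst_minus algebra_simps)
  then have "mconst (1/2) * (mconst 2 * p) = 0"
    using assms(3) mvar_mult_eq_0[of "mconst 2 * p" i] by simp
  then show ?thesis by (simp flip: mult.assoc mconst_mult)
next
  case False
  \<comment> \<open>The shear that adds s z_i to z_k: \<open>g (- \<delta>)\<close> undoes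
    \<open>g \<delta>\<close>, and \<open>g \<delta>\<close> sends the root to z_k.\<close>
  define g where "g s = (\<lambda>l. if l = k then mvar k + mconst s * mvar i else mvar l)" for s
  have "msubst (g (- \<delta>)) (msubst (g \<delta>) p) = msubst mvar p"
    unfolding msubst_msubst
    by (rule arg_cong[of _ _ "\<lambda>h. msubst h p"])
      (use False in \<open>auto simp: g_def fun_eq_iff msubst_add msubst_mult mconst_minus\<close>)
  moreover have "msubst (g \<delta>) (root_poly \<delta> k i) = mvar k"
    using False by (simp add: root_poly_def msubst_diff msubst_mult g_def)
  then have "msubst (g \<delta>) p = 0"
    using assms(3) mvar_mult_eq_0[of "msubst (g \<delta>) p" k] by (metis msubst_0 msubst_mult)
  ultimately show ?thesis by simp
qed

text \<open>Junk value unless \<open>\<delta> = \<plusminus>1\<close> and \<open>root_poly \<delta> k i \<noteq> 0\<close>.\<close>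

definition dd :: "complex \<Rightarrow> 'n \<Rightarrow> 'n \<Rightarrow> 'n::finite mpoly \<Rightarrow> 'n mpoly" where
  "dd \<delta> k i f = (THE p. p * root_poly \<delta> k i = f - mact (reflection \<delta> k i) f)"

text \<open>For a sign \<delta> the root vanishes exactly when k = i and \<delta> = 1. This case is
  excluded; in all others the divided difference exists and is unique.\<close>

locale root_data =
  fixes \<delta> :: complex and k i :: "'n::finite"
  assumes sign: "\<delta> \<in> {1, -1}" and nonzero: "k = i \<Longrightarrow> \<delta> = -1"
begin

text \<open>Divisibility passes from f to \<open>mvar l * f\<close> because the difference splits by
  the twisted Leibniz rule and a single variable changes by a multiple of the root.\<close>

lemma root_divides: "\<exists>p. p * root_poly \<delta> k i = f - mact (reflection \<delta> k i) f"
proof (induction f rule: mpoly_induct)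
  case (const a)
  show ?case by (intro exI[of _ 0]) simp
next
  case (add f g)
  then obtain p q where "p * root_poly \<delta> k i = f - mact (reflection \<delta> k i) f" "q * root_poly \<delta> k i = g - mact (reflection \<delta> k i) g"
    by blast
  then show ?case by (intro exI[of _ "p + q"]) (simp add: mact_add distrib_right)
next
  case (var l f)
  then obtain p where p: "p * root_poly \<delta> k i = f - mact (reflection \<delta> k i) f" by blast
  have "mvar l * f - mact (reflection \<delta> k i) (mvar l * f)
      = mvar l * (f - mact (reflection \<delta> k i) f) + (mvar l - mact (reflection \<delta> k i) (mvar l)) * mact (reflection \<delta> k i) f"
    by (simp add: mact_mult algebra_simps)
  also have "\<dots> = (mvar l * p + mconst (root_coeff \<delta> k i l) * mact (reflection \<delta> k i) f) * root_poly \<delta> k i"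
    unfolding var_minus_mact_refl[OF sign] p[symmetric] by (simp add: algebra_simps)
  finally show ?case by (intro exI) (rule sym)
qed

lemma dd_unique: "p * root_poly \<delta> k i = f - mact (reflection \<delta> k i) f \<Longrightarrow> dd \<delta> k i f = p"
  unfolding dd_def
proof (rule the_equality)
  fix q assume "q * root_poly \<delta> k i = f - mact (reflection \<delta> k i) f"
    and "p * root_poly \<delta> k i = f - mact (reflection \<delta> k i) f"
  then have "(q - p) * root_poly \<delta> k i = 0" by (simp add: left_diff_distrib)
  then show "q = p" using mult_root_eq_0[OF sign nonzero] by force
qed

lemma dd_mult_root: "dd \<delta> k i f * root_poly \<delta> k i = f - mact (reflection \<delta> k i) f"
  using root_divides[of f] dd_unique by blast

lemma dd_eq_0: "mact (reflection \<delta> k i) f = f \<Longrightarrow> dd \<delta> k i f = 0"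
  by (rule dd_unique) simp

lemma dd_const: "dd \<delta> k i (mconst a) = 0"
  by (rule dd_eq_0) simp

lemma dd_add: "dd \<delta> k i (f + g) = dd \<delta> k i f + dd \<delta> k i g"
  by (rule dd_unique) (simp add: distrib_right dd_mult_root mact_add)

lemma dd_const_mult: "dd \<delta> k i (mconst a * f) = mconst a * dd \<delta> k i f"
  by (rule dd_unique) (simp add: mult.assoc dd_mult_root mact_mult right_diff_distrib)

text \<open>Together with additivity and vanishing on constants this recursion determines
  \<open>dd\<close>. Commutators with momenta obey the same recursion, which is how divided
  differences enter.\<close>

lemma dd_var_mult:
  "dd \<delta> k i (mvar l * f) = mvar l * dd \<delta> k i f + mconst (root_coeff \<delta> k i l) * mact (reflection \<delta> k i) f"
proof (rule dd_unique)
  let ?s = "mact (reflection \<delta> k i)" and ?c = "mconst (root_coeff \<delta> k i l)"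
  have "(mvar l * dd \<delta> k i f + ?c * ?s f) * root_poly \<delta> k i
     = mvar l * (dd \<delta> k i f * root_poly \<delta> k i) + (?c * root_poly \<delta> k i) * ?s f"
    by (simp only: distrib_left distrib_right mult_ac)
  also have "\<dots> = mvar l * (f - ?s f) + (mvar l - ?s (mvar l)) * ?s f"
    by (simp only: dd_mult_root var_minus_mact_refl[OF sign])
  also have "\<dots> = mvar l * f - ?s (mvar l * f)"
    by (simp add: mact_mult left_diff_distrib right_diff_distrib)
  finally show "(mvar l * dd \<delta> k i f + ?c * ?s f) * root_poly \<delta> k i = mvar l * f - ?s (mvar l * f)" .
qed

end

section \<open>The commutator of a position and a momentum variable\<close>

interpretation free: central_scalars "scal :: complex \<Rightarrow> 'g free"
proof unfold_locales
  fix a :: complex and x :: "'g free"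
  have "Poly_Mapping.single m b * scal a = scal a * Poly_Mapping.single m b" for m :: "'g word" and b
    by (simp add: scal_def mult_single mult.commute)
  then have "(\<Sum>m\<in>Poly_Mapping.keys x. Poly_Mapping.single m (Poly_Mapping.lookup x m)) * scal a
      = scal a * (\<Sum>m\<in>Poly_Mapping.keys x. Poly_Mapping.single m (Poly_Mapping.lookup x m))"
    by (simp add: sum_distrib_left sum_distrib_right)
  then show "x * scal a = scal a * x" by (simp only: poly_mapping_sum_singles[symmetric])
qed (simp_all add: scal_def single_add mult_single)

definition signs :: "weyl_type \<Rightarrow> complex set" where
  "signs T = (if T = Type_A then {1} else {1, -1})"

lemma finite_signs [simp]: "finite (signs T)"
  and signs_subset: "signs T \<subseteq> {1, -1}"
  by (auto simp: signs_def)

lemma refl_in_weyl_group: "\<delta> \<in> signs T \<Longrightarrow> k \<noteq> i \<Longrightarrow> reflection \<delta> k i \<in> weyl_group T"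
  by (auto simp: signs_def refl_1(1) refl_minus_1(1) reflections_in_weyl_group simp del: weyl_group.simps split: if_splits)

abbreviation fC :: "'n::finite \<Rightarrow> 'n rdahc_free" where "fC i \<equiv> gen (Cgen i)"
abbreviation fW :: "complex^'n^'n \<Rightarrow> 'n rdahc_free" where "fW w \<equiv> gen (Wgen w)"

definition yx_comm :: "weyl_type \<Rightarrow> complex \<Rightarrow> complex \<Rightarrow> 'n::finite \<Rightarrow> 'n \<Rightarrow> 'n rdahc_free" where
  "yx_comm T u v j i = (if j = i then comm_diag T u v i else comm_offdiag T u j i)"

text \<open>Each summand is \<open>\<delta> * (1 + \<delta> * c_j c_i)\<close> times the reflection
  of sign \<delta>; this accounts for the minus signs of the barred part.\<close>

lemma yx_comm_offdiag:
  "j \<noteq> i \<Longrightarrow> yx_comm T u v j i =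
    scal u * (\<Sum>\<delta>\<in>signs T. scal \<delta> * ((1 + scal \<delta> * (fC j * fC i)) * fW (reflection \<delta> j i)))"
  by (cases T) (simp_all add: yx_comm_def signs_def refl_1(1)[of j i] s_refl_commute[of j i]
    sbar_refl_commute[of j i] free.sc_minus refl_minus_1(1)[of j i] algebra_simps)

lemma yx_comm_diag:
  "yx_comm T u v i i =
    - (scal u * (\<Sum>k\<in>UNIV - {i}. \<Sum>\<delta>\<in>signs T. (1 + scal \<delta> * (fC k * fC i)) * fW (reflection \<delta> k i)))
    - (if T = Type_B then scal (complex_of_real (sqrt 2) * v) * fW (reflection (-1) i i) else 0)"
  by (cases T) (simp_all add: yx_comm_def signs_def refl_1(1) refl_diag refl_minus_1(1)
    free.sc_minus algebra_simps)

text \<open>A term \<open>(k, b, \<delta>)\<close> stands for the group algebra element \<open>(c\<^sub>k c\<^sub>i)\<^sup>b reflection \<delta> k i\<close>.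
  The flag \<open>\<eta>\<close> tells which polynomial variables are moved past it: the \<open>y\<^sub>l\<close> (\<open>False\<close>) commute with
  \<open>c\<^sub>k c\<^sub>i\<close>, while the \<open>x\<^sub>l\<close> (\<open>True\<close>) change sign for \<open>l \<in> {k, i}\<close>, which turns the action of
  \<open>reflection \<delta> k i\<close> into that of \<open>reflection (-\<delta>) k i\<close>.\<close>

type_synonym 'n refl_term = "'n \<times> bool \<times> complex"

definition terms :: "weyl_type \<Rightarrow> 'n \<Rightarrow> 'n refl_term set" where
  "terms T i = (UNIV - {i}) \<times> UNIV \<times> signs T \<union> (if T = Type_B then {(i, False, -1)} else {})"

definition term_elt :: "'n::finite \<Rightarrow> 'n refl_term \<Rightarrow> 'n rdahc_free" where
  "term_elt i = (\<lambda>(k, b, \<delta>). (if b then fC k * fC i else 1) * fW (reflection \<delta> k i))"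

definition term_sign :: "bool \<Rightarrow> 'n refl_term \<Rightarrow> complex" where
  "term_sign \<eta> = (\<lambda>(k, b, \<delta>). if \<eta> \<and> b then - \<delta> else \<delta>)"

text \<open>The values are forced: multiplied by \<open>root_coeff\<close> they have to give the
  prescribed commutators. Without Clifford factor, \<delta> cancels the \<delta> of the root
  coefficient at l = i; with it, the required sign is supplied by \<open>term_sign\<close>. The sign
  change with \<open>\<eta>\<close> reflects [x_i, y_l] = - [y_l, x_i]; in the Clifford terms it
  comes from \<open>term_sign\<close> at l = i and from c_i c_l = - c_l c_i otherwise.\<close>

definition term_coeff :: "bool \<Rightarrow> complex \<Rightarrow> complex \<Rightarrow> 'n \<Rightarrow> 'n refl_term \<Rightarrow> complex" where
  "term_coeff \<eta> u v i = (\<lambda>(k, b, \<delta>).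
     if k = i then (if \<eta> then - (complex_of_real (sqrt 2) * v) else complex_of_real (sqrt 2) * v)
     else if b then - u else if \<eta> then \<delta> * u else - (\<delta> * u))"

lemma finite_terms [simp]: "finite (terms T (i::'n::finite))"
  by (simp add: terms_def)

lemma terms_root_data:
  assumes "t \<in> terms T i"
  shows "root_data (term_sign \<eta> t) (fst t) i"
  using assms signs_subset[of T] unfolding root_data_def
  by (auto simp: terms_def term_sign_def split: if_splits)

lemma sum_terms:
  fixes i :: "'n::finite" and f :: "'n refl_term \<Rightarrow> 'a::comm_monoid_add"
  shows "sum f (terms T i) = (\<Sum>k\<in>UNIV - {i}. \<Sum>\<delta>\<in>signs T. f (k, False, \<delta>) + f (k, True, \<delta>))
    + (if T = Type_B then f (i, False, -1) else 0)"
proof -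
  have "sum f (terms T i) = sum f ((UNIV - {i}) \<times> UNIV \<times> signs T) + (if T = Type_B then f (i, False, -1) else 0)"
    unfolding terms_def by (subst sum.union_disjoint) auto
  also have "sum f ((UNIV - {i}) \<times> UNIV \<times> signs T) = (\<Sum>k\<in>UNIV - {i}. \<Sum>b\<in>UNIV. \<Sum>\<delta>\<in>signs T. f (k, b, \<delta>))"
    by (simp add: sum.cartesian_product)
  also have "\<dots> = (\<Sum>k\<in>UNIV - {i}. \<Sum>\<delta>\<in>signs T. f (k, False, \<delta>) + f (k, True, \<delta>))"
    by (simp add: UNIV_bool sum.distrib add.commute)
  finally show ?thesis .
qed

definition term_sum :: "bool \<Rightarrow> weyl_type \<Rightarrow> complex \<Rightarrow> complex \<Rightarrow> 'n::finite \<Rightarrow> 'n \<Rightarrow> 'n rdahc_free" where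
  "term_sum \<eta> T u v i l = (\<Sum>t\<in>terms T i.
     scal (term_coeff \<eta> u v i t * root_coeff (term_sign \<eta> t) (fst t) i l) * term_elt i t)"

lemma term_tau:
  "scal (term_coeff \<eta> u v i (i, False, -1) * root_coeff (term_sign \<eta> (i, False, -1)) i i l) * term_elt i (i, False, -1)
    = (if l = i then scal (if \<eta> then - (complex_of_real (sqrt 2) * v) else complex_of_real (sqrt 2) * v)
        * fW (reflection (-1) i i) else 0)"
  by (simp add: term_coeff_def term_sign_def term_elt_def root_coeff_def)

lemma term_sum_eq:
  "term_sum \<eta> T u v i l = (\<Sum>k\<in>UNIV - {i}. \<Sum>\<delta>\<in>signs T.
      scal ((if \<eta> then \<delta> * u else - (\<delta> * u)) * root_coeff \<delta> k i l) * fW (reflection \<delta> k i)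
     + scal (- u * root_coeff (if \<eta> then - \<delta> else \<delta>) k i l) * (fC k * fC i * fW (reflection \<delta> k i)))
    + (if T = Type_B \<and> l = i then scal (if \<eta> then - (complex_of_real (sqrt 2) * v) else complex_of_real (sqrt 2) * v)
        * fW (reflection (-1) i i) else 0)"
  unfolding term_sum_def sum_terms fst_conv term_tau
  by (intro arg_cong2[of _ _ _ _ "(+)"] sum.cong) (auto simp: term_coeff_def term_sign_def term_elt_def)

lemma term_sum_diag: "term_sum \<eta> T u v i i = (if \<eta> then yx_comm T u v i i else - yx_comm T u v i i)"
proof -
  let ?A = "\<lambda>k \<delta>. scal ((if \<eta> then \<delta> * u else - (\<delta> * u)) * root_coeff \<delta> k i i) * fW (reflection \<delta> k i)
     + scal (- u * root_coeff (if \<eta> then - \<delta> else \<delta>) k i i) * (fC k * fC i * fW (reflection \<delta> k i))"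
  let ?B = "\<lambda>k \<delta>. (1 + scal \<delta> * (fC k * fC i)) * fW (reflection \<delta> k i)"
  let ?s = "scal (if \<eta> then - u else u)"
  have "?A k \<delta> = ?s * ?B k \<delta>" if "k \<in> UNIV - {i}" "\<delta> \<in> signs T" for k \<delta>
    using that by (auto simp: signs_def root_coeff_def free.sc_minus distrib_left distrib_right
      free.sc_mult mult.assoc split: if_splits)
  then have "(\<Sum>k\<in>UNIV - {i}. \<Sum>\<delta>\<in>signs T. ?A k \<delta>) = ?s * (\<Sum>k\<in>UNIV - {i}. \<Sum>\<delta>\<in>signs T. ?B k \<delta>)"
    unfolding sum_distrib_left by (intro sum.cong HOL.refl)
  then show ?thesis
    unfolding term_sum_eq yx_comm_diag by (simp only:) (simp add: free.sc_minus)
qed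

lemma term_sum_offdiag:
  assumes "l \<noteq> i"
  shows "term_sum \<eta> T u v i l = (\<Sum>\<delta>\<in>signs T.
    scal (if \<eta> then \<delta> * u else - (\<delta> * u)) * fW (reflection \<delta> l i) - scal u * (fC l * fC i * fW (reflection \<delta> l i)))"
proof -
  let ?A = "\<lambda>k. \<Sum>\<delta>\<in>signs T. scal ((if \<eta> then \<delta> * u else - (\<delta> * u)) * root_coeff \<delta> k i l) * fW (reflection \<delta> k i)
     + scal (- u * root_coeff (if \<eta> then - \<delta> else \<delta>) k i l) * (fC k * fC i * fW (reflection \<delta> k i))"
  let ?B = "\<Sum>\<delta>\<in>signs T.
    scal (if \<eta> then \<delta> * u else - (\<delta> * u)) * fW (reflection \<delta> l i) - scal u * (fC l * fC i * fW (reflection \<delta> l i))"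
  have "?A k = (if k = l then ?B else 0)" if "k \<in> UNIV - {i}" for k
    using that assms by (auto simp: root_coeff_def free.sc_minus)
  then have "(\<Sum>k\<in>UNIV - {i}. ?A k) = (\<Sum>k\<in>UNIV - {i}. if k = l then ?B else 0)"
    by (intro sum.cong HOL.refl)
  also have "\<dots> = ?B" using assms by simp
  finally show ?thesis using assms unfolding term_sum_eq by (simp only: simp_thms if_False add_0_right)
qed

lemma term_sum_y: "term_sum False T u v i l = - yx_comm T u v l i"
proof (cases "l = i")
  case False
  have "scal (- (\<delta> * u)) * fW (reflection \<delta> l i) - scal u * (fC l * fC i * fW (reflection \<delta> l i))
    = - (scal u * (scal \<delta> * ((1 + scal \<delta> * (fC l * fC i)) * fW (reflection \<delta> l i))))"
    if "\<delta> \<in> signs T" for \<delta>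
    using that by (auto simp: signs_def free.sc_minus distrib_left distrib_right mult.assoc split: if_splits)
  with False show ?thesis
    by (simp add: term_sum_offdiag yx_comm_offdiag sum_distrib_left sum_negf cong: sum.cong)
qed (simp add: term_sum_diag)

text \<open>The terms for the momentum y_i contain c_l c_i, whereas [y_i, x_l] contains c_i c_l.
  Anticommutation is isolated as the sole assumption because the comparison is also made in the
  kernel of a representation whose other relations are still to be verified.\<close>

locale clifford_congruence = ring_congruence J for J :: "'n::finite rdahc_free set" +
  assumes clifford: "i \<noteq> j \<Longrightarrow> fC i * fC j \<doteq> - (fC j * fC i)"
begin

lemma term_sum_x: "term_sum True T u v i l \<doteq> yx_comm T u v i l"
proof (cases "l = i")
  case False
  have "scal (\<delta> * u) * fW (reflection \<delta> l i) - scal u * (fC l * fC i * fW (reflection \<delta> l i))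
    \<doteq> scal u * (scal \<delta> * ((1 + scal \<delta> * (fC i * fC l)) * fW (reflection \<delta> i l)))"
    if "\<delta> \<in> signs T" for \<delta>
  proof -
    have r: "reflection \<delta> l i = reflection \<delta> i l"
      by (simp add: reflection_def transpose_commute insert_commute)
    have "scal (\<delta> * u) * fW (reflection \<delta> l i) - scal u * (fC l * fC i * fW (reflection \<delta> l i))
      \<doteq> scal (\<delta> * u) * fW (reflection \<delta> l i) - scal u * (- (fC i * fC l) * fW (reflection \<delta> l i))"
      using False by (intro eqv_diff eqv_mult eqv_refl clifford)
    also have "\<dots> = scal u * (scal \<delta> * ((1 + scal \<delta> * (fC i * fC l)) * fW (reflection \<delta> i l)))"
      using that by (auto simp: r signs_def free.sc_minus distrib_left distrib_right mult.assoc split: if_splits)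
    finally show ?thesis .
  qed
  with False show ?thesis
    by (simp add: term_sum_offdiag yx_comm_offdiag sum_distrib_left eqv_sum)
qed (simp add: term_sum_diag)

end

section \<open>Representations of the free algebra\<close>

locale operators = central_scalars sc for sc :: "complex \<Rightarrow> 'e::ring_1" +
  fixes h :: "('n::finite, complex^'n^'n) rdahc_gen \<Rightarrow> 'e"
begin

definition rep :: "'n rdahc_free \<Rightarrow> 'e" where
  "rep = lin_ext (\<lambda>w. prod_list (map h (letters w)))"

lemma rep_add: "rep (f + g) = rep f + rep g"
  and rep_minus: "rep (- f) = - rep f"
  and rep_diff: "rep (f - g) = rep f - rep g"
  and rep_0 [simp]: "rep 0 = 0"
  and rep_sum: "rep (sum F A) = (\<Sum>i\<in>A. rep (F i))"
  by (simp_all add: rep_def lin_ext_add lin_ext_minus lin_ext_diff lin_ext_sum)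

lemma rep_mult: "rep (f * g) = rep f * rep g"
  unfolding rep_def by (rule lin_ext_mult) (simp add: plus_word_def)

lemma rep_1 [simp]: "rep 1 = 1"
  unfolding rep_def by (rule lin_ext_1) (simp add: zero_word_def)

lemma rep_gen [simp]: "rep (gen g) = h g"
  by (simp add: rep_def gen_def)

lemma rep_scal [simp]: "rep (scal a) = sc a"
  by (simp add: rep_def scal_def zero_word_def)

lemmas rep_simps = rep_add rep_minus rep_diff rep_sum rep_mult

lemma rep_lin: "rep (lin K a) = (\<Sum>i\<in>UNIV. sc (a $ i) * h (K i))"
  by (simp add: lin_def rep_simps)

definition rep_kernel :: "'n rdahc_free set" where "rep_kernel = {f. rep f = 0}"

lemma ring_congruence_rep_kernel: "ring_congruence rep_kernel"
  by unfold_locales (auto simp: rep_kernel_def rep_simps)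

lemma eqv_rep_kernel: "ring_congruence.eqv rep_kernel f g \<longleftrightarrow> rep f = rep g"
  by (simp only: ring_congruence.eqv_def[OF ring_congruence_rep_kernel])
    (simp add: rep_kernel_def rep_diff)

end

text \<open>Products are kept nested to the right; in this form a commutation rule also rewrites two
  factors in the middle of a product.\<close>

lemma mult_eq_assoc: "a * b = c * d \<Longrightarrow> a * (b * x) = c * (d * x)" for a :: "'a::semigroup_mult"
  by (metis mult.assoc)

lemma mult_eq_minus_assoc: "a * b = - (c * d) \<Longrightarrow> a * (b * x) = - (c * (d * x))" for a :: "'a::ring"
  by (metis mult.assoc mult_minus_left)

section \<open>Conjugation in the Weyl group\<close>

lemma sign_square: "range \<epsilon> \<subseteq> {1, -1} \<Longrightarrow> \<epsilon> i * \<epsilon> i = (1::complex)"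
proof -
  assume "range \<epsilon> \<subseteq> {1, -1}"
  then have "\<epsilon> i \<in> {1, -1}" by blast
  then show ?thesis by auto
qed

text \<open>A conjugate of a reflection is the reflection in the image root: e_k - \<delta> e_i
  goes, up to sign, to the root with indices \<pi> k, \<pi> i and sign
  \<open>\<delta> * \<epsilon> k * \<epsilon> i\<close>.\<close>

lemma signed_perm_mult_reflection:
  assumes "bij \<pi>" "range \<epsilon> \<subseteq> {1, -1}"
  shows "signed_perm \<pi> \<epsilon> ** reflection \<delta> k i = reflection (\<delta> * \<epsilon> k * \<epsilon> i) (\<pi> k) (\<pi> i) ** signed_perm \<pi> \<epsilon>"
proof -
  have inj: "\<pi> a = \<pi> b \<longleftrightarrow> a = b" for a b
    using assms(1) by (auto simp: bij_def inj_def)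
  have "\<pi> \<circ> Transposition.transpose k i = Transposition.transpose (\<pi> k) (\<pi> i) \<circ> \<pi>"
    by (auto simp: fun_eq_iff Transposition.transpose_def inj)
  moreover have "(if l \<in> {k, i} then \<delta> else 1) * \<epsilon> (Transposition.transpose k i l)
      = \<epsilon> l * (if \<pi> l \<in> {\<pi> k, \<pi> i} then \<delta> * \<epsilon> k * \<epsilon> i else 1)" for l
  proof -
    have "\<epsilon> k = 1 \<or> \<epsilon> k = -1" "\<epsilon> i = 1 \<or> \<epsilon> i = -1" using assms(2) by blast+
    then show ?thesis
      by (cases "l = k"; cases "l = i") (auto simp: Transposition.transpose_def inj)
  qed
  ultimately show ?thesis
    unfolding reflection_def signed_perm_mult by (intro arg_cong2[of _ _ _ _ signed_perm]) (assumption | rule ext)+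
qed

text \<open>The last property keeps the set of reflections in the commutators stable under
  conjugation: in type A all signs are 1, in the other types both signs are available.\<close>

lemma weyl_group_cases:
  assumes "w \<in> weyl_group T"
  obtains \<pi> \<epsilon> where "w = signed_perm \<pi> \<epsilon>" "bij \<pi>" "range \<epsilon> \<subseteq> {1, -1}"
    "\<And>\<delta> k i. \<delta> \<in> signs T \<Longrightarrow> \<delta> * \<epsilon> k * \<epsilon> i \<in> signs T"
proof (cases "T = Type_A")
  case True
  with assms obtain \<pi> where "w = signed_perm \<pi> (\<lambda>_. 1)" "bij \<pi>" by auto
  then show ?thesis by (intro that[of \<pi> "\<lambda>_. 1"]) (auto simp: True)
next
  case False
  with assms obtain \<pi> \<epsilon> where w: "w = signed_perm \<pi> \<epsilon>" "bij \<pi>" "range \<epsilon> \<subseteq> {1, -1}"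
    by (cases T) auto
  have "\<delta> * \<epsilon> k * \<epsilon> i \<in> signs T" if "\<delta> \<in> signs T" for \<delta> k i
  proof -
    have "\<epsilon> k \<in> {1, -1}" "\<epsilon> i \<in> {1, -1}" "\<delta> \<in> {1, -1}" using w(3) that signs_subset[of T] by blast+
    then show ?thesis using False by (auto simp: signs_def)
  qed
  with w show ?thesis by (rule that)
qed

lemma weyl_group_subset_B: "w \<in> weyl_group T \<Longrightarrow> w \<in> weyl_group Type_B"
  by (erule weyl_group_cases) (simp only: signed_perm_in_weyl_group)

lemma weyl_group_matrix_inv:
  assumes "w \<in> weyl_group T"
  shows "w ** matrix_inv w = mat 1" "matrix_inv w ** w = mat 1"
proof -
  obtain \<pi> \<epsilon> where w: "w = signed_perm \<pi> \<epsilon>" "bij \<pi>" "range \<epsilon> \<subseteq> {1, -1}"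
    using assms by (rule weyl_group_cases) blast
  show "w ** matrix_inv w = mat 1"
    using sign_square[OF w(3)] surj_iff[THEN iffD1, OF bij_is_surj[OF w(2)]]
    by (simp only: w(1) signed_perm_inverse[OF w(2,3)] signed_perm_mult mat_1_eq_signed_perm id_def)
  then show "matrix_inv w ** w = mat 1" by (simp add: matrix_left_right_inverse)
qed

lemma sum_signs_mult:
  assumes "\<And>\<delta>. \<delta> \<in> signs T \<Longrightarrow> \<delta> * e \<in> signs T" "e * e = 1"
  shows "(\<Sum>\<delta>\<in>signs T. f (\<delta> * e)) = sum f (signs T)"
proof (rule sum.reindex_bij_betw)
  show "bij_betw (\<lambda>\<delta>. \<delta> * e) (signs T) (signs T)"
    by (rule bij_betw_byWitness[of _ "\<lambda>\<delta>. \<delta> * e"]) (use assms in \<open>auto simp: mult.assoc\<close>)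
qed

section \<open>Reduction of the relations to the commutators\<close>

text \<open>The variables \<open>Z\<close> are the \<open>y\<^sub>i\<close> (\<open>\<eta> = False\<close>) or the \<open>x\<^sub>i\<close> (\<open>\<eta> = True\<close>), and \<open>D\<close> are the others.
  The set \<open>N\<close> models the operators that kill constants; an operator in \<open>N\<close> which can be moved past
  all variables \<open>Z\<close> vanishes. Since the operators \<open>D\<^sub>i\<close> are in \<open>N\<close> and have the right commutators with
  the \<open>Z\<^sub>l\<close>, the Jacobi identity yields all other relations for \<open>D\<close>.\<close>

locale hecke_operators = operators sc h
  for sc :: "complex \<Rightarrow> 'e::ring_1" and h :: "('n::finite, complex^'n^'n) rdahc_gen \<Rightarrow> 'e" +
  fixes \<eta> :: bool and T :: weyl_type and u v :: complex and N :: "'e set"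
    and C Z D :: "'n \<Rightarrow> 'e" and W :: "complex^'n^'n \<Rightarrow> 'e"
  defines "C \<equiv> \<lambda>i. h (Cgen i)"
    and "W \<equiv> \<lambda>w. h (Wgen w)"
    and "Z \<equiv> \<lambda>i. h ((if \<eta> then Xgen else Ygen) i)"
    and "D \<equiv> \<lambda>i. h ((if \<eta> then Ygen else Xgen) i)"
  assumes Z_commute: "Z i * Z j = Z j * Z i"
    and W_mult: "w \<in> weyl_group Type_B \<Longrightarrow> w' \<in> weyl_group Type_B \<Longrightarrow> W w * W w' = W (w ** w')"
    and W_1: "W (mat 1) = 1"
    and C_square: "C i * C i = 1"
    and C_anticommute: "i \<noteq> j \<Longrightarrow> C i * C j = - (C j * C i)"
    and C_Z: "C l * Z k = (if \<eta> \<and> k = l then - (Z k * C l) else Z k * C l)"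
    and W_Z: "bij \<pi> \<Longrightarrow> range \<epsilon> \<subseteq> {1, -1} \<Longrightarrow>
      W (signed_perm \<pi> \<epsilon>) * Z i = sc (\<epsilon> i) * (Z (\<pi> i) * W (signed_perm \<pi> \<epsilon>))"
    and W_C: "bij \<pi> \<Longrightarrow> range \<epsilon> \<subseteq> {1, -1} \<Longrightarrow>
      W (signed_perm \<pi> \<epsilon>) * C i = sc (\<epsilon> i) * (C (\<pi> i) * W (signed_perm \<pi> \<epsilon>))"
    and D_Z: "D i * Z l = Z l * D i + rep (term_sum \<eta> T u v i l)"
    and N_add: "A \<in> N \<Longrightarrow> B \<in> N \<Longrightarrow> A + B \<in> N"
    and N_mult: "A \<in> N \<Longrightarrow> B * A \<in> N"
    and N_C: "A \<in> N \<Longrightarrow> A * C i \<in> N"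
    and N_W: "A \<in> N \<Longrightarrow> A * W w \<in> N"
    and N_D: "D i \<in> N"
    and N_eq_0: "A \<in> N \<Longrightarrow> (\<And>k. \<exists>a l. A * Z k = sc a * (Z l * A)) \<Longrightarrow> A = 0"
begin

lemma N_diff: "A \<in> N \<Longrightarrow> B \<in> N \<Longrightarrow> A - B \<in> N"
  using N_add[of A "-1 * B"] N_mult[of B "-1"] by simp

section \<open>Commutators against the Clifford generators\<close>

definition \<kappa> :: "'n \<Rightarrow> 'n \<Rightarrow> 'e" where "\<kappa> j i = rep (yx_comm T u v j i)"

definition R :: "complex \<Rightarrow> 'n \<Rightarrow> 'n \<Rightarrow> 'e" where
  "R \<delta> k i = (1 + sc \<delta> * (C k * C i)) * W (reflection \<delta> k i)"

lemma clifford_congruence_rep_kernel: "clifford_congruence rep_kernel"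
proof (intro clifford_congruence.intro clifford_congruence_axioms.intro ring_congruence_rep_kernel)
  fix i j :: 'n assume "i \<noteq> j"
  from C_anticommute[OF this] show "ring_congruence.eqv rep_kernel (fC i * fC j) (- (fC j * fC i))"
    by (simp only: eqv_rep_kernel rep_mult rep_minus rep_gen C_def)
qed

lemma D_Z_\<kappa>: "D i * Z l = Z l * D i + (if \<eta> then \<kappa> i l else - \<kappa> l i)"
  using D_Z[of i l] clifford_congruence.term_sum_x[OF clifford_congruence_rep_kernel, of T u v i l]
  by (simp add: eqv_rep_kernel \<kappa>_def term_sum_y rep_minus)

lemma \<kappa>_offdiag: "j \<noteq> i \<Longrightarrow> \<kappa> j i = sc u * (\<Sum>\<delta>\<in>signs T. sc \<delta> * R \<delta> j i)"
  by (simp add: \<kappa>_def yx_comm_offdiag rep_simps R_def C_def W_def)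

lemma \<kappa>_diag: "\<kappa> i i = - (sc u * (\<Sum>k\<in>UNIV - {i}. \<Sum>\<delta>\<in>signs T. R \<delta> k i))
    - (if T = Type_B then sc (complex_of_real (sqrt 2) * v) * W (reflection (-1) i i) else 0)"
  by (simp add: \<kappa>_def yx_comm_diag rep_simps R_def C_def W_def)

lemma sign_cases: "\<delta> \<in> signs T \<Longrightarrow> \<delta> = 1 \<or> \<delta> = -1"
  using signs_subset[of T] by auto

lemma W_reflection_C:
  assumes "\<delta> \<in> {1, -1}"
  shows "W (reflection \<delta> k i) * C l
    = (if l \<in> {k, i} then sc \<delta> else 1) * (C (Transposition.transpose k i l) * W (reflection \<delta> k i))"
proof -
  have "range (\<lambda>l. if l \<in> {k, i} then \<delta> else 1) \<subseteq> {1, -1}" using assms by auto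
  from W_C[OF bij_transpose this, of k i l] show ?thesis
    by (simp only: reflection_def if_distrib[of sc] sc_1)
qed

text \<open>The Clifford factor is made for this: the reflection turns c_k into \<delta> c_i, and
  \<open>(1 + \<delta> c_k c_i) (\<delta> c_i) = c_k (1 + \<delta> c_k c_i)\<close>. For c_i the
  analogous identity carries a minus sign.\<close>

lemma C_R:
  assumes "\<delta> \<in> signs T" "k \<noteq> i"
  shows "C l * R \<delta> k i = (if l = i then - (R \<delta> k i * C l) else R \<delta> k i * C l)"
proof -
  have W: "W (reflection \<delta> k i) * C l = (if l \<in> {k, i} then sc \<delta> else 1) * (C (Transposition.transpose k i l) * W (reflection \<delta> k i))" for l
    using assms signs_subset[of T] by (intro W_reflection_C) auto
  have sq: "C m * (C m * x) = x" for m x by (simp add: C_square flip: mult.assoc)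
  have an: "m \<noteq> m' \<Longrightarrow> C m * (C m' * x) = - (C m' * (C m * x))" for m m' x
    by (rule mult_eq_minus_assoc) (rule C_anticommute)
  consider "l = k" | "l = i" | "l \<noteq> k" "l \<noteq> i" by blast
  then show ?thesis
  proof cases
    case 1
    have "W (reflection \<delta> k i) * C k = sc \<delta> * (C i * W (reflection \<delta> k i))" by (simp add: W)
    then show ?thesis using assms(2) sign_cases[OF assms(1)] unfolding 1
      by (auto simp: R_def distrib_left distrib_right mult.assoc sc_minus sq an[of k i] C_square
        left_diff_distrib right_diff_distrib)
  next
    case 2
    have "W (reflection \<delta> k i) * C i = sc \<delta> * (C k * W (reflection \<delta> k i))" by (simp add: W)
    then show ?thesis using assms(2) sign_cases[OF assms(1)] unfolding 2
      by (auto simp: R_def distrib_left distrib_right mult.assoc sc_minus sq an[of i k] C_square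
        left_diff_distrib right_diff_distrib)
  next
    case 3
    then show ?thesis using assms sign_cases[OF assms(1)]
      by (auto simp: R_def distrib_left distrib_right mult.assoc W sc_minus an[of l] left_diff_distrib right_diff_distrib)
  qed
qed

text \<open>The sign is the one picked up by x_i, in accordance with [y_j, x_i], since y_j commutes
  with every c_l. The sign change \<tau>_i of type B obeys the same rule.\<close>

lemma C_\<kappa>: "C l * \<kappa> j i = (if l = i then - (\<kappa> j i * C l) else \<kappa> j i * C l)"
proof (cases "j = i")
  case False
  have "C l * \<kappa> j i = sc u * (\<Sum>\<delta>\<in>signs T. sc \<delta> * (C l * R \<delta> j i))"
    by (simp only: \<kappa>_offdiag[OF False] sum_distrib_left sc_left_commute[of "C l"])
  also have "\<dots> = sc u * (\<Sum>\<delta>\<in>signs T. sc \<delta> * (if l = i then - (R \<delta> j i * C l) else R \<delta> j i * C l))"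
    using False by (simp add: C_R cong: sum.cong)
  also have "\<dots> = (if l = i then - (\<kappa> j i * C l) else \<kappa> j i * C l)"
    by (simp add: \<kappa>_offdiag[OF False] sum_distrib_right sum_negf mult.assoc)
  finally show ?thesis .
next
  case True
  let ?s = "complex_of_real (sqrt 2) * v"
  have W: "C l * W (reflection (-1) i i) = (if l = i then - (W (reflection (-1) i i) * C l) else W (reflection (-1) i i) * C l)"
    by (simp add: W_reflection_C sc_minus)
  have S: "C l * (\<Sum>k\<in>UNIV - {i}. \<Sum>\<delta>\<in>signs T. R \<delta> k i)
    = (\<Sum>k\<in>UNIV - {i}. \<Sum>\<delta>\<in>signs T. if l = i then - (R \<delta> k i * C l) else R \<delta> k i * C l)"
    unfolding sum_distrib_left by (intro sum.cong) (auto simp: C_R)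
  have S': "C l * (\<Sum>k\<in>UNIV - {i}. \<Sum>\<delta>\<in>signs T. R \<delta> k i)
    = (if l = i then - ((\<Sum>k\<in>UNIV - {i}. \<Sum>\<delta>\<in>signs T. R \<delta> k i) * C l) else (\<Sum>k\<in>UNIV - {i}. \<Sum>\<delta>\<in>signs T. R \<delta> k i) * C l)"
    unfolding S by (simp add: sum_distrib_right sum_negf)
  have "C l * \<kappa> i i = - (sc u * (C l * (\<Sum>k\<in>UNIV - {i}. \<Sum>\<delta>\<in>signs T. R \<delta> k i)))
    - (if T = Type_B then sc ?s * (C l * W (reflection (-1) i i)) else 0)"
    by (simp add: \<kappa>_diag right_diff_distrib sc_left_commute[of "C l"])
  also have "\<dots> = (if l = i then - (\<kappa> i i * C l) else \<kappa> i i * C l)"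
    unfolding S' W by (simp add: \<kappa>_diag left_diff_distrib mult.assoc)
  finally show ?thesis using True by simp
qed

lemma D_C: "D i * C l = (if \<not> \<eta> \<and> i = l then - (C l * D i) else C l * D i)"
proof -
  \<comment> \<open>The expected sign of D_i against C_l: x_i anticommutes with c_i, all other pairs
    commute.\<close>
  define s where "s = (if \<not> \<eta> \<and> i = l then -1 else 1 :: 'e)"
  have s: "s * x = x * s" "s * (s * x) = x" "x * (s * y) = s * (x * y)" for x y by (auto simp: s_def)
  define E where "E = D i * C l - s * (C l * D i)"
  have "E = 0"
  proof (rule N_eq_0)
    show "E \<in> N" unfolding E_def by (intro N_diff N_mult N_C N_D)
    fix k
    define K where "K = (if \<eta> then \<kappa> i k else - \<kappa> k i)"
    define z where "z = (if \<eta> \<and> k = l then -1 else 1 :: 'e)"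
    have z: "z * x = x * z" "z * (z * x) = x" "x * (z * y) = z * (x * y)" for x y by (auto simp: z_def)
    have CZ: "C l * Z k = z * (Z k * C l)" by (auto simp: C_Z z_def)
    \<comment> \<open>By this identity the inhomogeneous parts of \<open>D1\<close> and
      \<open>D2\<close> cancel, so that E passes the variable up to a scalar.\<close>
    have CK: "z * (K * C l) = s * (C l * K)"
      by (auto simp: C_\<kappa> K_def z_def s_def)
    have DZ: "D i * Z k = Z k * D i + K" by (simp add: D_Z_\<kappa> K_def)
    have D1: "D i * (C l * Z k) = z * (Z k * (D i * C l)) + z * (K * C l)"
    proof -
      have "D i * (C l * Z k) = z * ((D i * Z k) * C l)"
        by (simp only: CZ z(3)[of "D i"] mult.assoc)
      then show ?thesis by (simp only: DZ distrib_left distrib_right mult.assoc)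
    qed
    have D2: "C l * (D i * Z k) = z * (Z k * (C l * D i)) + C l * K"
    proof -
      have "C l * (D i * Z k) = (C l * Z k) * D i + C l * K"
        by (simp only: DZ distrib_left mult.assoc)
      then show ?thesis by (simp only: CZ mult.assoc)
    qed
    have "E * Z k = D i * (C l * Z k) - s * (C l * (D i * Z k))"
      by (simp add: E_def left_diff_distrib mult.assoc)
    also have "\<dots> = z * (Z k * (D i * C l)) - s * (z * (Z k * (C l * D i)))"
      unfolding D1 D2 CK by (simp add: distrib_left)
    also have "\<dots> = z * (Z k * E)"
      by (simp add: E_def right_diff_distrib s(3)[of z] s(3)[of "Z k"])
    also have "z = sc (if \<eta> \<and> k = l then -1 else 1)" by (simp add: z_def sc_minus)
    finally show "\<exists>a l. E * Z k = sc a * (Z l * E)" by blast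
  qed
  then show ?thesis by (auto simp: E_def s_def)
qed

text \<open>Reflection and Clifford product acquire the same sign
  \<open>\<epsilon> k * \<epsilon> i\<close>, so the conjugate is again of the form
  \<open>R\<close>.\<close>

lemma W_R:
  assumes "bij \<pi>" "range \<epsilon> \<subseteq> {1, -1}" "\<delta> \<in> {1, -1}"
  shows "W (signed_perm \<pi> \<epsilon>) * R \<delta> k i = R (\<delta> * \<epsilon> k * \<epsilon> i) (\<pi> k) (\<pi> i) * W (signed_perm \<pi> \<epsilon>)"
proof -
  let ?w = "signed_perm \<pi> \<epsilon>"
  have B: "?w \<in> weyl_group Type_B" by (rule signed_perm_in_weyl_group[OF assms(1,2)])
  have "\<epsilon> k \<in> {1, -1}" "\<epsilon> i \<in> {1, -1}" using assms(2) by blast+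
  then have e: "\<delta> * \<epsilon> k * \<epsilon> i \<in> {1, -1}" using assms(3) by auto
  have "W ?w * W (reflection \<delta> k i) = W (reflection (\<delta> * \<epsilon> k * \<epsilon> i) (\<pi> k) (\<pi> i)) * W ?w"
    by (simp only: W_mult[OF B refl_in_B[OF assms(3)]] W_mult[OF refl_in_B[OF e] B]
      signed_perm_mult_reflection[OF assms(1,2)])
  note WW = this
  have CC: "W ?w * (C k * C i) = sc (\<epsilon> k * \<epsilon> i) * (C (\<pi> k) * C (\<pi> i) * W ?w)"
  proof -
    have "W ?w * (C k * C i) = sc (\<epsilon> k) * (C (\<pi> k) * (W ?w * C i))"
      by (simp only: mult.assoc[symmetric] W_C[OF assms(1,2), of k])
    also have "\<dots> = sc (\<epsilon> k * \<epsilon> i) * (C (\<pi> k) * C (\<pi> i) * W ?w)"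
      by (simp only: W_C[OF assms(1,2)] sc_left_commute[of "C _"] sc_mult mult.assoc)
    finally show ?thesis .
  qed
  have "W ?w * R \<delta> k i = (W ?w + sc \<delta> * (W ?w * (C k * C i))) * W (reflection \<delta> k i)"
  proof -
    have "W ?w * (1 + sc \<delta> * (C k * C i)) = W ?w + sc \<delta> * (W ?w * (C k * C i))"
      by (simp only: distrib_left mult_1_right sc_left_commute[of "W _"])
    from this[symmetric] show ?thesis by (simp only: R_def mult.assoc)
  qed
  also have "\<dots> = (1 + sc (\<delta> * \<epsilon> k * \<epsilon> i) * (C (\<pi> k) * C (\<pi> i))) * (W ?w * W (reflection \<delta> k i))"
    unfolding CC by (simp add: distrib_right sc_mult mult.assoc)
  finally show ?thesis unfolding WW R_def by (simp only: mult.assoc)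
qed

lemma sc_mult_swap: "sc (a * b) * x = sc b * (sc a * x)"
  by (simp only: mult.commute[of a b] sc_mult[of b a] mult.assoc)

text \<open>Conjugation permutes the summands, so the sums are reindexed by multiplying \<delta>
  with a sign and by sending k to \<pi> k. Off the diagonal the factor \<delta> in front of each
  summand leaves the scalar behind; on the diagonal the scalar is 1.\<close>

lemma W_\<kappa>:
  assumes "bij \<pi>" "range \<epsilon> \<subseteq> {1, -1}" and closed: "\<And>\<delta> k i. \<delta> \<in> signs T \<Longrightarrow> \<delta> * \<epsilon> k * \<epsilon> i \<in> signs T"
  shows "W (signed_perm \<pi> \<epsilon>) * \<kappa> j i = sc (\<epsilon> j * \<epsilon> i) * (\<kappa> (\<pi> j) (\<pi> i) * W (signed_perm \<pi> \<epsilon>))"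
proof -
  let ?w = "signed_perm \<pi> \<epsilon>"
  have inj: "\<pi> a = \<pi> b \<longleftrightarrow> a = b" for a b
    using assms(1) by (auto simp: bij_def inj_def)
  have sq: "\<epsilon> k * \<epsilon> k = 1" for k by (rule sign_square[OF assms(2)])
  have sq2: "(\<epsilon> k * \<epsilon> i) * (\<epsilon> k * \<epsilon> i) = 1" for k i
  proof -
    have "(\<epsilon> k * \<epsilon> i) * (\<epsilon> k * \<epsilon> i) = (\<epsilon> k * \<epsilon> k) * (\<epsilon> i * \<epsilon> i)" by (simp only: mult_ac)
    then show ?thesis by (simp only: sq mult_1_right)
  qed
  have WR: "W ?w * R \<delta> k i = R (\<delta> * (\<epsilon> k * \<epsilon> i)) (\<pi> k) (\<pi> i) * W ?w" if "\<delta> \<in> signs T" for \<delta> k i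
    using W_R[OF assms(1,2), of \<delta> k i] that signs_subset[of T] by (auto simp: mult.assoc)
  have closed': "\<delta> \<in> signs T \<Longrightarrow> \<delta> * (\<epsilon> k * \<epsilon> i) \<in> signs T" for \<delta> k i
    using closed[of \<delta> k i] by (simp add: mult.assoc)
  show ?thesis
  proof (cases "j = i")
    case False
    let ?e = "\<epsilon> j * \<epsilon> i"
    have "W ?w * \<kappa> j i = sc u * (\<Sum>\<delta>\<in>signs T. sc \<delta> * (W ?w * R \<delta> j i))"
      by (simp only: \<kappa>_offdiag[OF False] sum_distrib_left sc_left_commute[of "W _"])
    also have "(\<Sum>\<delta>\<in>signs T. sc \<delta> * (W ?w * R \<delta> j i))
        = (\<Sum>\<delta>\<in>signs T. sc ((\<delta> * ?e) * ?e) * (R (\<delta> * ?e) (\<pi> j) (\<pi> i) * W ?w))"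
      by (intro sum.cong) (simp_all only: WR mult.assoc[of _ ?e ?e] sq2 mult_1_right)
    also have "\<dots> = (\<Sum>\<delta>\<in>signs T. sc (\<delta> * ?e) * (R \<delta> (\<pi> j) (\<pi> i) * W ?w))"
      by (rule sum_signs_mult[OF closed' sq2])
    also have "\<dots> = sc ?e * ((\<Sum>\<delta>\<in>signs T. sc \<delta> * R \<delta> (\<pi> j) (\<pi> i)) * W ?w)"
      unfolding sum_distrib_left sum_distrib_right
      by (intro sum.cong) (simp_all only: sc_mult_swap mult.assoc)
    also have "sc u * \<dots> = sc ?e * (\<kappa> (\<pi> j) (\<pi> i) * W ?w)"
      using False by (simp only: \<kappa>_offdiag inj not_False_eq_True mult.assoc sc_left_commute[of "sc u" ?e])
    finally show ?thesis .
  next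
    case True
    have img: "\<pi> ` (UNIV - {i}) = UNIV - {\<pi> i}"
      using assms(1) by (simp add: image_set_diff bij_is_inj bij_is_surj)
    have S: "W ?w * (\<Sum>k\<in>UNIV - {i}. \<Sum>\<delta>\<in>signs T. R \<delta> k i)
      = (\<Sum>k\<in>UNIV - {\<pi> i}. \<Sum>\<delta>\<in>signs T. R \<delta> k (\<pi> i)) * W ?w"
    proof -
      have "W ?w * (\<Sum>k\<in>UNIV - {i}. \<Sum>\<delta>\<in>signs T. R \<delta> k i)
        = (\<Sum>k\<in>UNIV - {i}. \<Sum>\<delta>\<in>signs T. R (\<delta> * (\<epsilon> k * \<epsilon> i)) (\<pi> k) (\<pi> i) * W ?w)"
        unfolding sum_distrib_left by (intro sum.cong) (simp_all only: WR)
      also have "\<dots> = (\<Sum>k\<in>UNIV - {i}. \<Sum>\<delta>\<in>signs T. R \<delta> (\<pi> k) (\<pi> i) * W ?w)"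
        by (intro sum.cong HOL.refl sum_signs_mult[OF closed' sq2])
      also have "\<dots> = (\<Sum>k\<in>\<pi> ` (UNIV - {i}). \<Sum>\<delta>\<in>signs T. R \<delta> k (\<pi> i) * W ?w)"
        using assms(1) by (subst sum.reindex) (auto simp: bij_def intro: inj_on_subset)
      finally show ?thesis unfolding img by (simp add: sum_distrib_right)
    qed
    have t: "W ?w * W (reflection (-1) i i) = W (reflection (-1) (\<pi> i) (\<pi> i)) * W ?w"
    proof -
      have B: "?w \<in> weyl_group Type_B" by (rule signed_perm_in_weyl_group[OF assms(1,2)])
      have "?w ** reflection (-1) i i = reflection (-1) (\<pi> i) (\<pi> i) ** ?w"
        using signed_perm_mult_reflection[OF assms(1,2), of "-1" i i] sq[of i] by simp
      then show ?thesis by (simp add: W_mult B refl_in_B del: weyl_group.simps)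
    qed
    have "W ?w * \<kappa> i i = - (sc u * (W ?w * (\<Sum>k\<in>UNIV - {i}. \<Sum>\<delta>\<in>signs T. R \<delta> k i)))
      - (if T = Type_B then sc (complex_of_real (sqrt 2) * v) * (W ?w * W (reflection (-1) i i)) else 0)"
      by (simp add: \<kappa>_diag right_diff_distrib sc_left_commute[of "W _"])
    also have "\<dots> = \<kappa> (\<pi> i) (\<pi> i) * W ?w"
      unfolding S t by (simp add: \<kappa>_diag left_diff_distrib mult.assoc)
    finally show ?thesis using True sq[of i] by simp
  qed
qed

text \<open>By \<open>W_\<kappa>\<close> the defect of this rule carries Z_k to a multiple of the
  variable with index \<pi> k; as it lies in \<open>N\<close>, it vanishes.\<close>

lemma W_D:
  assumes "bij \<pi>" "range \<epsilon> \<subseteq> {1, -1}" "\<And>\<delta> k i. \<delta> \<in> signs T \<Longrightarrow> \<delta> * \<epsilon> k * \<epsilon> i \<in> signs T"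
  shows "W (signed_perm \<pi> \<epsilon>) * D i = sc (\<epsilon> i) * (D (\<pi> i) * W (signed_perm \<pi> \<epsilon>))"
proof -
  let ?w = "signed_perm \<pi> \<epsilon>"
  define E where "E = W ?w * D i - sc (\<epsilon> i) * (D (\<pi> i) * W ?w)"
  have "E = 0"
  proof (rule N_eq_0)
    show "E \<in> N" unfolding E_def by (intro N_diff N_mult N_W N_D)
    fix k
    define K where "K a b = (if \<eta> then \<kappa> a b else - \<kappa> b a)" for a b
    have WK: "W ?w * K i k = sc (\<epsilon> i) * (sc (\<epsilon> k) * (K (\<pi> i) (\<pi> k) * W ?w))"
      by (simp add: K_def W_\<kappa>[OF assms] sc_mult mult.assoc sc_commute[of "sc (\<epsilon> k)" "\<epsilon> i"]
        sc_left_commute[of "sc (\<epsilon> k)" "\<epsilon> i"])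
    have D1: "W ?w * (D i * Z k) = sc (\<epsilon> k) * (Z (\<pi> k) * (W ?w * D i)) + W ?w * K i k"
    proof -
      have "W ?w * (D i * Z k) = (W ?w * Z k) * D i + W ?w * K i k"
        by (simp only: D_Z_\<kappa> K_def distrib_left mult.assoc)
      then show ?thesis by (simp only: W_Z[OF assms(1,2)] mult.assoc)
    qed
    have D2: "D (\<pi> i) * (W ?w * Z k)
      = sc (\<epsilon> k) * (Z (\<pi> k) * (D (\<pi> i) * W ?w)) + sc (\<epsilon> k) * (K (\<pi> i) (\<pi> k) * W ?w)"
    proof -
      have "D (\<pi> i) * (W ?w * Z k) = sc (\<epsilon> k) * ((D (\<pi> i) * Z (\<pi> k)) * W ?w)"
        by (simp only: W_Z[OF assms(1,2)] sc_left_commute[of "D _"] mult.assoc)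
      then show ?thesis by (simp only: D_Z_\<kappa> K_def distrib_left distrib_right mult.assoc)
    qed
    have "E * Z k = W ?w * (D i * Z k) - sc (\<epsilon> i) * (D (\<pi> i) * (W ?w * Z k))"
      by (simp add: E_def left_diff_distrib mult.assoc)
    also have "\<dots> = sc (\<epsilon> k) * (Z (\<pi> k) * (W ?w * D i)) - sc (\<epsilon> i) * (sc (\<epsilon> k) * (Z (\<pi> k) * (D (\<pi> i) * W ?w)))"
      unfolding D1 D2 WK by (simp add: distrib_left)
    also have "\<dots> = sc (\<epsilon> k) * (Z (\<pi> k) * E)"
      by (simp add: E_def right_diff_distrib sc_left_commute[of "Z _"] sc_left_commute[of "sc (\<epsilon> k)" "\<epsilon> i"])
    finally show "\<exists>a l. E * Z k = sc a * (Z l * E)" by blast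
  qed
  then show ?thesis by (simp add: E_def)
qed

lemma W_reflection_D:
  assumes "reflection \<delta> k i \<in> weyl_group T" "\<delta> \<in> {1, -1}" "T = Type_A \<Longrightarrow> \<delta> = 1"
  shows "W (reflection \<delta> k i) * D l
    = (if l \<in> {k, i} then sc \<delta> else 1) * (D (Transposition.transpose k i l) * W (reflection \<delta> k i))"
proof -
  let ?\<epsilon> = "\<lambda>l. if l \<in> {k, i} then \<delta> else 1"
  have "range ?\<epsilon> \<subseteq> {1, -1}" using assms(2) by auto
  moreover have "\<delta>' * ?\<epsilon> m * ?\<epsilon> n \<in> signs T" if "\<delta>' \<in> signs T" for \<delta>' m n
    using that assms(2,3) by (auto simp: signs_def split: if_splits)
  ultimately show ?thesis
    using W_D[OF bij_transpose, of ?\<epsilon> k i l] by (simp only: reflection_def if_distrib[of sc] sc_1)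
qed

lemma W_signs_D:
  assumes "\<delta> \<in> signs T" "k \<noteq> i"
  shows "W (reflection \<delta> k i) * D l
    = (if l \<in> {k, i} then sc \<delta> else 1) * (D (Transposition.transpose k i l) * W (reflection \<delta> k i))"
  using assms signs_subset[of T]
  by (intro W_reflection_D refl_in_weyl_group) (auto simp: signs_def split: if_splits)

section \<open>The Jacobi identity and commutation of the momenta\<close>

lemma D_R:
  assumes "\<delta> \<in> signs T" "k \<noteq> l" "i \<noteq> k" "i \<noteq> l"
  shows "D i * R \<delta> k l = R \<delta> k l * D i"
proof -
  have W: "W (reflection \<delta> k l) * D i = D i * W (reflection \<delta> k l)"
    using W_signs_D[OF assms(1,2), of i] assms(3,4) by simp
  have c: "D i * C k = C k * D i" "D i * C l = C l * D i" using assms(3,4) by (simp_all add: D_C)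
  have "D i * R \<delta> k l = (1 + sc \<delta> * (C k * C l)) * (D i * W (reflection \<delta> k l))"
    by (simp only: R_def distrib_left distrib_right mult.assoc sc_left_commute[of "D _"]
      mult_eq_assoc[OF c(1)] mult_eq_assoc[OF c(2)] mult_1_left mult_1_right)
  then show ?thesis by (simp only: W[symmetric] R_def mult.assoc)
qed

text \<open>The reflection exchanges D_i and D_j up to \<delta>, hence it commutes with
  \<open>\<delta> * D i + D j\<close>. For D = y so does the Clifford factor. For D = x the product
  c_j c_i changes sign against D_i and D_j; the exchanged indices in the first \<open>R\<close> make
  up for this, because C_i C_j = - C_j C_i.\<close>

lemma D_R_bracket:
  assumes "\<delta> \<in> signs T" "i \<noteq> j"
  shows "sc \<delta> * (D i * (if \<eta> then R \<delta> j i else R \<delta> i j) - (if \<eta> then R \<delta> j i else R \<delta> i j) * D i)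
    = - (D j * R \<delta> j i - R \<delta> j i * D j)"
proof -
  have sym: "reflection \<delta> i j = reflection \<delta> j i"
    by (simp add: reflection_def transpose_commute insert_commute)
  have W: "W (reflection \<delta> j i) * D i = sc \<delta> * (D j * W (reflection \<delta> j i))"
    "W (reflection \<delta> j i) * D j = sc \<delta> * (D i * W (reflection \<delta> j i))"
    using W_signs_D[OF assms(1), of j i] assms(2) by simp_all
  have CD: "C m * D n = (if \<not> \<eta> \<and> n = m then - (D n * C m) else D n * C m)"
    "C m * (D n * x) = (if \<not> \<eta> \<and> n = m then - (D n * (C m * x)) else D n * (C m * x))" for m n x
  proof -
    show *: "C m * D n = (if \<not> \<eta> \<and> n = m then - (D n * C m) else D n * C m)"
      using D_C[of n m] by (auto split: if_splits)
    show "C m * (D n * x) = (if \<not> \<eta> \<and> n = m then - (D n * (C m * x)) else D n * (C m * x))"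
      by (simp only: mult.assoc[symmetric] *) simp
  qed
  have an: "C j * (C i * x) = - (C i * (C j * x))" for x
    by (rule mult_eq_minus_assoc) (use assms(2) in \<open>rule C_anticommute[OF not_sym]\<close>)
  show ?thesis
    using sign_cases[OF assms(1)] assms(2)
    by (cases \<eta>) (auto simp: R_def sym W CD an sc_minus distrib_left distrib_right left_diff_distrib right_diff_distrib mult.assoc)
qed

lemma D_\<kappa>_commute:
  assumes "k \<noteq> l" "i \<noteq> k" "i \<noteq> l"
  shows "D i * \<kappa> k l = \<kappa> k l * D i"
proof -
  have "D i * \<kappa> k l = sc u * (\<Sum>\<delta>\<in>signs T. sc \<delta> * (D i * R \<delta> k l))"
    by (simp only: \<kappa>_offdiag[OF assms(1)] sum_distrib_left sc_left_commute[of "D i"])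
  also have "\<dots> = sc u * (\<Sum>\<delta>\<in>signs T. sc \<delta> * (R \<delta> k l * D i))"
    using assms by (simp add: D_R cong: sum.cong)
  finally show ?thesis by (simp add: \<kappa>_offdiag[OF assms(1)] sum_distrib_right mult.assoc)
qed

text \<open>The summands with k different from j commute with D_j, and so does \<tau>_i in type
  B.\<close>

lemma D_\<kappa>_diag:
  assumes "i \<noteq> j"
  shows "D j * \<kappa> i i - \<kappa> i i * D j = - (sc u * (\<Sum>\<delta>\<in>signs T. D j * R \<delta> j i - R \<delta> j i * D j))"
proof -
  let ?S = "\<Sum>k\<in>UNIV - {i}. \<Sum>\<delta>\<in>signs T. R \<delta> k i"
  let ?t = "if T = Type_B then sc (complex_of_real (sqrt 2) * v) * W (reflection (-1) i i) else 0"
  have "D j * ?S - ?S * D j = (\<Sum>k\<in>UNIV - {i}. \<Sum>\<delta>\<in>signs T. D j * R \<delta> k i - R \<delta> k i * D j)"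
    by (simp only: sum_distrib_left sum_distrib_right sum_subtractf)
  also have "\<dots> = (\<Sum>k\<in>UNIV - {i}. if k = j then (\<Sum>\<delta>\<in>signs T. D j * R \<delta> j i - R \<delta> j i * D j) else 0)"
    using assms by (intro sum.cong) (auto simp: D_R)
  also have "\<dots> = (\<Sum>\<delta>\<in>signs T. D j * R \<delta> j i - R \<delta> j i * D j)"
    using assms by simp
  finally have S: "D j * ?S - ?S * D j = (\<Sum>\<delta>\<in>signs T. D j * R \<delta> j i - R \<delta> j i * D j)" .
  have t: "D j * ?t = ?t * D j"
  proof (cases "T = Type_B")
    case True
    then have "W (reflection (-1) i i) * D j = D j * W (reflection (-1) i i)"
      using W_reflection_D[of "-1" i i j] assms by (simp add: refl_in_B del: weyl_group.simps)
    with True show ?thesis by (simp add: mult.assoc sc_left_commute[of "D j"])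
  qed simp
  have "D j * \<kappa> i i - \<kappa> i i * D j = - (sc u * (D j * ?S - ?S * D j)) - (D j * ?t - ?t * D j)"
    unfolding \<kappa>_diag by (simp only: right_diff_distrib left_diff_distrib sc_left_commute[of "D j"] mult.assoc
      mult_minus_left mult_minus_right) simp
  then show ?thesis unfolding S t by simp
qed

text \<open>This is [D_i, [D_j, Z_i]] = [D_j, [D_i, Z_i]], the case of the Jacobi identity in which
  the position variable shares its index with a momentum. For three distinct indices both sides are
  0.\<close>

lemma D_\<kappa>_bracket:
  assumes "i \<noteq> j"
  shows "D i * (if \<eta> then \<kappa> j i else \<kappa> i j) - (if \<eta> then \<kappa> j i else \<kappa> i j) * D i = D j * \<kappa> i i - \<kappa> i i * D j"
proof -
  let ?R = "\<lambda>\<delta>. if \<eta> then R \<delta> j i else R \<delta> i j"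
  have K: "(if \<eta> then \<kappa> j i else \<kappa> i j) = sc u * (\<Sum>\<delta>\<in>signs T. sc \<delta> * ?R \<delta>)"
    using assms by (simp add: \<kappa>_offdiag)
  have "D i * (sc u * (\<Sum>\<delta>\<in>signs T. sc \<delta> * ?R \<delta>)) - (sc u * (\<Sum>\<delta>\<in>signs T. sc \<delta> * ?R \<delta>)) * D i
    = sc u * (\<Sum>\<delta>\<in>signs T. sc \<delta> * (D i * ?R \<delta> - ?R \<delta> * D i))"
    by (simp only: sc_left_commute[of "D i"] sum_distrib_left sum_distrib_right right_diff_distrib sum_subtractf mult.assoc)
  also have "\<dots> = sc u * (\<Sum>\<delta>\<in>signs T. - (D j * R \<delta> j i - R \<delta> j i * D j))"
    by (intro arg_cong2[of _ _ _ _ "(*)"] sum.cong HOL.refl D_R_bracket assms)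
  also have "\<dots> = - (sc u * (\<Sum>\<delta>\<in>signs T. D j * R \<delta> j i - R \<delta> j i * D j))"
    by (simp only: sum_negf mult_minus_right)
  finally show ?thesis unfolding K D_\<kappa>_diag[OF assms] .
qed

lemma D_commute: "D i * D j = D j * D i"
proof (cases "i = j")
  case False
  define E where "E = D i * D j - D j * D i"
  have "E = 0"
  proof (rule N_eq_0)
    show "E \<in> N" unfolding E_def by (intro N_diff N_mult N_D)
    fix k
    define K where "K a = (if \<eta> then \<kappa> a k else - \<kappa> k a)" for a
    have br: "D i * K j - K j * D i = D j * K i - K i * D j"
    proof -
      consider "k \<noteq> i" "k \<noteq> j" | "k = i" | "k = j" by blast
      then show ?thesis
      proof cases
        case 1
        then show ?thesis using False by (simp add: K_def D_\<kappa>_commute)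
      next
        case 2
        with D_\<kappa>_bracket[OF False] show ?thesis by (auto simp: K_def algebra_simps split: if_splits)
      next
        case 3
        with D_\<kappa>_bracket[OF False[symmetric]] show ?thesis by (auto simp: K_def algebra_simps split: if_splits)
      qed
    qed
    have DZ: "D a * Z k = Z k * D a + K a" for a by (simp add: D_Z_\<kappa> K_def)
    have DDZ: "D a * (D b * Z k) = Z k * (D a * D b) + K a * D b + D a * K b" for a b
    proof -
      have "D a * (D b * Z k) = (D a * Z k) * D b + D a * K b"
        by (simp only: DZ[of b] distrib_left mult.assoc)
      then show ?thesis by (simp only: DZ[of a] distrib_right mult.assoc)
    qed
    have "E * Z k = Z k * E + ((D i * K j - K j * D i) - (D j * K i - K i * D j))"
      by (simp add: E_def left_diff_distrib right_diff_distrib mult.assoc DDZ)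
    also have "\<dots> = sc 1 * (Z k * E)" unfolding br by simp
    finally show "\<exists>a l. E * Z k = sc a * (Z l * E)" by blast
  qed
  then show ?thesis by (simp add: E_def)
qed simp

section \<open>Verification of the defining relations\<close>

lemma rep_conjugate_lin:
  assumes "bij \<pi>" "range \<epsilon> \<subseteq> {1, -1}"
    and "\<And>i. W (signed_perm \<pi> \<epsilon>) * h (K i) = sc (\<epsilon> i) * (h (K (\<pi> i)) * W (signed_perm \<pi> \<epsilon>))"
  shows "W (signed_perm \<pi> \<epsilon>) * rep (lin K a) * W (matrix_inv (signed_perm \<pi> \<epsilon>)) = rep (lin K (signed_perm \<pi> \<epsilon> *v a))"
proof -
  let ?w = "signed_perm \<pi> \<epsilon>"
  have B: "?w \<in> weyl_group Type_B" by (rule signed_perm_in_weyl_group[OF assms(1,2)])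
  have "W ?w * W (matrix_inv ?w) = W (?w ** matrix_inv ?w)"
    by (rule W_mult[OF B weyl_group_inverse[OF B]])
  also have "?w ** matrix_inv ?w = mat 1" by (rule weyl_group_matrix_inv(1)[OF B])
  finally have inv: "W ?w * W (matrix_inv ?w) = 1" by (simp only: W_1)
  have "W ?w * rep (lin K a) = (\<Sum>i\<in>UNIV. sc (a $ i * \<epsilon> i) * h (K (\<pi> i))) * W ?w"
    by (simp only: rep_lin sum_distrib_left sum_distrib_right sc_left_commute[of "W _"] assms(3) sc_mult mult.assoc)
  also have "(\<Sum>i\<in>UNIV. sc (a $ i * \<epsilon> i) * h (K (\<pi> i))) = rep (lin K (?w *v a))"
  proof -
    have "rep (lin K (?w *v a)) = (\<Sum>j\<in>UNIV. sc (\<Sum>i\<in>UNIV. if j = \<pi> i then a $ i * \<epsilon> i else 0) * h (K j))"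
      unfolding rep_lin by (intro sum.cong arg_cong2[of _ _ _ _ "(*)"] arg_cong[of _ _ sc] HOL.refl)
        (auto simp: matrix_vector_mult_def signed_perm_def intro!: sum.cong)
    also have "\<dots> = (\<Sum>j\<in>UNIV. \<Sum>i\<in>UNIV. if j = \<pi> i then sc (a $ i * \<epsilon> i) * h (K (\<pi> i)) else 0)"
      unfolding sc_sum sum_distrib_right by (intro sum.cong) auto
    also have "\<dots> = (\<Sum>i\<in>UNIV. \<Sum>j\<in>UNIV. if j = \<pi> i then sc (a $ i * \<epsilon> i) * h (K (\<pi> i)) else 0)"
      by (rule sum.swap)
    finally show ?thesis by simp
  qed
  finally show ?thesis using inv by (simp add: mult.assoc)
qed

lemma rep_rels:
  assumes "r \<in> rdahc_rels T u v"
  shows "rep r = 0"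
proof -
  have XY: "h (Xgen i) = (if \<eta> then Z i else D i)" "h (Ygen i) = (if \<eta> then D i else Z i)" for i
    by (simp_all add: Z_def D_def)
  have hC: "h (Cgen i) = C i" for i by (simp add: C_def)
  have conj: "rep (gen (Wgen w) * lin K a * gen (Wgen (matrix_inv w)) - lin K (w *v a)) = 0"
    if w: "w \<in> weyl_group T" and K: "K \<in> {Xgen, Ygen, Cgen}" for w K a
  proof -
    obtain \<pi> \<epsilon> where w': "w = signed_perm \<pi> \<epsilon>" "bij \<pi>" "range \<epsilon> \<subseteq> {1, -1}"
      "\<And>\<delta> k i. \<delta> \<in> signs T \<Longrightarrow> \<delta> * \<epsilon> k * \<epsilon> i \<in> signs T"
      using w by (rule weyl_group_cases) blast
    have "W w * h (K i) = sc (\<epsilon> i) * (h (K (\<pi> i)) * W w)" for i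
      using K W_Z[OF w'(2,3), of i] W_D[OF w'(2-4), of i] W_C[OF w'(2,3), of i]
      by (auto simp: w'(1) XY C_def simp flip: W_def split: if_splits)
    then show ?thesis
      using rep_conjugate_lin[OF w'(2,3), of K a] by (simp add: w'(1) rep_simps W_def)
  qed
  have YX: "rep (comm (gen (Ygen j)) (gen (Xgen i))) = \<kappa> j i" for i j
    using D_Z_\<kappa>[of i j] D_Z_\<kappa>[of j i] by (simp add: comm_def rep_simps XY)
  from assms show ?thesis
    unfolding rdahc_rels_def
  proof (elim UnE CollectE exE conjE singletonE)
    fix w w' assume "r = fW w * fW w' - fW (w ** w')" "w \<in> weyl_group T" "w' \<in> weyl_group T"
    then show ?thesis using W_mult[OF weyl_group_subset_B weyl_group_subset_B, of w T w' T]
      by (simp add: rep_simps W_def)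
  next
    assume "r = fW (mat 1) - 1"
    then show ?thesis using W_1 by (simp add: rep_simps W_def)
  next
    fix i assume "r = fC i * fC i - 1"
    then show ?thesis using C_square[of i] by (simp add: rep_simps C_def)
  next
    fix i j assume "r = fC i * fC j + fC j * fC i" "i \<noteq> j"
    then show ?thesis using C_anticommute[of i j] by (simp add: rep_simps C_def)
  next
    fix i j assume "r = comm (gen (Xgen i)) (gen (Xgen j))"
    then show ?thesis using Z_commute[of i j] D_commute[of i j] by (simp add: rep_simps comm_def XY)
  next
    fix i j assume "r = comm (gen (Ygen i)) (gen (Ygen j))"
    then show ?thesis using Z_commute[of i j] D_commute[of i j] by (simp add: rep_simps comm_def XY)
  next
    fix i j assume "r = comm (gen (Ygen i)) (fC j)"
    then show ?thesis using C_Z[of j i] D_C[of i j]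
      by (auto simp: rep_simps comm_def XY hC)
  next
    fix i assume "r = gen (Xgen i) * fC i + fC i * gen (Xgen i)"
    then show ?thesis using C_Z[of i i] D_C[of i i]
      by (auto simp: rep_simps comm_def XY hC)
  next
    fix i j assume "r = comm (gen (Xgen i)) (fC j)" "i \<noteq> j"
    then show ?thesis using C_Z[of j i] D_C[of i j]
      by (auto simp: rep_simps comm_def XY hC)
  next
    fix w K a
    assume "r = gen (Wgen w) * lin K a * gen (Wgen (matrix_inv w)) - lin K (w *v a)"
      "w \<in> weyl_group T" "K \<in> {Xgen, Ygen, Cgen}"
    then show ?thesis using conj by blast
  next
    fix i j assume "r = comm (gen (Ygen j)) (gen (Xgen i)) - comm_offdiag T u j i" "i \<noteq> j"
    then show ?thesis using YX[of j i] by (simp add: rep_diff \<kappa>_def yx_comm_def)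
  next
    fix i assume "r = comm (gen (Ygen i)) (gen (Xgen i)) - comm_diag T u v i"
    then show ?thesis using YX[of i i] by (simp add: rep_diff \<kappa>_def yx_comm_def)
  qed
qed

end

section \<open>The polynomial representation\<close>

text \<open>Vector components are indexed by a finite type. Injectivity of \<rho> assigns different
  Jordan-Wigner operators to different c_i, as anticommutation requires.\<close>

typedef 'n bijection = "{f :: 'n \<Rightarrow> 'n. bij f}"
  morphisms bij_app Bijection
  by (rule exI[of _ id]) simp

instance bijection :: (finite) finite
proof
  have "(UNIV :: 'a bijection set) \<subseteq> Bijection ` UNIV"
    by (metis UNIV_I bij_app_inverse image_eqI subsetI)
  then show "finite (UNIV :: 'a bijection set)" by (rule finite_subset) simp
qed

text \<open>The operators act on polynomials with values in the module induced to \<open>\<C>\<^sub>n \<rtimes> W\<close> from the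
  Jordan-Wigner module of the Clifford algebra. At an index \<open>(\<rho>, d, S)\<close> the generator \<open>c\<^sub>i\<close> acts as
  the \<open>\<rho> i\<close>-th Jordan-Wigner operator on the subset \<open>S\<close>, with an additional sign if \<open>d i\<close>.\<close>

type_synonym 'n rep_index = "'n bijection \<times> ('n \<Rightarrow> bool) \<times> 'n set"
type_synonym 'n rep_space = "('n mpoly, 'n rep_index) vec"

definition smult_space :: "complex \<Rightarrow> 'n::finite rep_space \<Rightarrow> 'n rep_space" where
  "smult_space a F = (\<chi> q. mconst a * F $ q)"

text \<open>Linearity is over the scalars only, since reflections and divided differences are not
  linear over polynomials. Additivity gives left distributivity, and homogeneity makes the scalars
  central.\<close>

typedef 'n rep_op = "{f :: 'n::finite rep_space \<Rightarrow> 'n rep_space.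
    (\<forall>F G. f (F + G) = f F + f G) \<and> (\<forall>a F. f (smult_space a F) = smult_space a (f F))}"
  morphisms app Op
  by (rule exI[of _ id]) simp

lemma app_add: "app A (F + G) = app A F + app A G"
  using app[of A] by simp

lemma app_smult: "app A (smult_space a F) = smult_space a (app A F)"
  using app[of A] by simp

lemma app_0 [simp]: "app A 0 = 0"
  using app_add[of A 0 0] by simp

lemma app_sum: "app A (sum F I) = (\<Sum>i\<in>I. app A (F i))"
  by (induction I rule: infinite_finite_induct) (auto simp: app_add)

lemma app_Op:
  "(\<And>F G. f (F + G) = f F + f G) \<Longrightarrow> (\<And>a F. f (smult_space a F) = smult_space a (f F)) \<Longrightarrow> app (Op f) = f"
  by (rule Op_inverse) simp

lemma smult_space_simps:
  "smult_space a F $ q = mconst a * F $ q" "smult_space a 0 = 0"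
  "smult_space a (F + G) = smult_space a F + smult_space a G"
  "smult_space a (F - G) = smult_space a F - smult_space a G"
  "smult_space a (- F) = - smult_space a F"
  by (simp_all add: smult_space_def vec_eq_iff algebra_simps)

lemma rep_op_eqI: "(\<And>F q. app A F $ q = app B F $ q) \<Longrightarrow> A = B"
  by (simp add: app_inject[symmetric] fun_eq_iff vec_eq_iff)

instantiation rep_op :: (finite) ring_1
begin
definition "0 = Op (\<lambda>F :: 'a rep_space. 0)"
definition "1 = Op (\<lambda>F :: 'a rep_space. F)"
definition "A + B = Op (\<lambda>F :: 'a rep_space. app A F + app B F)"
definition "A - B = Op (\<lambda>F :: 'a rep_space. app A F - app B F)"
definition "- A = Op (\<lambda>F :: 'a rep_space. - app A F)"
definition "A * B = Op (\<lambda>F :: 'a rep_space. app A (app B F))"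

lemma app_ring_simps:
  "app 0 F = 0" "app 1 F = F" "app (A + B) F = app A F + app B F" "app (A - B) F = app A F - app B F"
  "app (- A) F = - app A F" "app (A * B) F = app A (app B F)"
  for A B :: "'a::finite rep_op"
  by (simp_all add: zero_rep_op_def one_rep_op_def plus_rep_op_def minus_rep_op_def uminus_rep_op_def
      times_rep_op_def app_Op app_add app_smult smult_space_simps)

instance
proof
  show "(0 :: 'a rep_op) \<noteq> 1"
  proof
    assume "(0 :: 'a rep_op) = 1"
    then have "app (0 :: 'a rep_op) (\<chi> q. 1) = app 1 (\<chi> q. 1)" by simp
    then show False by (simp add: app_ring_simps vec_eq_iff)
  qed
qed (auto intro!: rep_op_eqI simp: app_ring_simps app_add algebra_simps)

end

definition op_scal :: "complex \<Rightarrow> 'n::finite rep_op" where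
  "op_scal a = Op (\<lambda>F. \<chi> q. mconst a * F $ q)"

definition op_var :: "'n \<Rightarrow> 'n::finite rep_op" where
  "op_var l = Op (\<lambda>F. \<chi> q. mvar l * F $ q)"

definition op_act :: "complex^'n^'n \<Rightarrow> 'n::finite rep_op" where
  "op_act w = Op (\<lambda>F. \<chi> q. mact w (F $ q))"

definition op_dd :: "complex \<Rightarrow> 'n \<Rightarrow> 'n \<Rightarrow> 'n::finite rep_op" where
  "op_dd \<delta> k i = Op (\<lambda>F. \<chi> q. dd \<delta> k i (F $ q))"

text \<open>Group generators are matrices, whereas the action on indices needs a permutation and
  signs; both are recovered from the nonzero entry in each column.\<close>

definition perm_of :: "complex^'n^'n \<Rightarrow> 'n \<Rightarrow> 'n" where
  "perm_of w i = (THE j. w $ j $ i \<noteq> 0)"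

definition neg_of :: "complex^'n^'n \<Rightarrow> 'n \<Rightarrow> bool" where
  "neg_of w i \<longleftrightarrow> w $ perm_of w i $ i = -1"

lemma perm_of_signed_perm:
  assumes "range \<epsilon> \<subseteq> {1, -1}"
  shows "perm_of (signed_perm \<pi> \<epsilon>) = \<pi>"
proof
  fix i
  have "\<epsilon> i \<in> {1, -1}" using assms by blast
  then show "perm_of (signed_perm \<pi> \<epsilon>) i = \<pi> i"
    unfolding perm_of_def by (intro the_equality) (auto simp: signed_perm_def split: if_splits)
qed

lemma neg_of_signed_perm:
  "range \<epsilon> \<subseteq> {1, -1} \<Longrightarrow> neg_of (signed_perm \<pi> \<epsilon>) i \<longleftrightarrow> \<epsilon> i = -1"
  by (simp add: neg_of_def perm_of_signed_perm) (simp add: signed_perm_def)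

text \<open>Right multiplication of the signed permutation (\<rho>, d) by w. A right action on
  indices makes \<open>op_perm\<close>, which precomposes with it, a left action. All signed
  permutations occur as indices, so one space serves the three types.\<close>

definition index_act :: "complex^'n^'n \<Rightarrow> 'n::finite rep_index \<Rightarrow> 'n rep_index" where
  "index_act w = (\<lambda>(\<rho>, d, S). (Bijection (bij_app \<rho> \<circ> perm_of w), \<lambda>i. d (perm_of w i) \<noteq> neg_of w i, S))"

definition op_perm :: "complex^'n^'n \<Rightarrow> 'n::finite rep_op" where
  "op_perm w = Op (\<lambda>F. \<chi> q. F $ index_act w q)"

definition toggle :: "'a \<Rightarrow> 'a set \<Rightarrow> 'a set" where
  "toggle i S = (if i \<in> S then S - {i} else insert i S)"

text \<open>The parity of the number of elements of S below j; \<open>to_nat\<close> supplies some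
  linear order.\<close>

definition jw_sign :: "'n::finite \<Rightarrow> 'n set \<Rightarrow> complex" where
  "jw_sign j S = (-1) ^ card {k \<in> S. to_nat k < to_nat j}"

definition cliff_sign :: "'n \<Rightarrow> 'n::finite rep_index \<Rightarrow> complex" where
  "cliff_sign i = (\<lambda>(\<rho>, d, S). (if d i then -1 else 1) * jw_sign (bij_app \<rho> i) S)"

definition cliff_index :: "'n \<Rightarrow> 'n::finite rep_index \<Rightarrow> 'n rep_index" where
  "cliff_index i = (\<lambda>(\<rho>, d, S). (\<rho>, d, toggle (bij_app \<rho> i) S))"

definition op_cliff :: "'n \<Rightarrow> 'n::finite rep_op" where
  "op_cliff i = Op (\<lambda>F. \<chi> q. mconst (cliff_sign i q) * F $ cliff_index i q)"

lemma app_op_simps: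
  "app (op_scal a) F $ q = mconst a * F $ q"
  "app (op_var l) F $ q = mvar l * F $ q"
  "app (op_act w) F $ q = mact w (F $ q)"
  "app (op_perm w) F $ q = F $ index_act w q"
  "app (op_cliff i) F $ q = mconst (cliff_sign i q) * F $ cliff_index i q"
  by (simp_all add: op_scal_def op_var_def op_act_def op_perm_def op_cliff_def app_Op vec_eq_iff
      distrib_left mact_add mact_mult smult_space_simps mult.left_commute)

lemma app_op_dd: "root_data \<delta> k i \<Longrightarrow> app (op_dd \<delta> k i) F $ q = dd \<delta> k i (F $ q)"
  by (simp add: op_dd_def app_Op vec_eq_iff root_data.dd_add root_data.dd_const_mult smult_space_simps)

lemma toggle_toggle: "toggle i (toggle i S) = S"
  and toggle_commute: "toggle i (toggle j S) = toggle j (toggle i S)"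
  by (auto simp: toggle_def)

lemma jw_sign_square: "jw_sign j S * jw_sign j S = 1"
  by (simp add: jw_sign_def flip: power_mult_distrib)

lemma jw_sign_toggle:
  "jw_sign j (toggle i S) = (if to_nat i < to_nat j then - jw_sign j S else jw_sign j S)"
proof (cases "to_nat i < to_nat j")
  case True
  let ?A = "\<lambda>S. {k \<in> S. to_nat k < to_nat j}"
  have "(-1 :: complex) ^ card (?A (insert i S')) = - ((-1) ^ card (?A S'))" if "i \<notin> S'" for S'
  proof -
    have "?A (insert i S') = insert i (?A S')" using True by auto
    then show ?thesis using that by simp
  qed
  note * = this
  show ?thesis
  proof (cases "i \<in> S")
    case True
    with *[of "S - {i}"] \<open>to_nat i < to_nat j\<close> show ?thesis
      by (simp only: jw_sign_def toggle_def insert_Diff if_True) simp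
  next
    case False
    with *[of S] \<open>to_nat i < to_nat j\<close> show ?thesis by (simp add: jw_sign_def toggle_def)
  qed
next
  case False
  then have "{k \<in> toggle i S. to_nat k < to_nat j} = {k \<in> S. to_nat k < to_nat j}"
    by (auto simp: toggle_def)
  then show ?thesis using False by (simp add: jw_sign_def)
qed

lemma cliff_index_cliff_index:
  "cliff_index i (cliff_index i q) = q"
  "cliff_index i (cliff_index j q) = cliff_index j (cliff_index i q)"
  by (auto simp: cliff_index_def toggle_toggle toggle_commute split: prod.splits)

lemma cliff_sign_square: "cliff_sign i q * cliff_sign i (cliff_index i q) = 1"
  by (auto simp: cliff_sign_def cliff_index_def jw_sign_toggle jw_sign_square split: prod.splits)

text \<open>Toggling one of two distinct positions affects the sign at the other only if it is the
  smaller one, so exactly one of the two orders produces an additional sign.\<close>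

lemma cliff_sign_anticommute:
  assumes "i \<noteq> j"
  shows "cliff_sign i q * cliff_sign j (cliff_index i q) = - (cliff_sign j q * cliff_sign i (cliff_index j q))"
proof -
  obtain \<rho> d S where q: "q = (\<rho>, d, S)" by (cases q) auto
  have "bij_app \<rho> i \<noteq> bij_app \<rho> j"
    using assms bij_app[of \<rho>] by (auto simp: bij_def inj_def)
  then have "to_nat (bij_app \<rho> i) < to_nat (bij_app \<rho> j) \<longleftrightarrow> \<not> to_nat (bij_app \<rho> j) < to_nat (bij_app \<rho> i)"
    by (metis linorder_neqE_nat not_less_iff_gr_or_eq to_nat_split)
  then show ?thesis by (auto simp: q cliff_sign_def cliff_index_def jw_sign_toggle)
qed

lemma index_act_mult:
  assumes "w \<in> weyl_group Type_B" "w' \<in> weyl_group Type_B"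
  shows "index_act w' (index_act w q) = index_act (w ** w') q"
proof -
  obtain \<pi> \<epsilon> where w: "w = signed_perm \<pi> \<epsilon>" "bij \<pi>" "range \<epsilon> \<subseteq> {1, -1}"
    using assms(1) by (rule weyl_group_cases) blast
  obtain \<rho> \<delta> where w': "w' = signed_perm \<rho> \<delta>" "bij \<rho>" "range \<delta> \<subseteq> {1, -1}"
    using assms(2) by (rule weyl_group_cases) blast
  have s: "\<epsilon> i = 1 \<or> \<epsilon> i = -1" "\<delta> i = 1 \<or> \<delta> i = -1" for i using w(3) w'(3) by blast+
  have r: "range (\<lambda>i. \<delta> i * \<epsilon> (\<rho> i)) \<subseteq> {1, -1}"
  proof (rule image_subsetI)
    fix i show "\<delta> i * \<epsilon> (\<rho> i) \<in> {1, -1}" using s(1)[of "\<rho> i"] s(2)[of i] by auto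
  qed
  obtain \<sigma> d S where q: "q = (\<sigma>, d, S)" by (cases q) auto
  have b: "bij_app \<sigma> \<circ> \<pi> \<in> {f. bij f}" using bij_app[of \<sigma>] w(2) by (simp add: bij_comp)
  have d: "((d (\<pi> (\<rho> i)) \<noteq> (\<epsilon> (\<rho> i) = -1)) \<noteq> (\<delta> i = -1)) = (d (\<pi> (\<rho> i)) \<noteq> (\<delta> i * \<epsilon> (\<rho> i) = -1))" for i
    using s(1)[of "\<rho> i"] s(2)[of i] by auto
  show ?thesis
    unfolding q w(1) w'(1) signed_perm_mult
    by (simp only: index_act_def prod.case perm_of_signed_perm[OF w(3)] perm_of_signed_perm[OF w'(3)]
      perm_of_signed_perm[OF r] neg_of_signed_perm[OF w(3)] neg_of_signed_perm[OF w'(3)] neg_of_signed_perm[OF r]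
      Bijection_inverse[OF b] comp_assoc o_apply d)
qed

lemma index_act_mat_1: "index_act (mat 1) q = q"
proof -
  have r: "range (\<lambda>_::'n. 1 :: complex) \<subseteq> {1, -1}" by auto
  show ?thesis
    unfolding mat_1_eq_signed_perm
    by (cases q) (simp add: index_act_def perm_of_signed_perm[OF r] neg_of_signed_perm[OF r] bij_app_inverse)
qed

lemma
  assumes "bij \<pi>" "range \<epsilon> \<subseteq> {1, -1}"
  shows cliff_sign_index_act: "mconst (cliff_sign i (index_act (signed_perm \<pi> \<epsilon>) q))
      = mconst (\<epsilon> i) * mconst (cliff_sign (\<pi> i) q)"
    and cliff_index_index_act: "cliff_index i (index_act (signed_perm \<pi> \<epsilon>) q)
      = index_act (signed_perm \<pi> \<epsilon>) (cliff_index (\<pi> i) q)"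
proof -
  obtain \<sigma> d S where q: "q = (\<sigma>, d, S)" by (cases q) auto
  have b: "bij_app \<sigma> \<circ> \<pi> \<in> {f. bij f}" using bij_app[of \<sigma>] assms(1) by (simp add: bij_comp)
  have "\<epsilon> i = 1 \<or> \<epsilon> i = -1" using assms(2) by blast
  then show "mconst (cliff_sign i (index_act (signed_perm \<pi> \<epsilon>) q)) = mconst (\<epsilon> i) * mconst (cliff_sign (\<pi> i) q)"
    by (auto simp: q cliff_sign_def index_act_def perm_of_signed_perm[OF assms(2)] neg_of_signed_perm[OF assms(2)]
      Bijection_inverse[OF b] simp flip: mconst_mult)
  show "cliff_index i (index_act (signed_perm \<pi> \<epsilon>) q) = index_act (signed_perm \<pi> \<epsilon>) (cliff_index (\<pi> i) q)"
    by (simp add: q cliff_index_def index_act_def perm_of_signed_perm[OF assms(2)] neg_of_signed_perm[OF assms(2)]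
      Bijection_inverse[OF b])
qed

text \<open>The effect of c_i on polynomials that it is moved past: it negates x_i and leaves every
  y_j alone.\<close>

definition flip :: "bool \<Rightarrow> 'n::finite \<Rightarrow> complex^'n^'n" where
  "flip \<eta> i = (if \<eta> then reflection (-1) i i else mat 1)"

lemma flip_flip: "flip \<eta> i ** flip \<eta> i = mat 1"
proof -
  have "reflection (-1) i i ** reflection (-1) i i = mat 1"
    unfolding reflection_def signed_perm_mult mat_1_eq_signed_perm
    by (intro arg_cong2[of _ _ _ _ signed_perm]) auto
  then show ?thesis by (simp add: flip_def)
qed

lemma flip_commute: "flip \<eta> i ** flip \<eta> j = flip \<eta> j ** flip \<eta> i"
proof -
  have "reflection (-1) i i ** reflection (-1) j j = reflection (-1) j j ** reflection (-1) i i"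
    unfolding reflection_def signed_perm_mult
    by (intro arg_cong2[of _ _ _ _ signed_perm]) auto
  then show ?thesis by (simp add: flip_def)
qed

lemma signed_perm_flip:
  assumes "bij \<pi>" "range \<epsilon> \<subseteq> {1, -1}"
  shows "signed_perm \<pi> \<epsilon> ** flip \<eta> i = flip \<eta> (\<pi> i) ** signed_perm \<pi> \<epsilon>"
proof -
  have "\<epsilon> i * \<epsilon> i = 1" by (rule sign_square[OF assms(2)])
  then show ?thesis
    using signed_perm_mult_reflection[OF assms, of "-1" i i] by (simp add: flip_def)
qed

lemma flip_flip_reflection:
  assumes "k \<noteq> i"
  shows "flip \<eta> k ** flip \<eta> i ** reflection \<delta> k i = reflection (if \<eta> then - \<delta> else \<delta>) k i"
proof -
  have "reflection (-1) k k ** reflection (-1) i i ** reflection \<delta> k i = reflection (- \<delta>) k i"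
    unfolding reflection_def signed_perm_mult
    by (intro arg_cong2[of _ _ _ _ signed_perm] ext) (use assms in \<open>auto simp: Transposition.transpose_def\<close>)
  then show ?thesis by (simp add: flip_def)
qed

lemma mact_flip_var: "mact (flip \<eta> i) (mvar k) = (if \<eta> \<and> k = i then - mvar k else mvar k)"
  by (simp add: flip_def mact_refl_var mconst_minus)

text \<open>A Dunkl-type operator, found by applying the commutator formula for [d_i, f] to a
  constant vector killed by d_i. The reflections act trivially on the polynomial part of that
  vector, so only their action on the coefficients remains next to the divided difference.\<close>

definition op_mom :: "bool \<Rightarrow> weyl_type \<Rightarrow> complex \<Rightarrow> complex \<Rightarrow> 'n::finite \<Rightarrow> 'n rep_op" where
  "op_mom \<eta> T u v i = (\<Sum>t\<in>terms T i. op_scal (term_coeff \<eta> u v i t)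
    * (op_dd (term_sign \<eta> t) (fst t) i
    * ((if fst (snd t) then op_cliff (fst t) * op_cliff i else 1) * op_perm (reflection (snd (snd t)) (fst t) i))))"

text \<open>\<open>op_cliff\<close> commutes with all variables; the additional \<open>flip\<close>
  makes c_i anticommute with x_i. The Clifford relations survive because sign changes commute and
  square to 1.\<close>

fun gen_op :: "bool \<Rightarrow> weyl_type \<Rightarrow> complex \<Rightarrow> complex \<Rightarrow> ('n::finite, complex^'n^'n) rdahc_gen \<Rightarrow> 'n rep_op" where
  "gen_op \<eta> T u v (Xgen i) = (if \<eta> then op_var i else op_mom \<eta> T u v i)"
| "gen_op \<eta> T u v (Ygen i) = (if \<eta> then op_mom \<eta> T u v i else op_var i)"
| "gen_op \<eta> T u v (Cgen i) = op_act (flip \<eta> i) * op_cliff i"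
| "gen_op \<eta> T u v (Wgen w) = op_act w * op_perm w"

interpretation op: central_scalars "op_scal :: complex \<Rightarrow> 'n::finite rep_op"
proof
  have op_scal: "app (op_scal a) F = smult_space a F" for a and F :: "'n rep_space"
    by (simp add: vec_eq_iff app_op_simps smult_space_simps)
  show "x * op_scal a = op_scal a * x" for x :: "'n rep_op" and a
    by (intro rep_op_eqI) (simp add: app_ring_simps op_scal app_smult)
qed (auto intro!: rep_op_eqI simp: app_ring_simps app_op_simps mconst_add mconst_mult algebra_simps)

section \<open>Commutation rules between the elementary operators\<close>

lemma op_act_mult: "op_act w * op_act w' = op_act (w ** w')"
  by (rule rep_op_eqI) (simp add: app_ring_simps app_op_simps mact_mact)

lemma op_act_perm: "op_perm w * op_act w' = op_act w' * op_perm w"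
  by (rule rep_op_eqI) (simp add: app_ring_simps app_op_simps)

lemma op_act_cliff: "op_cliff i * op_act w = op_act w * op_cliff i"
  by (rule rep_op_eqI) (simp add: app_ring_simps app_op_simps mact_mult)

lemma op_var_perm: "op_perm w * op_var l = op_var l * op_perm w"
  by (rule rep_op_eqI) (simp add: app_ring_simps app_op_simps)

lemma op_var_cliff: "op_cliff i * op_var l = op_var l * op_cliff i"
  by (rule rep_op_eqI) (simp add: app_ring_simps app_op_simps mult.left_commute)

lemma op_dd_var:
  assumes "root_data \<delta> k i"
  shows "op_dd \<delta> k i * op_var l = op_var l * op_dd \<delta> k i + op_scal (root_coeff \<delta> k i l) * op_act (reflection \<delta> k i)"
  by (rule rep_op_eqI) (simp add: app_ring_simps app_op_simps app_op_dd[OF assms] root_data.dd_var_mult[OF assms])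

lemma op_cliff_square: "op_cliff i * op_cliff i = 1"
  by (rule rep_op_eqI)
    (simp add: app_ring_simps app_op_simps cliff_index_cliff_index(1) cliff_sign_square flip: mult.assoc mconst_mult)

lemma op_cliff_anticommute:
  assumes "i \<noteq> j"
  shows "op_cliff i * op_cliff j = - (op_cliff j * op_cliff i)"
proof (rule rep_op_eqI)
  fix F q
  have "app (op_cliff i * op_cliff j) F $ q
      = mconst (cliff_sign i q * cliff_sign j (cliff_index i q)) * F $ cliff_index i (cliff_index j q)"
    by (simp add: app_ring_simps app_op_simps mconst_mult mult.assoc cliff_index_cliff_index(2)[of j i])
  also have "\<dots> = app (- (op_cliff j * op_cliff i)) F $ q"
    unfolding cliff_sign_anticommute[OF assms]
    by (simp add: app_ring_simps app_op_simps mconst_mult mconst_minus mult.assoc)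
  finally show "app (op_cliff i * op_cliff j) F $ q = app (- (op_cliff j * op_cliff i)) F $ q" .
qed

lemma op_perm_mult:
  "w \<in> weyl_group Type_B \<Longrightarrow> w' \<in> weyl_group Type_B \<Longrightarrow> op_perm w * op_perm w' = op_perm (w ** w')"
  by (rule rep_op_eqI) (simp add: app_ring_simps app_op_simps index_act_mult del: weyl_group.simps)

lemma op_perm_cliff:
  assumes "bij \<pi>" "range \<epsilon> \<subseteq> {1, -1}"
  shows "op_perm (signed_perm \<pi> \<epsilon>) * op_cliff i = op_scal (\<epsilon> i) * (op_cliff (\<pi> i) * op_perm (signed_perm \<pi> \<epsilon>))"
  by (rule rep_op_eqI)
    (simp add: app_ring_simps app_op_simps cliff_sign_index_act[OF assms] cliff_index_index_act[OF assms] mult.assoc)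

section \<open>Operators that annihilate constant vectors\<close>

definition const_space :: "'n::finite rep_space set" where
  "const_space = {F. \<exists>m. \<forall>q. F $ q = mconst (m q)}"

definition kill_const :: "'n::finite rep_op set" where
  "kill_const = {A. \<forall>F\<in>const_space. app A F = 0}"

lemma const_spaceI: "(\<And>q. F $ q = mconst (m q)) \<Longrightarrow> F \<in> const_space"
  by (auto simp: const_space_def)

lemma app_in_const_space:
  assumes "F \<in> const_space"
  shows "app (op_act w) F \<in> const_space" "app (op_perm w) F \<in> const_space" "app (op_cliff i) F \<in> const_space"
proof -
  obtain m where m: "F $ q = mconst (m q)" for q using assms by (auto simp: const_space_def)
  show "app (op_act w) F \<in> const_space"
    by (rule const_spaceI[of _ m]) (simp add: app_op_simps m)
  show "app (op_perm w) F \<in> const_space"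
    by (rule const_spaceI[of _ "\<lambda>q. m (index_act w q)"]) (simp add: app_op_simps m)
  show "app (op_cliff i) F \<in> const_space"
    by (rule const_spaceI[of _ "\<lambda>q. cliff_sign i q * m (cliff_index i q)"]) (simp add: app_op_simps m mconst_mult)
qed

lemma kill_const_add: "A \<in> kill_const \<Longrightarrow> B \<in> kill_const \<Longrightarrow> A + B \<in> kill_const"
  and kill_const_mult: "A \<in> kill_const \<Longrightarrow> B * A \<in> kill_const"
  and kill_const_act: "A \<in> kill_const \<Longrightarrow> A * op_act w \<in> kill_const"
  and kill_const_perm: "A \<in> kill_const \<Longrightarrow> A * op_perm w \<in> kill_const"
  and kill_const_cliff: "A \<in> kill_const \<Longrightarrow> A * op_cliff i \<in> kill_const"
  by (auto simp: kill_const_def app_ring_simps app_in_const_space)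

lemma kill_const_sum: "(\<And>t. t \<in> I \<Longrightarrow> f t \<in> kill_const) \<Longrightarrow> sum f I \<in> kill_const"
proof (induction I rule: infinite_finite_induct)
  case (insert x I)
  then show ?case by (auto intro: kill_const_add)
qed (simp_all add: kill_const_def app_ring_simps)

lemma kill_const_dd: "root_data \<delta> k i \<Longrightarrow> op_dd \<delta> k i \<in> kill_const"
  by (auto simp: kill_const_def const_space_def vec_eq_iff app_op_dd root_data.dd_const)

lemma kill_const_mom: "op_mom \<eta> T u v i \<in> kill_const"
  unfolding op_mom_def
proof (rule kill_const_sum, rule kill_const_mult)
  fix t assume "t \<in> terms T i"
  then have "op_dd (term_sign \<eta> t) (fst t) i \<in> kill_const"
    by (intro kill_const_dd terms_root_data)
  then show "op_dd (term_sign \<eta> t) (fst t) i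
    * ((if fst (snd t) then op_cliff (fst t) * op_cliff i else 1) * op_perm (reflection (snd (snd t)) (fst t) i)) \<in> kill_const"
    by (auto simp flip: mult.assoc intro!: kill_const_perm kill_const_cliff)
qed

text \<open>Constants generate the space under multiplication by variables, and A passes each
  variable up to a scalar and a change of index. Induction on the polynomial in a single component
  therefore propagates the vanishing.\<close>

lemma kill_const_eq_0:
  assumes "A \<in> kill_const" and comm: "\<And>k. \<exists>a l. A * op_var k = op_scal a * (op_var l * A)"
  shows "A = 0"
proof (rule rep_op_eqI)
  fix F :: "'a rep_space" and q
  define single where "single q f = (\<chi> q'. if q' = q then f else 0)" for q :: "'a rep_index" and f :: "'a mpoly"
  have "app A (single q f) = 0" for q f
  proof (induction f rule: mpoly_induct)
    case (const a)
    have "single q (mconst a) \<in> const_space"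
      by (rule const_spaceI[of _ "\<lambda>q'. if q' = q then a else 0"]) (simp add: single_def)
    then show ?case using assms(1) by (simp add: kill_const_def)
  next
    case (add f g)
    have "single q (f + g) = single q f + single q g" by (auto simp: single_def vec_eq_iff)
    then show ?case using add by (simp add: app_add)
  next
    case (var k f)
    have "single q (mvar k * f) = app (op_var k) (single q f)"
      by (auto simp: single_def vec_eq_iff app_op_simps)
    moreover obtain a l where "A * op_var k = op_scal a * (op_var l * A)" using comm by blast
    ultimately have "app A (single q (mvar k * f)) = app (op_scal a * (op_var l * A)) (single q f)"
      by (simp flip: app_ring_simps)
    then show ?case using var by (simp add: app_ring_simps)
  qed
  note single = this
  have "F = (\<Sum>q\<in>UNIV. single q (F $ q))"
    by (simp add: single_def vec_eq_iff)
  then have "app A F = app A (\<Sum>q\<in>UNIV. single q (F $ q))" by (rule arg_cong)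
  also have "\<dots> = 0" unfolding app_sum by (simp add: single)
  finally have "app A F = 0" .
  then show "app A F $ q = app 0 F $ q" by (simp add: app_ring_simps)
qed

interpretation rep: operators op_scal "gen_op \<eta> T u v" for \<eta> T u v ..

text \<open>The sign changes contributed by c_k and c_i merge with the reflection into one
  reflection of polynomials; everything else acts on the coefficients.\<close>

lemma rep_term_elt:
  assumes "t \<in> terms T i"
  shows "rep.rep \<eta> T u v (term_elt i t) = op_act (reflection (term_sign \<eta> t) (fst t) i)
    * ((if fst (snd t) then op_cliff (fst t) * op_cliff i else 1) * op_perm (reflection (snd (snd t)) (fst t) i))"
proof -
  obtain k b \<delta> where t: "t = (k, b, \<delta>)" by (cases t) auto
  show ?thesis
  proof (cases b)
    case False
    then show ?thesis by (simp add: t term_elt_def term_sign_def rep.rep_mult)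
  next
    case True
    then have "k \<noteq> i" using assms by (auto simp: t terms_def split: if_splits)
    have "op_act (flip \<eta> k) * op_cliff k * (op_act (flip \<eta> i) * op_cliff i) * (op_act (reflection \<delta> k i) * op_perm (reflection \<delta> k i))
      = op_act (flip \<eta> k) * (op_act (flip \<eta> i) * (op_act (reflection \<delta> k i) * (op_cliff k * (op_cliff i * op_perm (reflection \<delta> k i)))))"
      by (simp only: mult.assoc mult_eq_assoc[OF op_act_cliff])
    also have "\<dots> = op_act (flip \<eta> k ** flip \<eta> i ** reflection \<delta> k i) * (op_cliff k * (op_cliff i * op_perm (reflection \<delta> k i)))"
      by (simp only: op_act_mult[symmetric] mult.assoc)
    finally show ?thesis
      using True by (simp add: t term_elt_def term_sign_def rep.rep_mult flip_flip_reflection[OF \<open>k \<noteq> i\<close>] mult.assoc)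
  qed
qed

text \<open>The Leibniz rule is applied in each summand: its coefficient part commutes with the
  variable, and the reflection left over by the rule completes this part to the action of
  \<open>term_elt\<close>.\<close>

lemma op_mom_var:
  "op_mom \<eta> T u v i * op_var l = op_var l * op_mom \<eta> T u v i + rep.rep \<eta> T u v (term_sum \<eta> T u v i l)"
proof -
  define M where "M t = (if fst (snd t) then op_cliff (fst t) * op_cliff i else 1)
    * op_perm (reflection (snd (snd t)) (fst t) i)" for t
  let ?c = "\<lambda>t. op_scal (term_coeff \<eta> u v i t)" and ?d = "\<lambda>t. op_dd (term_sign \<eta> t) (fst t) i"
  have m: "M t * op_var l = op_var l * M t" for t
    by (simp add: M_def mult.assoc op_var_perm op_var_cliff mult_eq_assoc[OF op_var_cliff])
  have "?c t * (?d t * M t) * op_var l = op_var l * (?c t * (?d t * M t))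
      + op_scal (term_coeff \<eta> u v i t * root_coeff (term_sign \<eta> t) (fst t) i l) * rep.rep \<eta> T u v (term_elt i t)"
    if "t \<in> terms T i" for t
  proof -
    have "?c t * (?d t * M t) * op_var l = ?c t * ((?d t * op_var l) * M t)"
      by (simp only: mult.assoc m)
    also have "\<dots> = ?c t * (op_var l * (?d t * M t))
      + ?c t * (op_scal (root_coeff (term_sign \<eta> t) (fst t) i l) * (op_act (reflection (term_sign \<eta> t) (fst t) i) * M t))"
      by (simp only: op_dd_var[OF terms_root_data[OF that]] distrib_left distrib_right mult.assoc)
    finally show ?thesis
      by (simp only: rep_term_elt[OF that] M_def[symmetric] op.sc_mult mult.assoc op.sc_left_commute[of "op_var l"])
  qed
  then show ?thesis
    unfolding op_mom_def term_sum_def rep.rep_simps rep.rep_scal M_def[symmetric]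
    by (simp only: sum_distrib_left sum_distrib_right sum.distrib[symmetric]) (intro sum.cong HOL.refl)
qed

theorem hecke_operators_gen_op: "hecke_operators op_scal (gen_op \<eta> T u v) \<eta> T u v kill_const"
proof (unfold_locales, goal_cases)
  case (1 i j)
  show ?case by (rule rep_op_eqI) (simp add: app_ring_simps app_op_simps mult.left_commute)
next
  case (2 w w')
  then have "op_act w * op_perm w * (op_act w' * op_perm w') = op_act (w ** w') * op_perm (w ** w')"
    by (simp only: mult.assoc mult_eq_assoc[OF op_act_perm] op_perm_mult[symmetric] op_act_mult[symmetric])
  then show ?case by simp
next
  case 3
  show ?case by (rule rep_op_eqI) (simp add: app_ring_simps app_op_simps index_act_mat_1)
next
  case (4 i)
  have "op_act (flip \<eta> i) * op_cliff i * (op_act (flip \<eta> i) * op_cliff i)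
    = (op_act (flip \<eta> i) * op_act (flip \<eta> i)) * (op_cliff i * op_cliff i)"
    by (simp only: mult.assoc mult_eq_assoc[OF op_act_cliff])
  also have "\<dots> = 1"
    unfolding op_act_mult flip_flip op_cliff_square by (rule rep_op_eqI) (simp add: app_ring_simps app_op_simps)
  finally show ?case by simp
next
  case (5 i j)
  have *: "op_act (flip \<eta> i) * op_cliff i * (op_act (flip \<eta> j) * op_cliff j)
    = op_act (flip \<eta> i ** flip \<eta> j) * (op_cliff i * op_cliff j)" for i j
    by (simp only: mult.assoc mult_eq_assoc[OF op_act_cliff] op_act_mult[symmetric])
  show ?case
    using op_cliff_anticommute[OF 5] by (simp add: * flip_commute[of \<eta> i j])
next
  case (6 l k)
  show ?case by (rule rep_op_eqI) (auto simp: app_ring_simps app_op_simps mact_mult mact_flip_var mult_ac)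
next
  case (7 \<pi> \<epsilon> i)
  show ?case
    by (rule rep_op_eqI) (auto simp: app_ring_simps app_op_simps mact_mult mact_signed_perm_var mult_ac)
next
  case (8 \<pi> \<epsilon> i)
  let ?w = "signed_perm \<pi> \<epsilon>"
  have "op_act ?w * op_perm ?w * (op_act (flip \<eta> i) * op_cliff i)
    = op_act (?w ** flip \<eta> i) * (op_perm ?w * op_cliff i)"
    by (simp only: mult.assoc mult_eq_assoc[OF op_act_perm] op_act_mult[symmetric])
  also have "\<dots> = op_scal (\<epsilon> i) * (op_act (flip \<eta> (\<pi> i)) * (op_act ?w * (op_cliff (\<pi> i) * op_perm ?w)))"
    unfolding signed_perm_flip[OF 8] op_perm_cliff[OF 8]
    by (simp only: op.sc_left_commute[of "op_act _"] op_act_mult[symmetric] mult.assoc)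
  also have "\<dots> = op_scal (\<epsilon> i) * (op_act (flip \<eta> (\<pi> i)) * op_cliff (\<pi> i) * (op_act ?w * op_perm ?w))"
    by (simp only: mult.assoc mult_eq_assoc[OF op_act_cliff])
  finally show ?case by simp
next
  case (9 i l)
  show ?case using op_mom_var[of \<eta> T u v i l] by (cases \<eta>) simp_all
next
  case (10 A B)
  then show ?case by (rule kill_const_add)
next
  case (11 A B)
  then show ?case by (rule kill_const_mult)
next
  case (12 A i)
  then show ?case by (auto simp flip: mult.assoc intro: kill_const_act kill_const_cliff)
next
  case (13 A w)
  then show ?case by (auto simp flip: mult.assoc intro: kill_const_act kill_const_perm)
next
  case (14 i)
  show ?case by (simp add: kill_const_mom)
next
  case (15 A)
  have "\<exists>a l. A * op_var k = op_scal a * (op_var l * A)" for k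
    using 15(2)[of k] by (cases \<eta>) simp_all
  with 15(1) show ?case by (rule kill_const_eq_0)
qed

section \<open>The defining ideal\<close>

text \<open>An ideal of the whole type, in contrast to \<open>rdahc_ideal\<close>, which lives in
  the carrier; congruences modulo it carry no membership conditions.\<close>

definition rel_ideal :: "weyl_type \<Rightarrow> complex \<Rightarrow> complex \<Rightarrow> 'n::finite rdahc_free set" where
  "rel_ideal T u v = \<Inter>{J. ring_congruence J \<and> rdahc_rels T u v \<subseteq> J}"

lemma ring_congruence_rel_ideal: "ring_congruence (rel_ideal T u v)"
  unfolding rel_ideal_def
  by unfold_locales (auto intro: ring_congruence.zero_mem ring_congruence.add_mem
    ring_congruence.mult_left_mem ring_congruence.mult_right_mem)

lemma rel_ideal_minimal: "ring_congruence J \<Longrightarrow> rdahc_rels T u v \<subseteq> J \<Longrightarrow> rel_ideal T u v \<subseteq> J"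
  by (auto simp: rel_ideal_def)

lemma rels_in_rel_ideal: "rdahc_rels T u v \<subseteq> rel_ideal T u v"
  by (auto simp: rel_ideal_def)

lemma prod_list_gen: "prod_list (map gen l) = Poly_Mapping.single (Word l) 1"
proof (induction l)
  case Nil
  then show ?case by (simp flip: single_one add: zero_word_def)
next
  case (Cons g l)
  then show ?case by (simp add: gen_def mult_single plus_word_def)
qed

lemma single_eq_prod_list_gen: "Poly_Mapping.single w a = scal a * prod_list (map gen (letters w))"
  by (simp add: prod_list_gen scal_def mult_single)

lemma free_algebra_induct [consumes 1, case_names zero add word]:
  assumes "f \<in> carrier (free_algebra G)"
    and "P 0" and "\<And>f g. P f \<Longrightarrow> P g \<Longrightarrow> P (f + g)"
    and "\<And>a l. set l \<subseteq> G \<Longrightarrow> P (scal a * prod_list (map gen l))"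
  shows "P f"
proof -
  have "P (\<Sum>w\<in>A. Poly_Mapping.single w (Poly_Mapping.lookup f w))" if "A \<subseteq> Poly_Mapping.keys f" for A
    using that
  proof (induction A rule: infinite_finite_induct)
    case (insert w A)
    then have "set (letters w) \<subseteq> G" using assms(1) by (auto simp: free_algebra_carrier_iff)
    then show ?case
      using insert by (simp add: assms(3) assms(4) single_eq_prod_list_gen)
  qed (simp_all add: assms(2))
  from this[of "Poly_Mapping.keys f"] show ?thesis by (simp flip: poly_mapping_sum_singles)
qed

lemma prod_list_closed:
  "(\<And>f. f \<in> set l \<Longrightarrow> f \<in> carrier (free_algebra G)) \<Longrightarrow> prod_list l \<in> carrier (free_algebra G)"
  by (induction l) (auto intro: free_algebra_closed)

lemma power_closed: "f \<in> carrier (free_algebra G) \<Longrightarrow> f ^ k \<in> carrier (free_algebra G)"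
  by (induction k) (auto intro: free_algebra_closed)

lemma free_algebra_mono: "G \<subseteq> H \<Longrightarrow> carrier (free_algebra G) \<subseteq> carrier (free_algebra H)"
  by (rule subsetI) (simp add: free_algebra_carrier_iff, blast)

lemma a_inv_free_algebra:
  assumes "f \<in> carrier (free_algebra G)"
  shows "\<ominus>\<^bsub>free_algebra G\<^esub> f = - f"
proof -
  interpret ring "free_algebra G" by (rule ring_free_algebra)
  show ?thesis
    by (rule minus_equality) (use assms in \<open>auto intro: free_algebra_closed\<close>)
qed

text \<open>Killing the generators that do not belong to \<open>rdahc_gens T\<close> retracts the full free algebra onto
  \<open>rdahc_free_algebra T\<close>; this compares the ideals generated in the two rings.\<close>

definition restrict_gen :: "weyl_type \<Rightarrow> ('n::finite, complex^'n^'n) rdahc_gen \<Rightarrow> 'n rdahc_free" where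
  "restrict_gen T g = (if g \<in> rdahc_gens T then gen g else 0)"

interpretation proj: operators scal "restrict_gen T" for T ..

lemma proj_closed: "proj.rep T f \<in> carrier (rdahc_free_algebra T)"
  unfolding proj.rep_def free.lin_ext_def
  by (intro free_algebra_sum_closed free_algebra_closed(6) free_algebra_closed(3) prod_list_closed)
    (auto simp: restrict_gen_def intro: free_algebra_closed)

lemma proj_id: "f \<in> carrier (rdahc_free_algebra T) \<Longrightarrow> proj.rep T f = f"
proof (induction rule: free_algebra_induct)
  case (word a l)
  then have 1: "map (restrict_gen T) l = map gen l" by (auto simp: restrict_gen_def)
  have 2: "proj.rep T (prod_list (map gen l)) = prod_list (map (restrict_gen T) l)"
    by (induction l) (simp_all add: proj.rep_mult)
  show ?case by (simp only: proj.rep_mult proj.rep_scal 2) (simp only: 1)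
qed (simp_all add: proj.rep_add)

lemma ideal_rdahc_ideal: "ideal (rdahc_ideal T u v) (rdahc_free_algebra T)"
  unfolding rdahc_ideal_def by (intro ring.genideal_ideal ring_free_algebra rdahc_rels_closed)

text \<open>Each ideal is minimal in its own ring. \<open>rel_ideal\<close> is compared with the
  preimage of \<open>rdahc_ideal\<close> under the retraction, and \<open>rdahc_ideal\<close> with
  the intersection of \<open>rel_ideal\<close> and the carrier.\<close>

lemma rel_ideal_iff:
  assumes "f \<in> carrier (rdahc_free_algebra T)"
  shows "f \<in> rdahc_ideal T u v \<longleftrightarrow> f \<in> rel_ideal T u v"
proof
  let ?R = "rdahc_free_algebra T" and ?I = "rdahc_ideal T u v"
  interpret R: ring ?R by (rule ring_free_algebra)
  interpret I: ideal ?I ?R by (rule ideal_rdahc_ideal)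
  interpret J: ring_congruence "rel_ideal T u v" by (rule ring_congruence_rel_ideal)
  have "ring_congruence {f. proj.rep T f \<in> ?I}"
  proof
    show "0 \<in> {f. proj.rep T f \<in> ?I}" using I.zero_closed by simp
    show "a + b \<in> {f. proj.rep T f \<in> ?I}" if "a \<in> {f. proj.rep T f \<in> ?I}" "b \<in> {f. proj.rep T f \<in> ?I}" for a b
      using that I.a_closed[of "proj.rep T a" "proj.rep T b"] by (simp add: proj.rep_add)
    show "x * a \<in> {f. proj.rep T f \<in> ?I}" if "a \<in> {f. proj.rep T f \<in> ?I}" for a x
      using that I.I_l_closed[OF _ proj_closed[of T x], of "proj.rep T a"] by (simp add: proj.rep_mult)
    show "a * x \<in> {f. proj.rep T f \<in> ?I}" if "a \<in> {f. proj.rep T f \<in> ?I}" for a x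
      using that I.I_r_closed[OF _ proj_closed[of T x], of "proj.rep T a"] by (simp add: proj.rep_mult)
  qed
  moreover have "rdahc_rels T u v \<subseteq> {f. proj.rep T f \<in> ?I}"
  proof
    fix r assume r: "r \<in> rdahc_rels T u v"
    then have "r \<in> carrier ?R" using rdahc_rels_closed by blast
    moreover have "r \<in> ?I" using R.genideal_self[OF rdahc_rels_closed] r unfolding rdahc_ideal_def by blast
    ultimately show "r \<in> {f. proj.rep T f \<in> ?I}" by (simp add: proj_id)
  qed
  ultimately have "rel_ideal T u v \<subseteq> {f. proj.rep T f \<in> ?I}" by (rule rel_ideal_minimal)
  then show "f \<in> ?I" if "f \<in> rel_ideal T u v"
    using that proj_id[OF assms] by auto
  have "ideal (rel_ideal T u v \<inter> carrier ?R) ?R"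
  proof (rule idealI)
    show "subgroup (rel_ideal T u v \<inter> carrier ?R) (add_monoid ?R)"
      by (rule R.add.subgroupI)
        (auto simp: a_inv_free_algebra intro: J.zero_mem J.add_mem J.uminus_mem free_algebra_closed)
  qed (auto intro: R.ring_axioms J.mult_left_mem J.mult_right_mem free_algebra_closed)
  then have "?I \<subseteq> rel_ideal T u v \<inter> carrier ?R"
    unfolding rdahc_ideal_def
    using rels_in_rel_ideal[of T u v] rdahc_rels_closed[of T u v] by (intro R.genideal_minimal) auto
  then show "f \<in> rel_ideal T u v" if "f \<in> ?I" using that by auto
qed

lemma rdahc_class_eq_iff:
  assumes "f \<in> carrier (rdahc_free_algebra T)" "g \<in> carrier (rdahc_free_algebra T)"
  shows "rdahc_class T u v f = rdahc_class T u v g \<longleftrightarrow> ring_congruence.eqv (rel_ideal T u v) f g"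
proof -
  interpret R: ring "rdahc_free_algebra T" by (rule ring_free_algebra)
  have "rdahc_class T u v f = rdahc_class T u v g \<longleftrightarrow> f \<ominus>\<^bsub>rdahc_free_algebra T\<^esub> g \<in> rdahc_ideal T u v"
    unfolding rdahc_class_def using R.quotient_eq_iff_same_a_r_cos[OF ideal_rdahc_ideal assms, of u v] by simp
  also have "f \<ominus>\<^bsub>rdahc_free_algebra T\<^esub> g = f - g"
    by (simp add: a_minus_def a_inv_free_algebra assms)
  also have "f - g \<in> rdahc_ideal T u v \<longleftrightarrow> f - g \<in> rel_ideal T u v"
    by (intro rel_ideal_iff free_algebra_closed assms)
  finally show ?thesis by (simp add: ring_congruence.eqv_def[OF ring_congruence_rel_ideal])
qed

lemma rdahc_class_ring_hom: "rdahc_class T u v \<in> ring_hom (rdahc_free_algebra T) (rdahc_algebra T u v)"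
  using ideal.rcos_ring_hom[OF ideal_rdahc_ideal, of T u v]
  by (simp add: rdahc_class_def[abs_def] rdahc_algebra_def)

lemma carrier_rdahc_algebra: "carrier (rdahc_algebra T u v) = rdahc_class T u v ` carrier (rdahc_free_algebra T)"
  by (auto simp: rdahc_algebra_def FactRing_def A_RCOSETS_def' rdahc_class_def)

section \<open>Evaluation of polynomials in the algebra\<close>

text \<open>Variables do not commute in the free algebra, so a monomial needs a fixed, though
  arbitrary, order of its factors.\<close>

definition var_list :: "'n::finite list" where
  "var_list = (SOME xs. set xs = UNIV \<and> distinct xs)"

lemma var_list: "set (var_list :: 'n::finite list) = UNIV" "distinct (var_list :: 'n list)"
  using someI_ex[OF finite_distinct_list[OF finite[of "UNIV :: 'n set"]]]
  by (auto simp: var_list_def)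

definition monom_eval :: "('n::finite \<Rightarrow> ('n, complex^'n^'n) rdahc_gen) \<Rightarrow> ('n \<Rightarrow>\<^sub>0 nat) \<Rightarrow> 'n rdahc_free" where
  "monom_eval K m = prod_list (map (\<lambda>i. gen (K i) ^ Poly_Mapping.lookup m i) var_list)"

definition eval :: "('n::finite \<Rightarrow> ('n, complex^'n^'n) rdahc_gen) \<Rightarrow> 'n mpoly \<Rightarrow> 'n rdahc_free" where
  "eval K = free.lin_ext (monom_eval K)"

lemma eval_add: "eval K (f + g) = eval K f + eval K g"
  and eval_0 [simp]: "eval K 0 = 0"
  by (simp_all add: eval_def free.lin_ext_add)

lemma eval_const [simp]: "eval K (mconst a) = scal a"
proof -
  have "prod_list (map (\<lambda>_. 1 :: 'a rdahc_free) l) = 1" for l :: "'a list" by (induction l) auto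
  then show ?thesis by (simp add: eval_def mconst_def monom_eval_def)
qed

lemma eval_1 [simp]: "eval K 1 = 1"
  using eval_const[of K 1] by simp

lemma prod_list_single_factor:
  assumes "distinct l" "i \<in> set l"
  shows "prod_list (map (\<lambda>j. if j = i then a else 1) l) = (a :: 'a::monoid_mult)"
  using assms
proof (induction l)
  case (Cons j l)
  have "prod_list (map (\<lambda>j. if j = i then a else 1) l) = 1" if "i \<notin> set l"
    using that by (induction l) auto
  with Cons show ?case by auto
qed simp

lemma eval_var [simp]: "eval K (mvar i) = gen (K i)"
proof -
  have "(\<lambda>j. gen (K j) ^ Poly_Mapping.lookup (Poly_Mapping.single i 1) j) = (\<lambda>j. if j = i then gen (K i) else 1)"
    by (auto simp: lookup_single when_def)
  then have "monom_eval K (Poly_Mapping.single i 1) = gen (K i)"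
    unfolding monom_eval_def using prod_list_single_factor[of var_list i "gen (K i)"] by (simp add: var_list)
  then show ?thesis by (simp add: eval_def mvar_def)
qed

lemma eval_closed: "eval K f \<in> carrier (free_algebra (range K))"
  unfolding eval_def free.lin_ext_def monom_eval_def
  by (intro free_algebra_sum_closed free_algebra_closed(6) free_algebra_closed(3) prod_list_closed)
    (auto intro: power_closed free_algebra_closed)

lemma (in ring_congruence) prod_list_mult_eqv:
  assumes "\<And>i j. f i * g j \<doteq> g j * f i"
  shows "prod_list (map (\<lambda>i. f i * g i) l) \<doteq> prod_list (map f l) * prod_list (map g l)"
proof (induction l)
  case (Cons i l)
  have "prod_list (map (\<lambda>i. f i * g i) (i # l)) \<doteq> (f i * g i) * (prod_list (map f l) * prod_list (map g l))"
    using eqv_mult[OF eqv_refl Cons.IH] by simp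
  also have "\<dots> = f i * ((g i * prod_list (map f l)) * prod_list (map g l))" by (simp add: mult.assoc)
  also have "\<dots> \<doteq> f i * ((prod_list (map f l) * g i) * prod_list (map g l))"
    by (rule eqv_mult[OF eqv_refl eqv_mult[OF eqv_prod_list_commute eqv_refl]]) (auto intro: eqv_sym assms)
  finally show ?case by (simp add: mult.assoc)
qed simp

lemma (in ring_congruence) power_commute_eqv: "a * b \<doteq> b * a \<Longrightarrow> a ^ m * b ^ n \<doteq> b ^ n * a ^ m"
  by (intro eqv_power_commute eqv_sym[OF eqv_power_commute[OF eqv_sym]])

section \<open>Consequences of the defining relations\<close>

lemma rdahc_rels_memI:
  "w \<in> weyl_group T \<Longrightarrow> w' \<in> weyl_group T \<Longrightarrow> fW w * fW w' - fW (w ** w') \<in> rdahc_rels T u v"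
  "fW (mat 1) - 1 \<in> rdahc_rels T u v"
  "fC i * fC i - 1 \<in> rdahc_rels T u v"
  "i \<noteq> j \<Longrightarrow> fC i * fC j + fC j * fC i \<in> rdahc_rels T u v"
  "comm (gen (Xgen i)) (gen (Xgen j)) \<in> rdahc_rels T u v"
  "comm (gen (Ygen i)) (gen (Ygen j)) \<in> rdahc_rels T u v"
  "comm (gen (Ygen i)) (fC j) \<in> rdahc_rels T u v"
  "gen (Xgen i) * fC i + fC i * gen (Xgen i) \<in> rdahc_rels T u v"
  "i \<noteq> j \<Longrightarrow> comm (gen (Xgen i)) (fC j) \<in> rdahc_rels T u v"
  "w \<in> weyl_group T \<Longrightarrow> K \<in> {Xgen, Ygen, Cgen} \<Longrightarrow>
     fW w * lin K a * fW (matrix_inv w) - lin K (w *v a) \<in> rdahc_rels T u v"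
  "i \<noteq> j \<Longrightarrow> comm (gen (Ygen j)) (gen (Xgen i)) - comm_offdiag T u j i \<in> rdahc_rels T u v"
  "comm (gen (Ygen i)) (gen (Xgen i)) - comm_diag T u v i \<in> rdahc_rels T u v"
  subgoal by (unfold rdahc_rels_def, rule UnI1, rule UnI1, rule UnI1, rule UnI1, rule UnI1, rule UnI1, rule UnI1, rule UnI1, rule UnI1, rule UnI1, rule UnI1, rule CollectI, (rule exI)+, rule conjI, rule HOL.refl, (rule TrueI | (intro conjI)?, assumption+))
  subgoal by (unfold rdahc_rels_def, rule UnI1, rule UnI1, rule UnI1, rule UnI1, rule UnI1, rule UnI1, rule UnI1, rule UnI1, rule UnI1, rule UnI1, rule UnI2, rule singletonI)
  subgoal by (unfold rdahc_rels_def, rule UnI1, rule UnI1, rule UnI1, rule UnI1, rule UnI1, rule UnI1, rule UnI1, rule UnI1, rule UnI1, rule UnI2, rule CollectI, (rule exI)+, rule conjI, rule HOL.refl, (rule TrueI | (intro conjI)?, assumption+))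
  subgoal by (unfold rdahc_rels_def, rule UnI1, rule UnI1, rule UnI1, rule UnI1, rule UnI1, rule UnI1, rule UnI1, rule UnI1, rule UnI2, rule CollectI, (rule exI)+, rule conjI, rule HOL.refl, assumption)
  subgoal by (unfold rdahc_rels_def, rule UnI1, rule UnI1, rule UnI1, rule UnI1, rule UnI1, rule UnI1, rule UnI1, rule UnI2, rule CollectI, (rule exI)+, rule conjI, rule HOL.refl, (rule TrueI | (intro conjI)?, assumption+))
  subgoal by (unfold rdahc_rels_def, rule UnI1, rule UnI1, rule UnI1, rule UnI1, rule UnI1, rule UnI1, rule UnI2, rule CollectI, (rule exI)+, rule conjI, rule HOL.refl, (rule TrueI | (intro conjI)?, assumption+))
  subgoal by (unfold rdahc_rels_def, rule UnI1, rule UnI1, rule UnI1, rule UnI1, rule UnI1, rule UnI2, rule CollectI, (rule exI)+, rule conjI, rule HOL.refl, (rule TrueI | (intro conjI)?, assumption+))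
  subgoal by (unfold rdahc_rels_def, rule UnI1, rule UnI1, rule UnI1, rule UnI1, rule UnI2, rule CollectI, (rule exI)+, rule conjI, rule HOL.refl, (rule TrueI | (intro conjI)?, assumption+))
  subgoal by (unfold rdahc_rels_def, rule UnI1, rule UnI1, rule UnI1, rule UnI2, rule CollectI, (rule exI)+, rule conjI, rule HOL.refl, assumption)
  subgoal by (unfold rdahc_rels_def, rule UnI1, rule UnI1, rule UnI2, rule CollectI, (rule exI)+, rule conjI, rule HOL.refl, (rule TrueI | (intro conjI)?, assumption+))
  subgoal by (unfold rdahc_rels_def, rule UnI1, rule UnI2, rule CollectI, (rule exI)+, rule conjI, rule HOL.refl, assumption)
  subgoal by (unfold rdahc_rels_def, rule UnI2, rule CollectI, (rule exI)+, rule conjI, rule HOL.refl, (rule TrueI | (intro conjI)?, assumption+))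
  done

text \<open>Stated for any ideal containing the relations, because it is applied both to \<open>rel_ideal\<close> and to
  the kernel of the polynomial representation.\<close>

locale hecke_congruence = ring_congruence J for J :: "'n::finite rdahc_free set" +
  fixes T :: weyl_type and u v :: complex
  assumes rels: "rdahc_rels T u v \<subseteq> J"
begin

lemma rel_eqvI: "f - g \<in> rdahc_rels T u v \<Longrightarrow> f \<doteq> g"
  using rels by (auto simp: eqv_def)

lemma W_mult: "w \<in> weyl_group T \<Longrightarrow> w' \<in> weyl_group T \<Longrightarrow> fW w * fW w' \<doteq> fW (w ** w')"
  and W_1: "fW (mat 1) \<doteq> 1"
  and C_square: "fC i * fC i \<doteq> 1"
  and C_anticommute: "i \<noteq> j \<Longrightarrow> fC i * fC j \<doteq> - (fC j * fC i)"
  and X_commute: "gen (Xgen i) * gen (Xgen j) \<doteq> gen (Xgen j) * gen (Xgen i)"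
  and Y_commute: "gen (Ygen i) * gen (Ygen j) \<doteq> gen (Ygen j) * gen (Ygen i)"
  and Y_C: "gen (Ygen i) * fC j \<doteq> fC j * gen (Ygen i)"
  and X_C_same: "gen (Xgen i) * fC i \<doteq> - (fC i * gen (Xgen i))"
  and X_C: "i \<noteq> j \<Longrightarrow> gen (Xgen i) * fC j \<doteq> fC j * gen (Xgen i)"
  and W_lin: "w \<in> weyl_group T \<Longrightarrow> K \<in> {Xgen, Ygen, Cgen} \<Longrightarrow>
     fW w * lin K a * fW (matrix_inv w) \<doteq> lin K (w *v a)"
  by (rule rel_eqvI, simp add: rdahc_rels_memI[unfolded comm_def])+

lemma Y_X: "gen (Ygen j) * gen (Xgen i) \<doteq> gen (Xgen i) * gen (Ygen j) + yx_comm T u v j i"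
proof (rule rel_eqvI)
  have "gen (Ygen j) * gen (Xgen i) - (gen (Xgen i) * gen (Ygen j) + yx_comm T u v j i)
    = comm (gen (Ygen j)) (gen (Xgen i)) - yx_comm T u v j i"
    by (simp add: comm_def)
  also have "\<dots> \<in> rdahc_rels T u v"
    using rdahc_rels_memI(11)[of i j T u v] rdahc_rels_memI(12)[of i T u v] by (simp add: yx_comm_def)
  finally show "gen (Ygen j) * gen (Xgen i) - (gen (Xgen i) * gen (Ygen j) + yx_comm T u v j i) \<in> rdahc_rels T u v" .
qed

sublocale clifford_congruence J
  by unfold_locales (rule C_anticommute)

text \<open>The conjugation relation is used for a basis vector, which w sends to a multiple of a
  basis vector, and is then multiplied by w from the right.\<close>

lemma W_gen:
  assumes "signed_perm \<pi> \<epsilon> \<in> weyl_group T" "K \<in> {Xgen, Ygen, Cgen}"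
  shows "fW (signed_perm \<pi> \<epsilon>) * gen (K i) \<doteq> scal (\<epsilon> i) * (gen (K (\<pi> i)) * fW (signed_perm \<pi> \<epsilon>))"
proof -
  let ?w = "signed_perm \<pi> \<epsilon>"
  have l: "lin K (axis i 1) = gen (K i)"
  proof -
    have "lin K (axis i 1) = (\<Sum>j\<in>UNIV. if j = i then gen (K j) else 0)"
      unfolding lin_def by (intro sum.cong) (auto simp: axis_def)
    then show ?thesis by simp
  qed
  have col: "(?w *v axis i 1) $ j = (if j = \<pi> i then \<epsilon> i else 0)" for j
  proof -
    have "(?w *v axis i 1) $ j = (\<Sum>k\<in>UNIV. if k = i then (if j = \<pi> i then \<epsilon> i else 0) else 0)"
      unfolding matrix_vector_mult_def vec_lambda_beta by (intro sum.cong) (auto simp: signed_perm_def axis_def)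
    then show ?thesis by simp
  qed
  have r: "lin K (?w *v axis i 1) = scal (\<epsilon> i) * gen (K (\<pi> i))"
  proof -
    have "lin K (?w *v axis i 1) = (\<Sum>j\<in>UNIV. if j = \<pi> i then scal (\<epsilon> i) * gen (K j) else 0)"
      unfolding lin_def by (intro sum.cong) (auto simp: col)
    then show ?thesis by simp
  qed
  have inv: "fW (matrix_inv ?w) * fW ?w \<doteq> 1"
  proof -
    have "matrix_inv ?w ** ?w = mat 1" by (rule weyl_group_matrix_inv(2)[OF assms(1)])
    then show ?thesis
      using eqv_trans[OF W_mult[OF weyl_group_inverse[OF assms(1)] assms(1)]] W_1 by simp
  qed
  have "fW ?w * gen (K i) = fW ?w * gen (K i) * 1" by simp
  also have "\<dots> \<doteq> fW ?w * gen (K i) * (fW (matrix_inv ?w) * fW ?w)"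
    by (intro eqv_mult eqv_refl eqv_sym[OF inv])
  also have "\<dots> = (fW ?w * lin K (axis i 1) * fW (matrix_inv ?w)) * fW ?w"
    by (simp only: l mult.assoc)
  also have "\<dots> \<doteq> lin K (?w *v axis i 1) * fW ?w"
    by (intro eqv_mult eqv_refl W_lin assms)
  finally show ?thesis by (simp only: r mult.assoc)
qed

abbreviation pos :: "bool \<Rightarrow> 'n \<Rightarrow> ('n, complex^'n^'n) rdahc_gen" where
  "pos \<eta> \<equiv> if \<eta> then Xgen else Ygen"

abbreviation mom :: "bool \<Rightarrow> 'n \<Rightarrow> ('n, complex^'n^'n) rdahc_gen" where
  "mom \<eta> \<equiv> if \<eta> then Ygen else Xgen"

lemma pos_commute: "gen (pos \<eta> i) * gen (pos \<eta> j) \<doteq> gen (pos \<eta> j) * gen (pos \<eta> i)"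
  using X_commute Y_commute by simp

lemma eval_mult: "eval (pos \<eta>) (f * g) \<doteq> eval (pos \<eta>) f * eval (pos \<eta>) g"
  unfolding eval_def
proof (rule free.lin_ext_mult_eqv[OF ring_congruence_axioms])
  show "monom_eval (pos \<eta>) (m + m') \<doteq> monom_eval (pos \<eta>) m * monom_eval (pos \<eta>) m'" for m m'
    unfolding monom_eval_def lookup_add power_add
    by (intro prod_list_mult_eqv power_commute_eqv pos_commute)
qed

lemma eval_var_mult: "eval (pos \<eta>) (mvar i * f) \<doteq> gen (pos \<eta> i) * eval (pos \<eta>) f"
  using eval_mult[of \<eta> "mvar i" f] by simp

lemma eval_const_mult: "eval (pos \<eta>) (mconst a * f) \<doteq> scal a * eval (pos \<eta>) f"
  using eval_mult[of \<eta> "mconst a" f] by simp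

definition moves :: "bool \<Rightarrow> 'n rdahc_free \<Rightarrow> complex^'n^'n \<Rightarrow> bool" where
  "moves \<eta> A w \<longleftrightarrow> (\<forall>f. A * eval (pos \<eta>) f \<doteq> eval (pos \<eta>) (mact w f) * A)"

text \<open>Modulo \<open>J\<close> both \<open>eval\<close> and \<open>mact w\<close> are
  multiplicative, so the variables suffice.\<close>

lemma movesI:
  assumes "\<And>i. A * gen (pos \<eta> i) \<doteq> eval (pos \<eta>) (mact w (mvar i)) * A"
  shows "moves \<eta> A w"
  unfolding moves_def
proof
  fix f show "A * eval (pos \<eta>) f \<doteq> eval (pos \<eta>) (mact w f) * A"
  proof (induction f rule: mpoly_induct)
    case (const a)
    then show ?case by (simp add: free.sc_commute)
  next
    case (add f g)
    then show ?case by (simp add: eval_add mact_add distrib_left distrib_right eqv_add)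
  next
    case (var i f)
    have "A * eval (pos \<eta>) (mvar i * f) \<doteq> A * (gen (pos \<eta> i) * eval (pos \<eta>) f)"
      by (intro eqv_mult eqv_refl eval_var_mult)
    also have "\<dots> = (A * gen (pos \<eta> i)) * eval (pos \<eta>) f" by (simp add: mult.assoc)
    also have "\<dots> \<doteq> (eval (pos \<eta>) (mact w (mvar i)) * A) * eval (pos \<eta>) f"
      by (intro eqv_mult eqv_refl assms)
    also have "\<dots> = eval (pos \<eta>) (mact w (mvar i)) * (A * eval (pos \<eta>) f)" by (simp add: mult.assoc)
    also have "\<dots> \<doteq> eval (pos \<eta>) (mact w (mvar i)) * (eval (pos \<eta>) (mact w f) * A)"
      by (intro eqv_mult eqv_refl var)
    also have "\<dots> = (eval (pos \<eta>) (mact w (mvar i)) * eval (pos \<eta>) (mact w f)) * A" by (simp add: mult.assoc)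
    also have "\<dots> \<doteq> eval (pos \<eta>) (mact w (mvar i) * mact w f) * A"
      by (intro eqv_mult eqv_refl eqv_sym[OF eval_mult])
    finally show ?case by (simp add: mact_mult)
  qed
qed

lemma movesD: "moves \<eta> A w \<Longrightarrow> A * eval (pos \<eta>) f \<doteq> eval (pos \<eta>) (mact w f) * A"
  by (simp add: moves_def)

lemma moves_mult:
  assumes "moves \<eta> A w" "moves \<eta> B w'"
  shows "moves \<eta> (A * B) (w ** w')"
  unfolding moves_def
proof
  fix f
  have "A * B * eval (pos \<eta>) f = A * (B * eval (pos \<eta>) f)" by (simp add: mult.assoc)
  also have "\<dots> \<doteq> A * (eval (pos \<eta>) (mact w' f) * B)"
    by (rule eqv_mult[OF eqv_refl movesD[OF assms(2)]])
  also have "\<dots> = (A * eval (pos \<eta>) (mact w' f)) * B" by (simp add: mult.assoc)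
  also have "\<dots> \<doteq> (eval (pos \<eta>) (mact w (mact w' f)) * A) * B"
    by (rule eqv_mult[OF movesD[OF assms(1)] eqv_refl])
  finally show "A * B * eval (pos \<eta>) f \<doteq> eval (pos \<eta>) (mact (w ** w') f) * (A * B)"
    by (simp add: mact_mact mult.assoc)
qed

lemma moves_W:
  assumes "w \<in> weyl_group T"
  shows "moves \<eta> (fW w) w"
proof (rule movesI)
  fix i
  obtain \<pi> \<epsilon> where w: "w = signed_perm \<pi> \<epsilon>" using assms by (rule weyl_group_cases)
  have "fW w * gen (pos \<eta> i) \<doteq> scal (\<epsilon> i) * (gen (pos \<eta> (\<pi> i)) * fW w)"
    using W_gen[of \<pi> \<epsilon> "pos \<eta>" i] assms by (simp add: w del: weyl_group.simps)
  also have "\<dots> = (scal (\<epsilon> i) * gen (pos \<eta> (\<pi> i))) * fW w" by (simp add: mult.assoc)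
  also have "\<dots> \<doteq> eval (pos \<eta>) (mconst (\<epsilon> i) * mvar (\<pi> i)) * fW w"
    using eqv_sym[OF eval_const_mult[of \<eta> "\<epsilon> i" "mvar (\<pi> i)"]] by (intro eqv_mult eqv_refl) simp
  finally show "fW w * gen (pos \<eta> i) \<doteq> eval (pos \<eta>) (mact w (mvar i)) * fW w"
    by (simp add: w mact_signed_perm_var)
qed

lemma eval_minus: "eval K (- f) = - eval K f"
  by (simp add: eval_def free.lin_ext_minus)

lemma moves_C: "moves \<eta> (fC i) (flip \<eta> i)"
proof (rule movesI)
  fix k
  show "fC i * gen (pos \<eta> k) \<doteq> eval (pos \<eta>) (mact (flip \<eta> i) (mvar k)) * fC i"
    using eqv_sym[OF Y_C[of k i]] eqv_sym[OF X_C[of k i]] eqv_minus[OF eqv_sym[OF X_C_same[of i]]]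
    by (auto simp: mact_flip_var eval_minus)
qed

lemma term_reflection_in_weyl_group:
  "(k, b, \<delta>) \<in> terms T i \<Longrightarrow> reflection \<delta> k i \<in> weyl_group T"
  using refl_in_weyl_group[of \<delta> T k i] refl_in_B[of "-1" i i]
  by (auto simp: terms_def simp del: weyl_group.simps split: if_splits)

lemma moves_term:
  assumes "t \<in> terms T i"
  shows "moves \<eta> (term_elt i t) (reflection (term_sign \<eta> t) (fst t) i)"
proof -
  obtain k b \<delta> where t: "t = (k, b, \<delta>)" by (cases t) auto
  have w: "reflection \<delta> k i \<in> weyl_group T"
    using assms unfolding t by (rule term_reflection_in_weyl_group)
  show ?thesis
  proof (cases b)
    case False
    with moves_W[OF w] show ?thesis by (simp add: t term_elt_def term_sign_def)
  next
    case True
    then have "k \<noteq> i" using assms by (auto simp: t terms_def split: if_splits)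
    with True moves_mult[OF moves_mult[OF moves_C moves_C] moves_W[OF w], of \<eta> k i] show ?thesis
      by (simp add: t term_elt_def term_sign_def flip_flip_reflection)
  qed
qed

lemma mom_pos: "gen (mom \<eta> i) * gen (pos \<eta> l) \<doteq> gen (pos \<eta> l) * gen (mom \<eta> i) + term_sum \<eta> T u v i l"
proof (cases \<eta>)
  case True
  have "gen (Ygen i) * gen (Xgen l) \<doteq> gen (Xgen l) * gen (Ygen i) + yx_comm T u v i l" by (rule Y_X)
  also have "\<dots> \<doteq> gen (Xgen l) * gen (Ygen i) + term_sum True T u v i l"
    by (intro eqv_add eqv_refl eqv_sym[OF term_sum_x])
  finally show ?thesis using True by simp
next
  case False
  have "gen (Xgen i) * gen (Ygen l) = (gen (Xgen i) * gen (Ygen l) + yx_comm T u v l i) - yx_comm T u v l i" by simp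
  also have "\<dots> \<doteq> gen (Ygen l) * gen (Xgen i) - yx_comm T u v l i"
    by (intro eqv_diff eqv_refl eqv_sym[OF Y_X])
  finally show ?thesis using False by (simp add: term_sum_y)
qed

text \<open>Passing one more variable leaves \<open>term_sum\<close> behind, whose terms then move
  past f and reflect it. The resulting recursion is that of \<open>dd_var_mult\<close>.\<close>

lemma mom_eval:
  "gen (mom \<eta> i) * eval (pos \<eta>) f \<doteq> eval (pos \<eta>) f * gen (mom \<eta> i)
    + (\<Sum>t\<in>terms T i. scal (term_coeff \<eta> u v i t) * (eval (pos \<eta>) (dd (term_sign \<eta> t) (fst t) i f) * term_elt i t))"
proof (induction f rule: mpoly_induct)
  case (const a)
  have "dd (term_sign \<eta> t) (fst t) i (mconst a) = 0" if "t \<in> terms T i" for t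
    by (rule root_data.dd_const[OF terms_root_data[OF that]])
  then show ?case by (simp add: free.sc_commute)
next
  case (add f g)
  let ?S = "\<lambda>f. \<Sum>t\<in>terms T i. scal (term_coeff \<eta> u v i t) * (eval (pos \<eta>) (dd (term_sign \<eta> t) (fst t) i f) * term_elt i t)"
  have S: "?S (f + g) = ?S f + ?S g"
    unfolding sum.distrib[symmetric]
    by (intro sum.cong HOL.refl) (simp only: root_data.dd_add[OF terms_root_data] eval_add distrib_left distrib_right)
  show ?case
    using eqv_add[OF add] by (simp only: S eval_add distrib_left distrib_right add_ac)
next
  case (var l f)
  let ?e = "eval (pos \<eta>)" and ?P = "gen (mom \<eta> i)" and ?z = "gen (pos \<eta> l)"
  let ?d = "\<lambda>t. dd (term_sign \<eta> t) (fst t) i" and ?c = "\<lambda>t. scal (term_coeff \<eta> u v i t)"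
  let ?r = "\<lambda>t. root_coeff (term_sign \<eta> t) (fst t) i l" and ?s = "\<lambda>t. mact (reflection (term_sign \<eta> t) (fst t) i)"
  have t: "?c t * (?z * (?e (?d t f) * term_elt i t)) + ?c t * (scal (?r t) * (?e (?s t f) * term_elt i t))
      \<doteq> ?c t * (?e (?d t (mvar l * f)) * term_elt i t)" if "t \<in> terms T i" for t
  proof -
    have "?e (?d t (mvar l * f)) = ?e (mvar l * ?d t f) + ?e (mconst (?r t) * ?s t f)"
      by (simp only: root_data.dd_var_mult[OF terms_root_data[OF that]] eval_add)
    also have "\<dots> \<doteq> ?z * ?e (?d t f) + scal (?r t) * ?e (?s t f)"
      by (intro eqv_add eval_var_mult eval_const_mult)
    finally have "?c t * (?e (?d t (mvar l * f)) * term_elt i t)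
      \<doteq> ?c t * ((?z * ?e (?d t f) + scal (?r t) * ?e (?s t f)) * term_elt i t)"
      by (rule eqv_mult[OF eqv_refl eqv_mult[OF _ eqv_refl]])
    from eqv_sym[OF this] show ?thesis by (simp only: distrib_left distrib_right mult.assoc)
  qed
  have "?P * ?e (mvar l * f) \<doteq> ?P * (?z * ?e f)"
    by (intro eqv_mult eqv_refl eval_var_mult)
  also have "\<dots> = (?P * ?z) * ?e f" by (simp add: mult.assoc)
  also have "\<dots> \<doteq> (?z * ?P + term_sum \<eta> T u v i l) * ?e f"
    by (intro eqv_mult eqv_refl mom_pos)
  also have "\<dots> = ?z * (?P * ?e f) + (\<Sum>t\<in>terms T i. ?c t * (scal (?r t) * (term_elt i t * ?e f)))"
    by (simp only: term_sum_def distrib_right sum_distrib_right free.sc_mult mult.assoc)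
  also have "\<dots> \<doteq> ?z * (?e f * ?P + (\<Sum>t\<in>terms T i. ?c t * (?e (?d t f) * term_elt i t)))
      + (\<Sum>t\<in>terms T i. ?c t * (scal (?r t) * (?e (?s t f) * term_elt i t)))"
  proof (intro eqv_add eqv_mult[OF eqv_refl var] eqv_sum)
    fix t assume "t \<in> terms T i"
    then show "?c t * (scal (?r t) * (term_elt i t * ?e f)) \<doteq> ?c t * (scal (?r t) * (?e (?s t f) * term_elt i t))"
      by (intro eqv_mult[OF eqv_refl] movesD moves_term)
  qed
  also have "\<dots> = (?z * ?e f) * ?P + (\<Sum>t\<in>terms T i. ?c t * (?z * (?e (?d t f) * term_elt i t))
      + ?c t * (scal (?r t) * (?e (?s t f) * term_elt i t)))"
    by (simp only: distrib_left sum.distrib sum_distrib_left mult.assoc free.sc_left_commute[of ?z] add.assoc)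
  also have "\<dots> \<doteq> ?e (mvar l * f) * ?P + (\<Sum>t\<in>terms T i. ?c t * (?e (?d t (mvar l * f)) * term_elt i t))"
    by (intro eqv_add eqv_mult eqv_refl eqv_sum t eqv_sym[OF eval_var_mult])
  finally show ?case .
qed

end

section \<open>Central elements\<close>

lemma mact_flip_square_poly: "f \<in> range (msubst (\<lambda>i. mvar i ^ 2)) \<Longrightarrow> mact (flip \<eta> i) f = f"
proof -
  have sq: "mact (flip \<eta> i) (mvar j ^ 2) = mvar j ^ 2" for j
    by (auto simp: mact_power mact_flip_var)
  assume "f \<in> range (msubst (\<lambda>i. mvar i ^ 2))"
  then obtain g where f: "f = msubst (\<lambda>i. mvar i ^ 2) g" by blast
  show "mact (flip \<eta> i) f = f" unfolding f
    by (induction g rule: mpoly_induct) (simp_all add: msubst_add msubst_mult mact_add mact_mult sq)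
qed

definition even_free :: "('n, 'w) rdahc_gen free \<Rightarrow> bool" where
  "even_free f \<longleftrightarrow> (\<forall>w\<in>Poly_Mapping.keys f. even (length (filter is_odd_gen (letters w))))"

lemma even_free_add: "even_free f \<Longrightarrow> even_free g \<Longrightarrow> even_free (f + g)"
  unfolding even_free_def using Poly_Mapping.keys_add[of f g] by blast

lemma even_free_mult: "even_free f \<Longrightarrow> even_free g \<Longrightarrow> even_free (f * g)"
  unfolding even_free_def using keys_mult[of f g] by (fastforce simp: plus_word_def)

lemma even_free_scal: "even_free (scal a)"
  by (auto simp: even_free_def scal_def zero_word_def split: if_splits)

lemma even_free_eval:
  assumes "\<And>i. \<not> is_odd_gen (K i)"
  shows "even_free (eval K f)"
  unfolding even_free_def
proof
  fix w assume "w \<in> Poly_Mapping.keys (eval K f)"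
  then have "set (letters w) \<subseteq> range K" using eval_closed[of K f] by (auto simp: free_algebra_carrier_iff)
  then have "filter is_odd_gen (letters w) = []" using assms by (auto simp: filter_empty_conv)
  then show "even (length (filter is_odd_gen (letters w)))" by simp
qed

context hecke_congruence
begin

text \<open>For y every \<open>flip\<close> is the identity and only invariance under W remains; for
  x evenness in each variable is imposed as well.\<close>

definition fixed :: "bool \<Rightarrow> 'n mpoly \<Rightarrow> bool" where
  "fixed \<eta> f \<longleftrightarrow> (\<forall>w\<in>weyl_group T. mact w f = f) \<and> (\<forall>i. mact (flip \<eta> i) f = f)"

lemma fixed_Y: "f \<in> invariants T \<Longrightarrow> fixed False f"
  by (simp add: fixed_def invariants_def flip_def del: weyl_group.simps)

lemma fixed_square: "f \<in> square_invariants T \<Longrightarrow> fixed \<eta> f"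
  unfolding fixed_def square_invariants_def invariants_def using mact_flip_square_poly by blast

text \<open>For x and a Clifford term the reflection has sign -\<delta> and may lie outside W, as in
  type A. It is still a group element multiplied by two sign changes, all of which fix f.\<close>

lemma fixed_term:
  assumes "fixed \<eta> f" "t \<in> terms T i"
  shows "mact (reflection (term_sign \<eta> t) (fst t) i) f = f"
proof -
  obtain k b \<delta> where t: "t = (k, b, \<delta>)" by (cases t) auto
  have r: "mact (reflection \<delta> k i) f = f"
    using assms term_reflection_in_weyl_group unfolding t fixed_def by blast
  show ?thesis
  proof (cases b)
    case False
    with r show ?thesis by (simp add: t term_sign_def)
  next
    case True
    then have "k \<noteq> i" using assms(2) by (auto simp: t terms_def split: if_splits)
    have "mact (flip \<eta> k ** flip \<eta> i ** reflection \<delta> k i) f = f"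
      using assms(1) r by (simp add: fixed_def flip: mact_mact)
    then show ?thesis using True \<open>k \<noteq> i\<close> by (simp add: t term_sign_def flip_flip_reflection)
  qed
qed

lemma eval_commute_gen:
  assumes "fixed \<eta> f" "g \<in> rdahc_gens T"
  shows "gen g * eval (pos \<eta>) f \<doteq> eval (pos \<eta>) f * gen g"
proof -
  have pos: "gen (pos \<eta> i) * eval (pos \<eta>) f \<doteq> eval (pos \<eta>) f * gen (pos \<eta> i)" for i
  proof -
    have "gen (pos \<eta> i) * eval (pos \<eta>) f \<doteq> eval (pos \<eta>) (mvar i * f)" by (rule eqv_sym[OF eval_var_mult])
    also have "\<dots> = eval (pos \<eta>) (f * mvar i)" by (simp only: mult.commute)
    also have "\<dots> \<doteq> eval (pos \<eta>) f * eval (pos \<eta>) (mvar i)" by (rule eval_mult)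
    finally show ?thesis by simp
  qed
  have mom: "gen (mom \<eta> i) * eval (pos \<eta>) f \<doteq> eval (pos \<eta>) f * gen (mom \<eta> i)" for i
  proof -
    have "dd (term_sign \<eta> t) (fst t) i f = 0" if "t \<in> terms T i" for t
      by (rule root_data.dd_eq_0[OF terms_root_data[OF that] fixed_term[OF assms(1) that]])
    then show ?thesis using mom_eval[of \<eta> i f] by simp
  qed
  have C: "fC i * eval (pos \<eta>) f \<doteq> eval (pos \<eta>) f * fC i" for i
    using movesD[OF moves_C, of i \<eta> f] assms(1) by (simp add: fixed_def)
  have W: "fW w * eval (pos \<eta>) f \<doteq> eval (pos \<eta>) f * fW w" if "w \<in> weyl_group T" for w
    using movesD[OF moves_W[OF that], of \<eta> f] assms(1) that by (simp add: fixed_def del: weyl_group.simps)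
  show ?thesis
    using assms(2) pos mom C W unfolding rdahc_gens_def by (cases \<eta>) auto
qed

lemma eval_central:
  assumes "fixed \<eta> f" "a \<in> carrier (rdahc_free_algebra T)"
  shows "a * eval (pos \<eta>) f \<doteq> eval (pos \<eta>) f * a"
  using assms(2)
proof (induction rule: free_algebra_induct)
  case (add a b)
  then show ?case by (simp only: distrib_left distrib_right eqv_add)
next
  case (word c l)
  have "prod_list (map gen l) * eval (pos \<eta>) f \<doteq> eval (pos \<eta>) f * prod_list (map gen l)"
  proof (rule eqv_sym, rule eqv_prod_list_commute)
    fix b assume "b \<in> set (map gen l)"
    then obtain g where "g \<in> rdahc_gens T" "b = gen g" using word by auto
    then show "eval (pos \<eta>) f * b \<doteq> b * eval (pos \<eta>) f"
      by (simp only: eqv_sym[OF eval_commute_gen[OF assms(1)]])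
  qed
  from eqv_mult[OF eqv_refl[of "scal c"] this] show ?case
    by (simp only: mult.assoc free.sc_left_commute[of "eval _ _"])
qed simp

text \<open>Evenness is asked of the representative itself, because the even part of the quotient is
  defined as the image of the even elements.\<close>

definition central :: "'n rdahc_free set" where
  "central = {f \<in> carrier (rdahc_free_algebra T). even_free f \<and>
     (\<forall>a\<in>carrier (rdahc_free_algebra T). a * f \<doteq> f * a)}"

lemma eval_pos_closed: "eval (pos \<eta>) f \<in> carrier (rdahc_free_algebra T)"
  using eval_closed[of "pos \<eta>" f] free_algebra_mono[of "range (pos \<eta>)" "rdahc_gens T"]
  by (auto simp: rdahc_gens_def split: if_splits)

lemma eval_in_central: "fixed \<eta> f \<Longrightarrow> eval (pos \<eta>) f \<in> central"
  unfolding central_def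
  by (intro CollectI conjI ballI eval_pos_closed eval_central even_free_eval) auto

lemma central_closed:
  "scal a \<in> central"
  "f \<in> central \<Longrightarrow> g \<in> central \<Longrightarrow> f + g \<in> central"
  "f \<in> central \<Longrightarrow> g \<in> central \<Longrightarrow> f * g \<in> central"
proof -
  show "scal a \<in> central"
    by (auto simp: central_def even_free_scal free_algebra_closed free.sc_commute)
  show "f \<in> central \<Longrightarrow> g \<in> central \<Longrightarrow> f + g \<in> central"
    by (auto simp: central_def distrib_left distrib_right intro: free_algebra_closed even_free_add eqv_add)
  show "f * g \<in> central" if f: "f \<in> central" and g: "g \<in> central"
  proof -
    have "a * (f * g) \<doteq> f * g * a" if a: "a \<in> carrier (rdahc_free_algebra T)" for a
    proof -
      have "a * (f * g) = (a * f) * g" by (simp add: mult.assoc)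
      also have "\<dots> \<doteq> (f * a) * g" using f a by (intro eqv_mult[OF _ eqv_refl]) (auto simp: central_def)
      also have "\<dots> = f * (a * g)" by (simp add: mult.assoc)
      also have "\<dots> \<doteq> f * (g * a)" using g a by (intro eqv_mult[OF eqv_refl]) (auto simp: central_def)
      finally show ?thesis by (simp add: mult.assoc)
    qed
    with f g show ?thesis by (auto simp: central_def intro: free_algebra_closed even_free_mult)
  qed
qed

end

lemma hecke_congruence_rel_ideal: "hecke_congruence (rel_ideal T u v) T u v"
  by (intro hecke_congruence.intro hecke_congruence_axioms.intro ring_congruence_rel_ideal rels_in_rel_ideal)

lemma class_mult:
  assumes "f \<in> carrier (rdahc_free_algebra T)" "g \<in> carrier (rdahc_free_algebra T)"
  shows "rdahc_class T u v f \<otimes>\<^bsub>rdahc_algebra T u v\<^esub> rdahc_class T u v g = rdahc_class T u v (f * g)"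
  using ring_hom_mult[OF rdahc_class_ring_hom assms] by simp

lemma class_add:
  assumes "f \<in> carrier (rdahc_free_algebra T)" "g \<in> carrier (rdahc_free_algebra T)"
  shows "rdahc_class T u v f \<oplus>\<^bsub>rdahc_algebra T u v\<^esub> rdahc_class T u v g = rdahc_class T u v (f + g)"
  using ring_hom_add[OF rdahc_class_ring_hom assms] by simp

lemma central_class:
  assumes "f \<in> hecke_congruence.central (rel_ideal T u v) T"
  shows "rdahc_class T u v f \<in> rdahc_even_center T u v"
proof -
  interpret hecke_congruence "rel_ideal T u v" T u v by (rule hecke_congruence_rel_ideal)
  have f: "f \<in> carrier (rdahc_free_algebra T)" "even_free f"
    "\<And>a. a \<in> carrier (rdahc_free_algebra T) \<Longrightarrow> eqv (a * f) (f * a)"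
    using assms by (auto simp: central_def)
  have "rdahc_class T u v f \<otimes>\<^bsub>rdahc_algebra T u v\<^esub> a = a \<otimes>\<^bsub>rdahc_algebra T u v\<^esub> rdahc_class T u v f"
    if a: "a \<in> carrier (rdahc_algebra T u v)" for a
  proof -
    obtain b where b: "b \<in> carrier (rdahc_free_algebra T)" "a = rdahc_class T u v b"
      using a unfolding carrier_rdahc_algebra by blast
    show ?thesis
      unfolding b(2) using b(1) f(1) f(3)[OF b(1)]
      by (simp add: class_mult rdahc_class_eq_iff free_algebra_closed eqv_sym)
  qed
  moreover have "rdahc_class T u v f \<in> rdahc_even_part T u v"
    using f unfolding rdahc_even_part_def even_free_def by blast
  ultimately show ?thesis by (simp add: rdahc_even_center_def)
qed

section \<open>Embedding of the invariants\<close>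

lemma rep_eval_inject:
  fixes f g :: "'n::finite mpoly"
  assumes "ring_congruence.eqv (rel_ideal T u v) (eval (if \<eta> then Xgen else Ygen) f) (eval (if \<eta> then Xgen else Ygen) g)"
  shows "f = g"
proof -
  have rels: "rdahc_rels T u v \<subseteq> (rep.rep_kernel \<eta> T u v)"
    using hecke_operators.rep_rels[OF hecke_operators_gen_op, of _ T u v \<eta>] unfolding rep.rep_kernel_def by blast
  interpret K: hecke_congruence "rep.rep_kernel \<eta> T u v :: 'n rdahc_free set" T u v
    by (intro hecke_congruence.intro hecke_congruence_axioms.intro rep.ring_congruence_rep_kernel rels)
  let ?e = "eval (if \<eta> then Xgen else Ygen)"
  \<comment> \<open>The kernel contains all relations, so the variables can be taken out of the
    ordered product one at a time, each acting by multiplication.\<close>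
  have ev: "app (rep.rep \<eta> T u v (?e f)) (\<chi> q. 1) = (\<chi> q. f)" for f :: "'n mpoly"
  proof (induction f rule: mpoly_induct)
    case (const a)
    show ?case by (simp add: vec_eq_iff app_op_simps)
  next
    case (add f g)
    then show ?case by (simp add: eval_add rep.rep_add app_ring_simps vec_eq_iff)
  next
    case (var i f)
    have "rep.rep \<eta> T u v (?e (mvar i * f)) = rep.rep \<eta> T u v (gen ((if \<eta> then Xgen else Ygen) i) * ?e f)"
      using K.eval_var_mult[of \<eta> i f] by (simp only: rep.eqv_rep_kernel)
    also have "\<dots> = op_var i * rep.rep \<eta> T u v (?e f)" by (simp add: rep.rep_mult)
    finally show ?case using var by (simp add: app_ring_simps vec_eq_iff app_op_simps)
  qed
  have "rel_ideal T u v \<subseteq> (rep.rep_kernel \<eta> T u v)" by (rule rel_ideal_minimal[OF rep.ring_congruence_rep_kernel rels])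
  then have "rep.rep \<eta> T u v (?e f) = rep.rep \<eta> T u v (?e g)"
    using assms unfolding ring_congruence.eqv_def[OF ring_congruence_rel_ideal]
    by (auto simp: rep.rep_kernel_def rep.rep_diff)
  then have "(\<chi> q. f) = ((\<chi> q. g) :: 'n rep_space)" using ev[of f] ev[of g] by simp
  then show ?thesis by (simp add: vec_eq_iff)
qed

lemma embeds_in_even_centerI:
  fixes P :: "'n::finite mpoly set"
  assumes "\<And>f. f \<in> P \<Longrightarrow> hecke_congruence.fixed T \<eta> f"
  shows "embeds_in_even_center T u v (if \<eta> then Xgen else Ygen) P"
proof -
  interpret hecke_congruence "rel_ideal T u v :: 'n rdahc_free set" T u v by (rule hecke_congruence_rel_ideal)
  let ?\<phi> = "\<lambda>f. rdahc_class T u v (eval (pos \<eta>) f)"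
  have "?\<phi> \<in> ring_hom (type_ring UNIV) (rdahc_algebra T u v)"
  proof (rule ring_hom_memI)
    fix f g :: "'n mpoly"
    show "?\<phi> f \<in> carrier (rdahc_algebra T u v)"
      unfolding carrier_rdahc_algebra by (intro imageI eval_pos_closed)
    show "?\<phi> (f \<otimes>\<^bsub>type_ring UNIV\<^esub> g) = ?\<phi> f \<otimes>\<^bsub>rdahc_algebra T u v\<^esub> ?\<phi> g"
      by (simp only: class_mult eval_pos_closed rdahc_class_eq_iff free_algebra_closed type_ring_def
        monoid.simps partial_object.simps ring.simps eval_mult)
    show "?\<phi> (f \<oplus>\<^bsub>type_ring UNIV\<^esub> g) = ?\<phi> f \<oplus>\<^bsub>rdahc_algebra T u v\<^esub> ?\<phi> g"
      by (simp only: class_add eval_pos_closed type_ring_def eval_add monoid.simps partial_object.simps ring.simps)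
  next
    show "?\<phi> \<one>\<^bsub>type_ring UNIV\<^esub> = \<one>\<^bsub>rdahc_algebra T u v\<^esub>"
      using ring_hom_one[OF rdahc_class_ring_hom, of T u v] by (simp add: type_ring_def)
  qed
  then have "is_eval_hom T u v (pos \<eta>) ?\<phi>"
    by (simp add: is_eval_hom_def)
  moreover have "inj_on ?\<phi> P"
    using rep_eval_inject by (intro inj_onI) (simp only: rdahc_class_eq_iff eval_pos_closed, blast)
  moreover have "?\<phi> ` P \<subseteq> rdahc_even_center T u v"
    by (intro image_subsetI central_class eval_in_central assms)
  ultimately show ?thesis unfolding embeds_in_even_center_def by blast
qed

section \<open>Finiteness of the polynomial ring over the invariants of the squares\<close>

lemma square_invariantsI:
  "(\<And>w. w \<in> weyl_group T \<Longrightarrow> mact w f = f) \<Longrightarrow> f = msubst (\<lambda>i. mvar i ^ 2) g \<Longrightarrow> f \<in> square_invariants T"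
  unfolding square_invariants_def invariants_def by blast

lemma square_invariantsE:
  assumes "f \<in> square_invariants T"
  obtains g where "\<And>w. w \<in> weyl_group T \<Longrightarrow> mact w f = f" "f = msubst (\<lambda>i. mvar i ^ 2) g"
  using assms unfolding square_invariants_def invariants_def by blast

lemma square_invariants_closed:
  "mconst a \<in> square_invariants T"
  "f \<in> square_invariants T \<Longrightarrow> g \<in> square_invariants T \<Longrightarrow> f * g \<in> square_invariants T"
  "f \<in> square_invariants T \<Longrightarrow> - f \<in> square_invariants T"
proof -
  show "mconst a \<in> square_invariants T"
    by (rule square_invariantsI[of _ _ "mconst a"]) simp_all
  show "f \<in> square_invariants T \<Longrightarrow> g \<in> square_invariants T \<Longrightarrow> f * g \<in> square_invariants T"
    by (elim square_invariantsE, rule square_invariantsI)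
      (simp only: mact_mult, simp only: msubst_mult[symmetric])
  show "f \<in> square_invariants T \<Longrightarrow> - f \<in> square_invariants T"
    by (elim square_invariantsE, rule square_invariantsI)
      (simp only: mact_minus, simp only: msubst_minus[symmetric])
qed

text \<open>Elementary symmetric polynomials in the elements - z_j^2; with this sign they are the
  coefficients of the product of all t - z_j^2, without alternating signs.\<close>

definition esym :: "nat \<Rightarrow> 'n::finite mpoly" where
  "esym k = (\<Sum>A | card A = k. \<Prod>j\<in>A. - (mvar j ^ 2))"

lemma esym_square_invariant: "esym k \<in> square_invariants T"
proof -
  have "mact w (esym k) = esym k" if "w \<in> weyl_group T" for w :: "complex^'n^'n"
  proof -
    obtain \<pi> \<epsilon> where w: "w = signed_perm \<pi> \<epsilon>" "bij \<pi>" "range \<epsilon> \<subseteq> {1, -1}"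
      using \<open>w \<in> weyl_group T\<close> by (rule weyl_group_cases) blast
    have sq: "mact w (mvar j ^ 2) = mvar (\<pi> j) ^ 2" for j
    proof -
      have "mact w (mvar j ^ 2) = (mconst (\<epsilon> j) * mconst (\<epsilon> j)) * mvar (\<pi> j) ^ 2"
        by (simp only: w(1) mact_mult mact_signed_perm_var power2_eq_square mult_ac)
      then show ?thesis by (simp only: mconst_mult[symmetric] sign_square[OF w(3)] mconst_1 mult_1_left)
    qed
    have inj: "inj \<pi>" using w(2) by (rule bij_is_inj)
    have "mact w (esym k) = (\<Sum>A | card A = k. \<Prod>j\<in>A. - (mvar (\<pi> j) ^ 2))"
      by (simp add: esym_def mact_sum mact_prod mact_minus sq)
    also have "\<dots> = (\<Sum>A | card A = k. \<Prod>j\<in>\<pi> ` A. - (mvar j ^ 2))"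
      using inj by (simp add: prod.reindex inj_on_subset)
    also have "\<dots> = esym k"
      unfolding esym_def
    proof (rule sum.reindex_bij_betw)
      have "\<pi> ` inv_into UNIV \<pi> ` A = A" "inv_into UNIV \<pi> ` \<pi> ` A = A" for A
        using w(2) by (simp_all add: image_image bij_is_surj surj_f_inv_f inv_f_f[OF inj])
      moreover have "card (\<pi> ` A) = card A" "card (inv_into UNIV \<pi> ` A) = card A" for A
        using inj bij_is_inj[OF bij_imp_bij_inv[OF w(2)]] by (simp_all add: card_image inj_on_subset)
      ultimately show "bij_betw ((`) \<pi>) {A. card A = k} {A. card A = k}"
        by (intro bij_betw_byWitness[of _ "(`) (inv_into UNIV \<pi>)"]) auto
    qed
    finally show ?thesis .
  qed
  moreover have "esym k = msubst (\<lambda>i. mvar i ^ 2) (\<Sum>A | card A = k. \<Prod>j\<in>A. - mvar j)"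
    by (simp add: esym_def msubst_sum msubst_prod msubst_minus)
  ultimately show ?thesis unfolding square_invariants_def invariants_def by blast
qed

text \<open>Each variable is a root of the monic polynomial \<open>\<Prod>\<^sub>j (t\<^sup>2 - mvar j ^ 2)\<close>, whose coefficients
  are invariant under all signed permutations.\<close>

lemma var_power_eq:
  fixes i :: "'n::finite"
  shows "mvar i ^ (2 * CARD('n)) = (\<Sum>k=1..CARD('n). - esym k * mvar i ^ (2 * (CARD('n) - k)))"
proof -
  let ?n = "CARD('n)"
  let ?h = "\<lambda>A. (\<Prod>j\<in>A. - (mvar j ^ 2)) * (\<Prod>j\<in>UNIV - A. mvar i ^ 2) :: 'n mpoly"
  \<comment> \<open>The factor with j = i vanishes. Expansion over subsets, grouped by cardinality,
    then isolates the leading term k = 0.\<close>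
  have "0 = (\<Prod>j\<in>UNIV. - (mvar j ^ 2) + mvar i ^ 2 :: 'n mpoly)"
    by (rule sym, rule prod_zero) auto
  also have "\<dots> = (\<Sum>A\<in>Pow UNIV. ?h A)" by (rule prod_add) simp
  also have "\<dots> = (\<Sum>k\<in>{0..?n}. \<Sum>A\<in>{A \<in> Pow UNIV. card A = k}. ?h A)"
    by (rule sum.group[symmetric]) (auto intro: card_mono[OF finite subset_UNIV])
  also have "\<dots> = (\<Sum>k\<in>{0..?n}. esym k * mvar i ^ (2 * (?n - k)))"
  proof (rule sum.cong)
    fix k
    have "?h A = (\<Prod>j\<in>A. - (mvar j ^ 2)) * mvar i ^ (2 * (?n - k))" if "card A = k" for A
      using that by (simp add: card_Diff_subset power_mult)
    then show "(\<Sum>A\<in>{A \<in> Pow UNIV. card A = k}. ?h A) = esym k * mvar i ^ (2 * (?n - k))"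
      by (simp add: esym_def sum_distrib_right)
  qed simp
  also have "\<dots> = esym 0 * mvar i ^ (2 * ?n) + (\<Sum>k=1..?n. esym k * mvar i ^ (2 * (?n - k)))"
    by (subst sum.atLeast_Suc_atMost) simp_all
  also have "esym 0 = (1 :: 'n mpoly)"
  proof -
    have "{A :: 'n set. card A = 0} = {{}}" by auto
    then show ?thesis by (simp add: esym_def)
  qed
  finally show ?thesis by (simp add: sum_negf eq_neg_iff_add_eq_0)
qed

definition monomial :: "('n \<Rightarrow> nat) \<Rightarrow> 'n::finite mpoly" where
  "monomial m = (\<Prod>i\<in>UNIV. mvar i ^ m i)"

lemma monomial_split: "monomial m = mvar i ^ m i * monomial (m(i := 0))"
proof -
  have "monomial (m(i := 0)) = (\<Prod>j\<in>UNIV - {i}. mvar j ^ m j)"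
    unfolding monomial_def by (subst prod.remove[of _ i]) auto
  moreover have "monomial m = mvar i ^ m i * (\<Prod>j\<in>UNIV - {i}. mvar j ^ m j)"
    unfolding monomial_def by (rule prod.remove) auto
  ultimately show ?thesis by simp
qed

lemma monomial_update: "monomial (m(i := k)) = mvar i ^ k * monomial (m(i := 0))"
  using monomial_split[of "m(i := k)" i] by simp

definition reduced :: "('n::finite \<Rightarrow> nat) set" where
  "reduced = {m. \<forall>i. m i < 2 * CARD('n)}"

text \<open>Generated inductively, so that stability under a variable only has to be checked on a
  single monomial with invariant coefficient.\<close>

inductive_set reduced_span :: "weyl_type \<Rightarrow> 'n::finite mpoly set" for T where
  base: "e \<in> square_invariants T \<Longrightarrow> m \<in> reduced \<Longrightarrow> e * monomial m \<in> reduced_span T"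
| add: "f \<in> reduced_span T \<Longrightarrow> g \<in> reduced_span T \<Longrightarrow> f + g \<in> reduced_span T"

lemma reduced_span_sum:
  "finite I \<Longrightarrow> I \<noteq> {} \<Longrightarrow> (\<And>i. i \<in> I \<Longrightarrow> f i \<in> reduced_span T) \<Longrightarrow> sum f I \<in> reduced_span T"
  by (induction I rule: finite_ne_induct) (auto intro: reduced_span.add)

lemma reduced_span_var: "f \<in> reduced_span T \<Longrightarrow> mvar i * f \<in> reduced_span T"
proof (induction rule: reduced_span.induct)
  case (base e m)
  let ?n = "CARD('a)"
  have step: "mvar i * (e * monomial m) = e * (mvar i ^ Suc (m i) * monomial (m(i := 0)))"
    using monomial_split[of m i] by (simp add: mult_ac)
  show ?case
  proof (cases "Suc (m i) < 2 * ?n")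
    case True
    then have "m(i := Suc (m i)) \<in> reduced" using base by (auto simp: reduced_def)
    from reduced_span.base[OF base(1) this] show ?thesis
      unfolding step monomial_update[of m i "Suc (m i)"] .
  next
    case False
    moreover have "m i < 2 * ?n" using base by (simp add: reduced_def)
    ultimately have "Suc (m i) = 2 * ?n" by linarith
    \<comment> \<open>The exponent has reached 2n and is replaced by the exponents 2(n - k), which
      lie below 2n again because k is at least 1.\<close>
    then have "mvar i * (e * monomial m) = (\<Sum>k=1..?n. (e * - esym k) * monomial (m(i := 2 * (?n - k))))"
      unfolding step monomial_update[of m i "2 * _"]
      by (simp only: var_power_eq sum_distrib_left sum_distrib_right mult.assoc)
    moreover have "(e * - esym k) * monomial (m(i := 2 * (?n - k))) \<in> reduced_span T" if "k \<in> {1..?n}" for k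
    proof (rule reduced_span.base)
      show "e * - esym k \<in> square_invariants T"
        by (intro square_invariants_closed esym_square_invariant base)
      show "m(i := 2 * (?n - k)) \<in> reduced" using base that by (auto simp: reduced_def)
    qed
    ultimately show ?thesis by (simp only:) (intro reduced_span_sum, auto simp: Suc_le_eq)
  qed
next
  case (add f g)
  then show ?case by (simp add: distrib_left reduced_span.add)
qed

lemma reduced_span_UNIV: "f \<in> reduced_span T"
proof (induction f rule: mpoly_induct)
  case (const a)
  have "(\<lambda>_. 0) \<in> reduced" by (simp add: reduced_def)
  from reduced_span.base[OF square_invariants_closed(1) this, of a T] show ?case
    by (simp add: monomial_def)
qed (auto intro: reduced_span.add reduced_span_var)

section \<open>Finiteness over the even center\<close>

lemma finite_weyl_group: "finite (weyl_group T :: (complex^'n::finite^'n) set)"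
proof (rule finite_subset)
  show "weyl_group T \<subseteq> (\<lambda>(\<pi>, \<epsilon>). signed_perm \<pi> \<epsilon>) ` (UNIV \<times> ((UNIV :: 'n set) \<rightarrow>\<^sub>E {1, -1}))"
  proof
    fix w :: "complex^'n^'n" assume "w \<in> weyl_group T"
    then obtain \<pi> \<epsilon> where "w = signed_perm \<pi> \<epsilon>" "range \<epsilon> \<subseteq> {1, -1}" by (rule weyl_group_cases)
    then show "w \<in> (\<lambda>(\<pi>, \<epsilon>). signed_perm \<pi> \<epsilon>) ` (UNIV \<times> ((UNIV :: 'n set) \<rightarrow>\<^sub>E {1, -1}))"
      by (intro image_eqI[of _ _ "(\<pi>, \<epsilon>)"]) auto
  qed
  show "finite ((\<lambda>(\<pi>, \<epsilon>). signed_perm \<pi> \<epsilon>) ` ((UNIV :: ('n \<Rightarrow> 'n) set) \<times> ((UNIV :: 'n set) \<rightarrow>\<^sub>E {1, -1 :: complex})))"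
    by (intro finite_imageI finite_cartesian_product finite_PiE) auto
qed

lemma finite_reduced: "finite (reduced :: ('n::finite \<Rightarrow> nat) set)"
proof (rule finite_subset)
  show "(reduced :: ('n \<Rightarrow> nat) set) \<subseteq> UNIV \<rightarrow>\<^sub>E {..<2 * CARD('n)}" by (auto simp: reduced_def)
  show "finite ((UNIV :: 'n set) \<rightarrow>\<^sub>E {..<2 * CARD('n)})" by (intro finite_PiE) auto
qed

lemma finite_distinct_lists: "finite {l :: 'n::finite list. distinct l}"
proof (rule finite_subset)
  show "{l :: 'n list. distinct l} \<subseteq> {l. set l \<subseteq> UNIV \<and> length l \<le> CARD('n)}"
    using card_mono[OF finite, OF subset_UNIV] by (auto simp flip: distinct_card)
  show "finite {l :: 'n list. set l \<subseteq> UNIV \<and> length l \<le> CARD('n)}"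
    by (rule finite_lists_length_le) simp
qed

abbreviation cword :: "'n::finite list \<Rightarrow> 'n rdahc_free" where
  "cword l \<equiv> prod_list (map (\<lambda>i. gen (Cgen i)) l)"

definition basis_elt :: "('n \<Rightarrow> nat) \<Rightarrow> ('n \<Rightarrow> nat) \<Rightarrow> 'n::finite list \<Rightarrow> complex^'n^'n \<Rightarrow> 'n rdahc_free" where
  "basis_elt m m' l w = eval Xgen (monomial m) * (eval Ygen (monomial m') * (cword l * fW w))"

definition spanning_set :: "weyl_type \<Rightarrow> 'n::finite rdahc_free set" where
  "spanning_set T = (\<lambda>(m, m', l, w). basis_elt m m' l w) `
     (reduced \<times> reduced \<times> {l. distinct l} \<times> weyl_group T)"

lemma finite_spanning_set: "finite (spanning_set T)"
  unfolding spanning_set_def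
  by (intro finite_imageI finite_cartesian_product finite_reduced finite_distinct_lists finite_weyl_group)

section \<open>Products of Clifford words and group elements\<close>

context hecke_congruence
begin

inductive_set clifford_weyl :: "'n rdahc_free set" where
  base: "distinct l \<Longrightarrow> w \<in> weyl_group T \<Longrightarrow> scal a * (cword l * fW w) \<in> clifford_weyl"
| add: "p \<in> clifford_weyl \<Longrightarrow> q \<in> clifford_weyl \<Longrightarrow> p + q \<in> clifford_weyl"
| eqv: "p \<in> clifford_weyl \<Longrightarrow> p \<doteq> q \<Longrightarrow> q \<in> clifford_weyl"

lemma C_cword_commute: "i \<notin> set l \<Longrightarrow> fC i * cword l \<doteq> scal ((-1) ^ length l) * (cword l * fC i)"
proof (induction l)
  case (Cons j l)
  have "fC i * cword (j # l) = (fC i * fC j) * cword l" by (simp add: mult.assoc)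
  also have "\<dots> \<doteq> - (fC j * fC i) * cword l"
    using Cons.prems by (intro eqv_mult[OF C_anticommute eqv_refl]) auto
  also have "\<dots> = - (fC j * (fC i * cword l))" by (simp add: mult.assoc)
  also have "\<dots> \<doteq> - (fC j * (scal ((-1) ^ length l) * (cword l * fC i)))"
    using Cons by (intro eqv_minus eqv_mult[OF eqv_refl]) auto
  also have "\<dots> = scal ((-1) ^ length (j # l)) * (cword (j # l) * fC i)"
    by (simp add: free.sc_left_commute[of "fC j"] free.sc_minus mult.assoc)
  finally show ?case .
qed simp

text \<open>If i occurs in l, the new factor is carried to that occurrence, where the square is 1;
  otherwise the list grows by one letter.\<close>

lemma C_cword:
  assumes "distinct l"
  obtains a l' where "distinct l'" "fC i * cword l \<doteq> scal a * cword l'"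
proof (cases "i \<in> set l")
  case False
  show ?thesis
    by (rule that[of "i # l" 1]) (use assms False in simp_all)
next
  case True
  then obtain l1 l2 where l: "l = l1 @ i # l2" by (meson split_list)
  have "fC i * cword l = (fC i * cword l1) * (fC i * cword l2)" by (simp add: l mult.assoc)
  also have "\<dots> \<doteq> scal ((-1) ^ length l1) * (cword l1 * fC i) * (fC i * cword l2)"
    using assms by (intro eqv_mult[OF C_cword_commute eqv_refl]) (simp add: l)
  also have "\<dots> = scal ((-1) ^ length l1) * (cword l1 * ((fC i * fC i) * cword l2))" by (simp add: mult.assoc)
  also have "\<dots> \<doteq> scal ((-1) ^ length l1) * (cword l1 * (1 * cword l2))"
    by (intro eqv_mult[OF eqv_refl eqv_mult[OF eqv_refl eqv_mult[OF C_square eqv_refl]]])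
  finally show ?thesis
    using assms by (intro that[of "l1 @ l2"]) (simp_all add: l)
qed

text \<open>The letters are permuted by the underlying bijection and so remain distinct; their signs
  collect in the scalar.\<close>

lemma W_cword:
  assumes "w \<in> weyl_group T" "distinct l"
  obtains a l' where "distinct l'" "fW w * cword l \<doteq> scal a * (cword l' * fW w)"
proof -
  obtain \<pi> \<epsilon> where w: "w = signed_perm \<pi> \<epsilon>" "bij \<pi>" using assms(1) by (rule weyl_group_cases) blast
  have "\<exists>a. fW w * cword l \<doteq> scal a * (cword (map \<pi> l) * fW w)" for l
  proof (induction l)
    case Nil
    show ?case by (intro exI[of _ 1]) simp
  next
    case (Cons i l)
    then obtain a where a: "fW w * cword l \<doteq> scal a * (cword (map \<pi> l) * fW w)" by blast
    have "fW w * cword (i # l) = (fW w * fC i) * cword l" by (simp add: mult.assoc)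
    also have "\<dots> \<doteq> (scal (\<epsilon> i) * (fC (\<pi> i) * fW w)) * cword l"
      using W_gen[of \<pi> \<epsilon> Cgen i] assms(1) unfolding w(1) by (intro eqv_mult[OF _ eqv_refl]) auto
    also have "\<dots> = scal (\<epsilon> i) * (fC (\<pi> i) * (fW w * cword l))" by (simp add: mult.assoc)
    also have "\<dots> \<doteq> scal (\<epsilon> i) * (fC (\<pi> i) * (scal a * (cword (map \<pi> l) * fW w)))"
      by (intro eqv_mult[OF eqv_refl eqv_mult[OF eqv_refl a]])
    also have "\<dots> = scal (\<epsilon> i * a) * (cword (map \<pi> (i # l)) * fW w)"
      by (simp add: free.sc_left_commute[of "fC _"] free.sc_mult mult.assoc)
    finally show ?case by blast
  qed
  then obtain a where "fW w * cword l \<doteq> scal a * (cword (map \<pi> l) * fW w)" by blast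
  moreover have "distinct (map \<pi> l)"
    using assms(2) w(2) by (simp add: distinct_map inj_on_subset[OF bij_is_inj])
  ultimately show ?thesis by (intro that)
qed

lemma C_clifford_weyl: "q \<in> clifford_weyl \<Longrightarrow> fC i * q \<in> clifford_weyl"
proof (induction rule: clifford_weyl.induct)
  case (base l w a)
  obtain b l' where l': "distinct l'" "fC i * cword l \<doteq> scal b * cword l'"
    using base(1) by (rule C_cword)
  have "scal (a * b) * (cword l' * fW w) = scal a * ((scal b * cword l') * fW w)"
    by (simp add: free.sc_mult mult.assoc)
  also have "\<dots> \<doteq> scal a * ((fC i * cword l) * fW w)"
    by (intro eqv_mult[OF eqv_refl eqv_mult[OF eqv_sym[OF l'(2)] eqv_refl]])
  also have "\<dots> = fC i * (scal a * (cword l * fW w))"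
    by (simp add: free.sc_left_commute[of "fC i"] mult.assoc)
  finally show ?case using clifford_weyl.base[OF l'(1) base(2)] by (rule clifford_weyl.eqv[rotated])
next
  case (add p q)
  then show ?case by (simp add: distrib_left clifford_weyl.add)
next
  case (eqv p q)
  from eqv(3) eqv_mult[OF eqv_refl eqv(2)] show ?case by (rule clifford_weyl.eqv)
qed

lemma W_clifford_weyl:
  assumes "w' \<in> weyl_group T"
  shows "q \<in> clifford_weyl \<Longrightarrow> fW w' * q \<in> clifford_weyl"
proof (induction rule: clifford_weyl.induct)
  case (base l w a)
  obtain b l' where l': "distinct l'" "fW w' * cword l \<doteq> scal b * (cword l' * fW w')"
    using assms base(1) by (rule W_cword)
  have "scal (a * b) * (cword l' * fW (w' ** w)) = scal a * (scal b * (cword l' * fW (w' ** w)))"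
    by (simp add: free.sc_mult mult.assoc)
  also have "\<dots> \<doteq> scal a * (scal b * (cword l' * (fW w' * fW w)))"
    by (intro eqv_mult[OF eqv_refl eqv_mult[OF eqv_refl eqv_mult[OF eqv_refl eqv_sym[OF W_mult]]]] assms base)
  also have "\<dots> = scal a * ((scal b * (cword l' * fW w')) * fW w)" by (simp add: mult.assoc)
  also have "\<dots> \<doteq> scal a * ((fW w' * cword l) * fW w)"
    by (intro eqv_mult[OF eqv_refl eqv_mult[OF eqv_sym[OF l'(2)] eqv_refl]])
  also have "\<dots> = fW w' * (scal a * (cword l * fW w))"
    by (simp add: free.sc_left_commute[of "fW w'"] mult.assoc)
  finally show ?case
    using clifford_weyl.base[OF l'(1) weyl_group_mult[OF assms base(2)]] by (rule clifford_weyl.eqv[rotated])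
next
  case (add p q)
  then show ?case by (simp add: distrib_left clifford_weyl.add)
next
  case (eqv p q)
  from eqv(3) eqv_mult[OF eqv_refl eqv(2)] show ?case by (rule clifford_weyl.eqv)
qed

lemma term_clifford_weyl: "t \<in> terms T i \<Longrightarrow> q \<in> clifford_weyl \<Longrightarrow> term_elt i t * q \<in> clifford_weyl"
  using term_reflection_in_weyl_group[of "fst t" "fst (snd t)" "snd (snd t)" i]
  by (auto simp: term_elt_def mult.assoc split: prod.splits intro!: C_clifford_weyl W_clifford_weyl)

lemma one_clifford_weyl: "1 \<in> clifford_weyl"
  using clifford_weyl.base[of "[]" "mat 1" 1] W_1 weyl_group_one
  by (auto intro: clifford_weyl.eqv simp del: weyl_group.simps)

section \<open>Reordering of arbitrary products\<close>

inductive_set ordered_span :: "'n rdahc_free set" where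
  base: "q \<in> clifford_weyl \<Longrightarrow> eval Xgen f * (eval Ygen g * q) \<in> ordered_span"
| add: "p \<in> ordered_span \<Longrightarrow> q \<in> ordered_span \<Longrightarrow> p + q \<in> ordered_span"
| eqv: "p \<in> ordered_span \<Longrightarrow> p \<doteq> q \<Longrightarrow> q \<in> ordered_span"

lemma ordered_span_sum:
  "(\<And>i. i \<in> I \<Longrightarrow> f i \<in> ordered_span) \<Longrightarrow> sum f I \<in> ordered_span"
proof (induction I rule: infinite_finite_induct)
  case (insert x F)
  then show ?case by (auto intro: ordered_span.add)
qed (use ordered_span.base[OF one_clifford_weyl, of 0] in simp_all)

lemma ordered_span_mult:
  assumes "\<And>f g q. q \<in> clifford_weyl \<Longrightarrow> A * (eval Xgen f * (eval Ygen g * q)) \<in> ordered_span"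
  shows "p \<in> ordered_span \<Longrightarrow> A * p \<in> ordered_span"
proof (induction rule: ordered_span.induct)
  case (base q f g)
  then show ?case by (rule assms)
next
  case (add p q)
  then show ?case by (simp add: distrib_left ordered_span.add)
next
  case (eqv p q)
  from eqv(3) eqv_mult[OF eqv_refl eqv(2)] show ?case by (rule ordered_span.eqv)
qed

text \<open>Such an A passes both polynomials without creating new terms and is absorbed on the
  right; this covers the c_i and the group elements.\<close>

lemma moves_ordered_span:
  assumes X: "moves True A w" and Y: "moves False A w'" and A: "\<And>q. q \<in> clifford_weyl \<Longrightarrow> A * q \<in> clifford_weyl"
  shows "p \<in> ordered_span \<Longrightarrow> A * p \<in> ordered_span"
proof (rule ordered_span_mult)
  fix f g q assume q: "q \<in> clifford_weyl"
  have "A * (eval Xgen f * (eval Ygen g * q)) = (A * eval Xgen f) * (eval Ygen g * q)" by (simp add: mult.assoc)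
  also have "\<dots> \<doteq> (eval Xgen (mact w f) * A) * (eval Ygen g * q)"
    using movesD[OF X, of f] by (intro eqv_mult[OF _ eqv_refl]) simp
  also have "\<dots> = eval Xgen (mact w f) * ((A * eval Ygen g) * q)" by (simp add: mult.assoc)
  also have "\<dots> \<doteq> eval Xgen (mact w f) * ((eval Ygen (mact w' g) * A) * q)"
    using movesD[OF Y, of g] by (intro eqv_mult[OF eqv_refl eqv_mult[OF _ eqv_refl]]) simp
  also have "\<dots> = eval Xgen (mact w f) * (eval Ygen (mact w' g) * (A * q))" by (simp add: mult.assoc)
  finally show "A * (eval Xgen f * (eval Ygen g * q)) \<in> ordered_span"
    using ordered_span.base[OF A[OF q]] by (blast intro: ordered_span.eqv eqv_sym)
qed

lemma scal_ordered_span: "p \<in> ordered_span \<Longrightarrow> scal a * p \<in> ordered_span"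
proof (rule ordered_span_mult)
  fix f g q assume q: "q \<in> clifford_weyl"
  have "eval Xgen (mconst a * f) * (eval Ygen g * q) \<doteq> (scal a * eval Xgen f) * (eval Ygen g * q)"
    using eval_const_mult[of True a f] by (intro eqv_mult[OF _ eqv_refl]) simp
  then show "scal a * (eval Xgen f * (eval Ygen g * q)) \<in> ordered_span"
    using ordered_span.base[OF q] by (auto simp: mult.assoc intro: ordered_span.eqv)
qed

lemma X_ordered_span: "p \<in> ordered_span \<Longrightarrow> gen (Xgen i) * p \<in> ordered_span"
proof (rule ordered_span_mult)
  fix f g q assume q: "q \<in> clifford_weyl"
  have "eval Xgen (mvar i * f) * (eval Ygen g * q) \<doteq> (gen (Xgen i) * eval Xgen f) * (eval Ygen g * q)"
    using eval_var_mult[of True i f] by (intro eqv_mult[OF _ eqv_refl]) simp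
  then show "gen (Xgen i) * (eval Xgen f * (eval Ygen g * q)) \<in> ordered_span"
    using ordered_span.base[OF q] by (auto simp: mult.assoc intro: ordered_span.eqv)
qed

text \<open>The correction terms of [y_i, f(x)] contain no further y, only elements
  \<open>term_elt\<close>. These move past g(y) by a reflection and are absorbed on the right, so
  one use of the commutator formula suffices.\<close>

lemma Y_ordered_span: "p \<in> ordered_span \<Longrightarrow> gen (Ygen i) * p \<in> ordered_span"
proof (rule ordered_span_mult)
  fix f g q assume q: "q \<in> clifford_weyl"
  let ?d = "\<lambda>t. dd (term_sign True t) (fst t) i f"
  let ?E = "\<lambda>t. scal (term_coeff True u v i t) * (eval Xgen (?d t) * (term_elt i t * (eval Ygen g * q)))"
  have "gen (Ygen i) * (eval Xgen f * (eval Ygen g * q)) = (gen (Ygen i) * eval Xgen f) * (eval Ygen g * q)"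
    by (simp add: mult.assoc)
  also have "\<dots> \<doteq> (eval Xgen f * gen (Ygen i)
      + (\<Sum>t\<in>terms T i. scal (term_coeff True u v i t) * (eval Xgen (?d t) * term_elt i t))) * (eval Ygen g * q)"
    using mom_eval[of True i f] by (intro eqv_mult[OF _ eqv_refl]) simp
  also have "\<dots> = eval Xgen f * ((gen (Ygen i) * eval Ygen g) * q) + sum ?E (terms T i)"
    by (simp only: distrib_right sum_distrib_right mult.assoc)
  also have "\<dots> \<doteq> eval Xgen f * (eval Ygen (mvar i * g) * q) + sum ?E (terms T i)"
    using eqv_sym[OF eval_var_mult[of False i g]]
    by (intro eqv_add[OF eqv_mult[OF eqv_refl eqv_mult[OF _ eqv_refl]] eqv_refl]) simp
  finally have *: "gen (Ygen i) * (eval Xgen f * (eval Ygen g * q))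
      \<doteq> eval Xgen f * (eval Ygen (mvar i * g) * q) + sum ?E (terms T i)" .
  have "?E t \<in> ordered_span" if t: "t \<in> terms T i" for t
  proof (rule scal_ordered_span)
    have "eval Xgen (?d t) * (eval Ygen (mact (reflection (term_sign False t) (fst t) i) g) * (term_elt i t * q))
      = eval Xgen (?d t) * ((eval Ygen (mact (reflection (term_sign False t) (fst t) i) g) * term_elt i t) * q)"
      by (simp add: mult.assoc)
    also have "\<dots> \<doteq> eval Xgen (?d t) * ((term_elt i t * eval Ygen g) * q)"
      using eqv_sym[OF movesD[OF moves_term[OF t], of False g]]
      by (intro eqv_mult[OF eqv_refl eqv_mult[OF _ eqv_refl]]) simp
    finally show "eval Xgen (?d t) * (term_elt i t * (eval Ygen g * q)) \<in> ordered_span"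
      using ordered_span.base[OF term_clifford_weyl[OF t q]]
      by (auto simp: mult.assoc intro: ordered_span.eqv)
  qed
  then have "eval Xgen f * (eval Ygen (mvar i * g) * q) + sum ?E (terms T i) \<in> ordered_span"
    by (intro ordered_span.add ordered_span.base ordered_span_sum q)
  from this eqv_sym[OF *] show "gen (Ygen i) * (eval Xgen f * (eval Ygen g * q)) \<in> ordered_span"
    by (rule ordered_span.eqv)
qed

text \<open>The ordered span contains 1 and is stable under left multiplication by every generator,
  hence it contains every word.\<close>

lemma ordered_span_carrier: "a \<in> carrier (rdahc_free_algebra T) \<Longrightarrow> a \<in> ordered_span"
proof (induction rule: free_algebra_induct)
  case zero
  show ?case using ordered_span_sum[of "{}"] by simp
next
  case (add f g)
  then show ?case by (rule ordered_span.add)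
next
  case (word a l)
  have "prod_list (map gen l) \<in> ordered_span"
    using word
  proof (induction l)
    case Nil
    show ?case using ordered_span.base[OF one_clifford_weyl, of 1 1] by simp
  next
    case (Cons g l)
    have C: "fC i * p \<in> ordered_span" if "p \<in> ordered_span" for i p
      by (rule moves_ordered_span[OF moves_C moves_C]) (auto intro: C_clifford_weyl that)
    have W: "fW w * p \<in> ordered_span" if "p \<in> ordered_span" "w \<in> weyl_group T" for w p
      by (rule moves_ordered_span[OF moves_W[OF that(2)] moves_W[OF that(2)]])
        (auto intro: W_clifford_weyl that simp del: weyl_group.simps)
    have "prod_list (map gen l) \<in> ordered_span" using Cons by simp
    moreover have "g \<in> rdahc_gens T" using Cons.prems by simp
    ultimately show ?case
      unfolding rdahc_gens_def by (auto intro: C W X_ordered_span Y_ordered_span simp del: weyl_group.simps)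
  qed
  then show ?case by (rule scal_ordered_span)
qed

section \<open>Combinations with central coefficients\<close>

definition central_span :: "'n rdahc_free set \<Rightarrow> 'n rdahc_free set" where
  "central_span B = {a. \<exists>z. (\<forall>s\<in>B. z s \<in> central) \<and> a \<doteq> (\<Sum>s\<in>B. z s * s)}"

lemma central_spanI:
  "\<forall>s\<in>B. z s \<in> central \<Longrightarrow> a \<doteq> (\<Sum>s\<in>B. z s * s) \<Longrightarrow> a \<in> central_span B"
  unfolding central_span_def by (intro CollectI exI[of _ z] conjI)

lemma central_span_eqv: "a \<in> central_span B \<Longrightarrow> a \<doteq> b \<Longrightarrow> b \<in> central_span B"
  unfolding central_span_def by (blast intro: eqv_trans[OF eqv_sym])

lemma central_span_add:
  assumes "a \<in> central_span B" "b \<in> central_span B"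
  shows "a + b \<in> central_span B"
proof -
  obtain z z' where "\<forall>s\<in>B. z s \<in> central" "a \<doteq> (\<Sum>s\<in>B. z s * s)" "\<forall>s\<in>B. z' s \<in> central" "b \<doteq> (\<Sum>s\<in>B. z' s * s)"
    using assms unfolding central_span_def by blast
  then have "a + b \<doteq> (\<Sum>s\<in>B. (z s + z' s) * s)" "\<forall>s\<in>B. z s + z' s \<in> central"
    using eqv_add[of a "\<Sum>s\<in>B. z s * s" b "\<Sum>s\<in>B. z' s * s"]
    by (simp_all add: distrib_right sum.distrib central_closed)
  then show ?thesis by (intro central_spanI[of B "\<lambda>s. z s + z' s"])
qed

lemma central_span_mult:
  assumes "c \<in> central" "a \<in> central_span B"
  shows "c * a \<in> central_span B"
proof -
  obtain z where "\<forall>s\<in>B. z s \<in> central" "a \<doteq> (\<Sum>s\<in>B. z s * s)"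
    using assms unfolding central_span_def by blast
  then have "c * a \<doteq> (\<Sum>s\<in>B. (c * z s) * s)" "\<forall>s\<in>B. c * z s \<in> central"
    using eqv_mult[OF eqv_refl, of a "\<Sum>s\<in>B. z s * s" c] assms(1)
    by (simp_all add: sum_distrib_left mult.assoc central_closed)
  then show ?thesis by (intro central_spanI[of B "\<lambda>s. c * z s"])
qed

lemma central_span_base:
  assumes "finite B" "b \<in> B"
  shows "b \<in> central_span B"
proof -
  have "(\<Sum>s\<in>B. (if s = b then 1 else 0) * s) = (\<Sum>s\<in>B. if s = b then s else 0)"
    by (rule sum.cong) auto
  also have "\<dots> = b" using assms by simp
  finally have "b \<doteq> (\<Sum>s\<in>B. (if s = b then 1 else 0) * s)" by simp
  moreover have "1 \<in> central" "0 \<in> central" using central_closed(1)[of 1] central_closed(1)[of 0] by simp_all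
  then have "\<forall>s\<in>B. (if s = b then 1 else 0) \<in> central" by simp
  ultimately show ?thesis by (intro central_spanI[of B "\<lambda>s. if s = b then 1 else 0"])
qed

text \<open>\<open>B\<close> only has to represent the spanning elements up to congruence, which
  permits a choice without two members in the same class. Expanding g and f over
  \<open>reduced\<close> exponents produces coefficients that are evaluations of square invariants
  and hence central.\<close>

lemma central_span_carrier:
  assumes B: "finite B" and sp: "\<And>b. b \<in> spanning_set T \<Longrightarrow> \<exists>b'\<in>B. b \<doteq> b'"
    and a: "a \<in> carrier (rdahc_free_algebra T)"
  shows "a \<in> central_span B"
proof -
  let ?X = "\<lambda>m. eval Xgen (monomial m)" and ?Y = "\<lambda>m. eval Ygen (monomial m)"
  have 1: "?X m * (?Y m' * q) \<in> central_span B"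
    if m: "m \<in> reduced" "m' \<in> reduced" and q: "q \<in> clifford_weyl" for m m' q
    using q
  proof (induction rule: clifford_weyl.induct)
    case (base l w a)
    have "basis_elt m m' l w \<in> spanning_set T"
      using m base unfolding spanning_set_def by (intro image_eqI[of _ _ "(m, m', l, w)"]) auto
    then obtain b where b: "b \<in> B" "basis_elt m m' l w \<doteq> b" using sp by blast
    have "basis_elt m m' l w \<in> central_span B"
      by (rule central_span_eqv[OF central_span_base[OF B b(1)] eqv_sym[OF b(2)]])
    from central_span_mult[OF central_closed(1) this, of a] show ?case
      by (simp add: basis_elt_def free.sc_left_commute[of "eval _ _"])
  next
    case (add p q)
    then show ?case by (simp add: distrib_left central_span_add)
  next
    case (eqv p q)
    from eqv(3) eqv_mult[OF eqv_refl eqv_mult[OF eqv_refl eqv(2)]] show ?case by (rule central_span_eqv)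
  qed
  have 2: "?X m * (eval Ygen g * q) \<in> central_span B"
    if m: "m \<in> reduced" and q: "q \<in> clifford_weyl" and g: "g \<in> reduced_span T" for m g q
    using g
  proof (induction rule: reduced_span.induct)
    case (base e m')
    have e: "fixed False e" using base(1) by (rule fixed_square)
    have X: "?X m \<in> carrier (rdahc_free_algebra T)" using eval_pos_closed[of True] by simp
    \<comment> \<open>The invariant e(y) stands to the right of a monomial in x and is taken out
      across it by centrality.\<close>
    have "eval Ygen e * (?X m * (?Y m' * q)) = (eval Ygen e * ?X m) * (?Y m' * q)" by (simp add: mult.assoc)
    also have "\<dots> \<doteq> (?X m * eval Ygen e) * (?Y m' * q)"
      using eqv_sym[OF eval_central[OF e X]] by (intro eqv_mult[OF _ eqv_refl]) simp
    also have "\<dots> = ?X m * ((eval Ygen e * ?Y m') * q)" by (simp add: mult.assoc)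
    also have "\<dots> \<doteq> ?X m * (eval Ygen (e * monomial m') * q)"
      using eqv_sym[OF eval_mult[of False e "monomial m'"]] by (intro eqv_mult[OF eqv_refl eqv_mult[OF _ eqv_refl]]) simp
    finally have "eval Ygen e * (?X m * (?Y m' * q)) \<doteq> ?X m * (eval Ygen (e * monomial m') * q)" .
    moreover have "eval Ygen e \<in> central" using eval_in_central[OF e] by simp
    ultimately show ?case
      using central_span_eqv[OF central_span_mult[OF _ 1[OF m base(2) q]]] by simp
  next
    case (add f g)
    then show ?case by (simp add: eval_add distrib_left distrib_right central_span_add)
  qed
  have 3: "eval Xgen f * (eval Ygen g * q) \<in> central_span B"
    if q: "q \<in> clifford_weyl" and f: "f \<in> reduced_span T" for f g q
    using f
  proof (induction rule: reduced_span.induct)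
    case (base e m)
    have "eval Xgen e * (?X m * (eval Ygen g * q)) \<doteq> eval Xgen (e * monomial m) * (eval Ygen g * q)"
      using eqv_mult[OF eqv_sym[OF eval_mult[of True e "monomial m"]] eqv_refl[of "eval Ygen g * q"]]
      by (simp add: mult.assoc)
    moreover have "eval Xgen e \<in> central" using eval_in_central[OF fixed_square[OF base(1), of True]] by simp
    ultimately show ?case
      using central_span_eqv[OF central_span_mult[OF _ 2[OF base(2) q reduced_span_UNIV]]] by simp
  next
    case (add f g)
    then show ?case by (simp add: eval_add distrib_right central_span_add)
  qed
  from ordered_span_carrier[OF a] show ?thesis
  proof (induction rule: ordered_span.induct)
    case (base q f g)
    then show ?case by (rule 3[OF _ reduced_span_UNIV])
  next
    case (add p q)
    from add(3,4) show ?case by (rule central_span_add)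
  next
    case (eqv p q)
    from eqv(3,2) show ?case by (rule central_span_eqv)
  qed
qed

end

section \<open>Passage to the quotient ring\<close>

lemma spanning_set_closed: "(spanning_set T :: 'n::finite rdahc_free set) \<subseteq> carrier (rdahc_free_algebra T)"
proof -
  have X: "eval Xgen f \<in> carrier (rdahc_free_algebra T)" and Y: "eval Ygen f \<in> carrier (rdahc_free_algebra T)" for f :: "'n mpoly"
    using hecke_congruence.eval_pos_closed[OF hecke_congruence_rel_ideal, of True f T]
      hecke_congruence.eval_pos_closed[OF hecke_congruence_rel_ideal, of False f T] by simp_all
  show ?thesis
    unfolding spanning_set_def basis_elt_def
    by (auto intro!: free_algebra_closed(6) X Y prod_list_closed rdahc_gens_closed simp del: weyl_group.simps)
qed

lemma class_closed:
  "f \<in> carrier (rdahc_free_algebra T) \<Longrightarrow> rdahc_class T u v f \<in> carrier (rdahc_algebra T u v)"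
  unfolding carrier_rdahc_algebra by (rule imageI)

lemma class_sum:
  assumes "finite A" "\<And>i. i \<in> A \<Longrightarrow> f i \<in> carrier (rdahc_free_algebra T)"
  shows "rdahc_class T u v (sum f A) = (\<Oplus>\<^bsub>rdahc_algebra T u v\<^esub>i\<in>A. rdahc_class T u v (f i))"
proof -
  interpret R: ring "rdahc_algebra T u v" by (rule ring_rdahc_algebra)
  show ?thesis
    using assms
  proof (induction A rule: finite_induct)
    case empty
    show ?case
      using ring_hom_zero[OF rdahc_class_ring_hom ring_free_algebra R.ring_axioms] by simp
  next
    case (insert x A)
    have "rdahc_class T u v (sum f (insert x A)) = rdahc_class T u v (f x + sum f A)"
      using insert by simp
    also have "\<dots> = rdahc_class T u v (f x) \<oplus>\<^bsub>rdahc_algebra T u v\<^esub> rdahc_class T u v (sum f A)"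
      by (rule class_add[symmetric]) (use insert in \<open>auto intro: free_algebra_sum_closed\<close>)
    finally show ?case using insert by (simp add: R.finsum_insert Pi_def class_closed)
  qed
qed

lemma module_finite_rdahc_algebra:
  "module_finite_over (rdahc_algebra T u v :: 'n::finite rdahc ring) (rdahc_even_center T u v)"
proof -
  interpret hecke_congruence "rel_ideal T u v :: 'n rdahc_free set" T u v by (rule hecke_congruence_rel_ideal)
  interpret R: ring "rdahc_algebra T u v :: 'n rdahc ring" by (rule ring_rdahc_algebra)
  let ?c = "rdahc_class T u v :: 'n rdahc_free \<Rightarrow> 'n rdahc"
  \<comment> \<open>Several spanning elements may share a class, while a sum over classes counts
    each class once; hence one representative per class is selected.\<close>
  have "\<exists>B\<subseteq>spanning_set T. inj_on ?c B \<and> ?c ` spanning_set T = ?c ` B"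
    by (rule iffD1[OF subset_image_inj order_refl])
  then obtain B where B: "B \<subseteq> spanning_set T" "inj_on ?c B" "?c ` spanning_set T = ?c ` B"
    by (elim exE conjE) (rule that)
  have fin: "finite B" using B(1) finite_spanning_set by (rule finite_subset)
  have Bc: "B \<subseteq> carrier (rdahc_free_algebra T)" using B(1) spanning_set_closed by blast
  have sp: "\<exists>b'\<in>B. eqv b b'" if "b \<in> spanning_set T" for b
  proof -
    have "?c b \<in> ?c ` B" using that unfolding B(3)[symmetric] by (rule imageI)
    then obtain b' where b': "b' \<in> B" "?c b = ?c b'" by blast
    have "b \<in> carrier (rdahc_free_algebra T)" "b' \<in> carrier (rdahc_free_algebra T)"
      using Bc b'(1) spanning_set_closed that by blast+
    then have "eqv b b'" using b'(2) by (simp only: rdahc_class_eq_iff)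
    with b'(1) show ?thesis ..
  qed
  have "\<exists>z\<in>?c ` B \<rightarrow> rdahc_even_center T u v. a = (\<Oplus>\<^bsub>rdahc_algebra T u v\<^esub>s\<in>?c ` B. z s \<otimes>\<^bsub>rdahc_algebra T u v\<^esub> s)"
    if aR: "a \<in> carrier (rdahc_algebra T u v)" for a
  proof -
    obtain f where f: "f \<in> carrier (rdahc_free_algebra T)" "a = ?c f"
      using aR unfolding carrier_rdahc_algebra by blast
    have "f \<in> central_span B" by (rule central_span_carrier[OF fin sp f(1)])
    then obtain z where z: "\<forall>s\<in>B. z s \<in> central" "eqv f (\<Sum>s\<in>B. z s * s)"
      unfolding central_span_def by blast
    have zc: "z s \<in> carrier (rdahc_free_algebra T)" if "s \<in> B" for s
      using z(1) that by (auto simp: central_def)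
    have prod: "?c (z b * b) = ?c (z b) \<otimes>\<^bsub>rdahc_algebra T u v\<^esub> ?c b"
      "?c (z b) \<otimes>\<^bsub>rdahc_algebra T u v\<^esub> ?c b \<in> carrier (rdahc_algebra T u v)" if "b \<in> B" for b
      using that Bc zc[OF that] by (auto simp: class_mult intro: class_closed)
    \<comment> \<open>Coefficients have to be functions of the class, so they are read off at its
      unique representative in \<open>B\<close>.\<close>
    define z' where "z' s = ?c (z (inv_into B ?c s))" for s
    have z'_class: "z' (?c b) = ?c (z b)" if "b \<in> B" for b
      using that B(2) by (simp add: z'_def inv_into_f_f)
    have "a = ?c (\<Sum>s\<in>B. z s * s)"
    proof -
      have "(\<Sum>s\<in>B. z s * s) \<in> carrier (rdahc_free_algebra T)"
        using Bc zc by (intro free_algebra_sum_closed free_algebra_closed(6)) auto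
      then show ?thesis unfolding f(2) using z(2) by (simp only: rdahc_class_eq_iff f(1))
    qed
    also have "\<dots> = (\<Oplus>\<^bsub>rdahc_algebra T u v\<^esub>b\<in>B. ?c (z b * b))"
      using Bc zc fin by (intro class_sum free_algebra_closed(6)) auto
    also have "\<dots> = (\<Oplus>\<^bsub>rdahc_algebra T u v\<^esub>b\<in>B. z' (?c b) \<otimes>\<^bsub>rdahc_algebra T u v\<^esub> ?c b)"
      by (intro R.finsum_cong') (auto simp: z'_class prod)
    also have "\<dots> = (\<Oplus>\<^bsub>rdahc_algebra T u v\<^esub>s\<in>?c ` B. z' s \<otimes>\<^bsub>rdahc_algebra T u v\<^esub> s)"
      by (intro R.finsum_reindex[symmetric] B(2)) (auto simp: z'_class prod)
    finally have "a = (\<Oplus>\<^bsub>rdahc_algebra T u v\<^esub>s\<in>?c ` B. z' s \<otimes>\<^bsub>rdahc_algebra T u v\<^esub> s)" .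
    moreover have "z' \<in> ?c ` B \<rightarrow> rdahc_even_center T u v"
      using z(1) by (auto simp: z'_class intro!: central_class)
    ultimately show ?thesis by blast
  qed
  moreover have "finite (?c ` B)" "?c ` B \<subseteq> carrier (rdahc_algebra T u v)"
    using fin Bc by (auto intro: class_closed)
  ultimately show ?thesis unfolding module_finite_over_def by blast
qed

theorem proposition4p18:
  fixes T :: weyl_type and u v :: complex
  assumes "admissible T CARD('n::finite)"
  shows "embeds_in_even_center T u v Ygen (invariants T :: 'n mpoly set)
    \<and> embeds_in_even_center T u v Xgen (square_invariants T :: 'n mpoly set)
    \<and> module_finite_over (rdahc_algebra T u v :: 'n rdahc ring) (rdahc_even_center T u v)"
proof (intro conjI)
  note hecke = hecke_congruence_rel_ideal[of T u v, where 'a = 'n]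
  have "embeds_in_even_center T u v (if False then Xgen else Ygen) (invariants T :: 'n mpoly set)"
    by (rule embeds_in_even_centerI) (rule hecke_congruence.fixed_Y[OF hecke])
  then show "embeds_in_even_center T u v Ygen (invariants T :: 'n mpoly set)" by simp
  have "embeds_in_even_center T u v (if True then Xgen else Ygen) (square_invariants T :: 'n mpoly set)"
    by (rule embeds_in_even_centerI) (rule hecke_congruence.fixed_square[OF hecke])
  then show "embeds_in_even_center T u v Xgen (square_invariants T :: 'n mpoly set)" by simp
qed (rule module_finite_rdahc_algebra)

end
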